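(* Every Artin--Tits presentation $(S,R)$ of type FC satisfies Property H: for every word $w$ of $\mathcal W(S)$ that represents $1$ in the group $\langle S\mid R\rangle$, the relation $w\rightsquigarrow^{0,1,2}_R\varepsilon$ holds.
   Context: For a set $S$, $\mathcal W^+(S)$ is the free monoid of all words in the alphabet $S$, and $\mathcal W(S)$ is the free monoid of all words in $S\sqcup S^{-1}$, where $S^{-1}$ is a disjoint copy of $S$ with one letter $s^{-1}$ for each $s\in S$. The empty word is $\varepsilon$; $w^{-1}$ is obtained from $w$ by exchanging $s$ and $s^{-1}$ everywhere and reversing the order of letters. A factor of a word is a contiguous subword. A presentation $(S,R)$ is positive if every relation of $R$ is of the form $v=v'$ with $v,v'$ nonempty words of $\mathcal W^+(S)$ (relations are unoriented). $\langle S\mid R\rangle$ is the group it presents. Special transformations on words of $\mathcal W(S)$: - type $0$: remove some pair $s^{-1}s$ or $ss^{-1}$ with $s\in S$; - type $1$: replace some factor $v$ by $v'$, or $v^{-1}$ by $v'^{-1}$, where $v=v'$ is a relation of $R$; - type $2_r$: replace some factor $v^{-1}v'$ by $uu'^{-1}$, where $v,v'$ are nonempty words of $\mathcal W^+(S)$ and $vu=v'u'$ is a relation of $R$; - type $2_\ell$: replace some factor $vv'^{-1}$ by $u^{-1}u'$, where $v,v'$ are nonempty words of $\mathcal W^+(S)$ and $uv=u'v'$ is a relation of $R$. Type $2$ means $2_r$ or $2_\ell$. One writes $w\rightsquigarrow^{0,1,2}_R w'$ if $w$ can be transformed to $w'$ by a finite (possibly empty) sequence of special transformations of types $0$, $1$,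 $2$. An Artin--Tits presentation is a presentation $(S,R)$ in which $R$ consists of relations $sts\cdots=tst\cdots$ with $s\ne t$ in $S$, both sides being alternating words in $s,t$ of the same length at least $2$, with at most one such relation for each pair $\{s,t\}$. It is of spherical type if the associated Coxeter group, i.e. the quotient of $\langle S\mid R\rangle$ obtained by adding the relations $s^2=1$ for all $s\in S$, is finite. Type FC: the family of Artin--Tits groups of type FC is the smallest class of groups that contains all Artin--Tits groups of spherical type and is closed under forming amalgamated products over a standard parabolic subgroup. In terms of presentations: the Artin--Tits presentations of type FC form the smallest family that contains all Artin--Tits presentations of spherical type and contains $(S_1\cup S_2,R_1\cup R_2)$ whenever it contains $(S_1,R_1)$ and $(S_2,R_2)$ and these are in amalgam position, i.e. the identity map of $S_1\cap S_2$ induces an isomorphism from the subgroup of $\langle S_1\mid R_1\rangle$ generated by $S_1\cap S_2$ onto the subgroup of $\langle S_2\mid R_2\rangle$ generated by $S_1\cap S_2$. (For Artin--Tits presentations, by results of van der Lek, this holds if and only if the relations of $R_1$ and of $R_2$ that involve only generators in $S_1\cap S_2$ coincide.) *)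

theory Defs
  imports "HOL-Library.Uprod" "HOL-Algebra.Generated_Groups"
begin

section \<open>Words\<close>

datatype 'a letter = Pos 'a | Neg 'a

fun inv_letter :: "'a letter \<Rightarrow> 'a letter" where
  "inv_letter (Pos s) = Neg s"
| "inv_letter (Neg s) = Pos s"

text \<open>\<open>words S\<close> is the free monoid on \<open>S\<close> together with its disjoint copy of inverse letters. The
  positive words on \<open>S\<close> are the elements of \<open>lists S\<close>, embedded by \<open>pos\<close>.\<close>

definition words :: "'a set \<Rightarrow> 'a letter list set" where
  "words S = lists (Pos ` S \<union> Neg ` S)"

definition pos :: "'a list \<Rightarrow> 'a letter list" where
  "pos v = map Pos v"

definition inv_word :: "'a letter list \<Rightarrow> 'a letter list" where
  "inv_word w = rev (map inv_letter w)"

section \<open>Presented groups\<close>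

text \<open>A presentation is a pair \<open>(S, R)\<close>, where the relation \<open>v = v'\<close> between positive words is the
  unordered pair \<open>Upair v v'\<close>. The congruence below is the one generated on \<open>words S\<close> by the
  relations and by free cancellation.\<close>

inductive pres_eq :: "'a set \<Rightarrow> 'a list uprod set \<Rightarrow> 'a letter list \<Rightarrow> 'a letter list \<Rightarrow> bool"
  for S :: "'a set" and R :: "'a list uprod set" where
  pos_neg: "s \<in> S \<Longrightarrow> pres_eq S R [Pos s, Neg s] []"
| neg_pos: "s \<in> S \<Longrightarrow> pres_eq S R [Neg s, Pos s] []"
| relation: "Upair v v' \<in> R \<Longrightarrow> v \<in> lists S \<Longrightarrow> v' \<in> lists S \<Longrightarrow> pres_eq S R (pos v) (pos v')"
| refl: "w \<in> words S \<Longrightarrow> pres_eq S R w w"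
| sym: "pres_eq S R w w' \<Longrightarrow> pres_eq S R w' w"
| trans: "pres_eq S R w w' \<Longrightarrow> pres_eq S R w' w'' \<Longrightarrow> pres_eq S R w w''"
| append: "pres_eq S R a a' \<Longrightarrow> pres_eq S R b b' \<Longrightarrow> pres_eq S R (a @ b) (a' @ b')"

definition word_class :: "'a set \<Rightarrow> 'a list uprod set \<Rightarrow> 'a letter list \<Rightarrow> 'a letter list set" where
  "word_class S R w = {w'. pres_eq S R w w'}"

definition pres_group :: "'a set \<Rightarrow> 'a list uprod set \<Rightarrow> 'a letter list set monoid" where
  "pres_group S R =
    \<lparr>carrier = word_class S R ` words S,
     mult = (\<lambda>A B. \<Union>a\<in>A. \<Union>b\<in>B. word_class S R (a @ b)),
     one = word_class S R []\<rparr>"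

lemma words_simps [simp]:
  "[] \<in> words S"
  "Pos s # w \<in> words S \<longleftrightarrow> s \<in> S \<and> w \<in> words S"
  "Neg s # w \<in> words S \<longleftrightarrow> s \<in> S \<and> w \<in> words S"
  "a @ b \<in> words S \<longleftrightarrow> a \<in> words S \<and> b \<in> words S"
  by (auto simp: words_def)

lemma pos_words [simp]: "pos v \<in> words S \<longleftrightarrow> v \<in> lists S"
  by (induction v) (auto simp: pos_def)

lemma inv_word_words [simp]: "inv_word w \<in> words S \<longleftrightarrow> w \<in> words S"
proof (induction w)
  case Nil
  show ?case by (simp add: inv_word_def)
next
  case (Cons x w)
  then show ?case by (cases x) (auto simp: inv_word_def)
qed

lemma pres_eq_words: "pres_eq S R w w' \<Longrightarrow> w \<in> words S \<and> w' \<in> words S"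
  by (induction rule: pres_eq.induct) simp_all

lemma word_class_eq_iff:
  assumes "w \<in> words S"
  shows "word_class S R w = word_class S R w' \<longleftrightarrow> pres_eq S R w w'"
proof
  assume "word_class S R w = word_class S R w'"
  then show "pres_eq S R w w'"
    using pres_eq.refl[OF assms] by (auto simp: word_class_def intro: pres_eq.sym)
next
  assume "pres_eq S R w w'"
  then show "word_class S R w = word_class S R w'"
    by (auto simp: word_class_def intro: pres_eq.sym pres_eq.trans)
qed

lemma pres_group_simps:
  "carrier (pres_group S R) = word_class S R ` words S"
  "\<one>\<^bsub>pres_group S R\<^esub> = word_class S R []"
  by (simp_all add: pres_group_def)

lemma pres_group_mult:
  assumes "a \<in> words S" "b \<in> words S"
  shows "word_class S R a \<otimes>\<^bsub>pres_group S R\<^esub> word_class S R b = word_class S R (a @ b)"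
proof -
  have eq: "word_class S R (a' @ b') = word_class S R (a @ b)"
    if "a' \<in> word_class S R a" "b' \<in> word_class S R b" for a' b'
  proof -
    have "pres_eq S R (a @ b) (a' @ b')"
      using that by (intro pres_eq.append) (simp_all add: word_class_def)
    moreover have "a @ b \<in> words S"
      using assms by simp
    ultimately show ?thesis
      using word_class_eq_iff by metis
  qed
  have "a \<in> word_class S R a" "b \<in> word_class S R b"
    using assms by (simp_all add: word_class_def pres_eq.refl)
  then have "(\<Union>a'\<in>word_class S R a. \<Union>b'\<in>word_class S R b. word_class S R (a' @ b'))
      = word_class S R (a @ b)"
    using eq by blast
  then show ?thesis
    by (simp add: pres_group_def)
qed

lemma pres_eq_inv_word:
  assumes "w \<in> words S"
  shows "pres_eq S R (inv_word w @ w) []"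
  using assms
proof (induction w)
  case Nil
  show ?case by (simp add: inv_word_def pres_eq.refl)
next
  case (Cons x w)
  have w: "w \<in> words S" and x: "pres_eq S R [inv_letter x, x] []"
    using Cons.prems by (cases x; auto intro: pres_eq.intros)+
  have "pres_eq S R (inv_word w @ ([inv_letter x, x] @ w)) (inv_word w @ ([] @ w))"
    using w x by (intro pres_eq.append pres_eq.refl) auto
  with Cons.IH[OF w] show ?case
    by (auto simp: inv_word_def intro: pres_eq.trans)
qed

lemma group_pres_group: "group (pres_group S R)"
proof (rule groupI)
  fix A assume "A \<in> carrier (pres_group S R)"
  then obtain w where w: "w \<in> words S" "A = word_class S R w"
    by (auto simp: pres_group_simps)
  then have "word_class S R (inv_word w) \<otimes>\<^bsub>pres_group S R\<^esub> A = \<one>\<^bsub>pres_group S R\<^esub>"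
    by (simp add: pres_group_mult pres_group_simps word_class_eq_iff pres_eq_inv_word)
  then show "\<exists>B\<in>carrier (pres_group S R). B \<otimes>\<^bsub>pres_group S R\<^esub> A = \<one>\<^bsub>pres_group S R\<^esub>"
    using w by (auto simp: pres_group_simps)
qed (auto simp: pres_group_simps pres_group_mult)

section \<open>Special transformations and Property H\<close>

text \<open>The four types are \<open>0\<close>, \<open>1\<close>, \<open>2\<^sub>r\<close>, and \<open>2\<^sub>l\<close>; in the last two, \<open>u\<close> and \<open>u'\<close> may be empty.\<close>

inductive special_step :: "'a set \<Rightarrow> 'a list uprod set \<Rightarrow> 'a letter list \<Rightarrow> 'a letter list \<Rightarrow> bool"
  for S :: "'a set" and R :: "'a list uprod set" where
  type0_neg_pos:
    "\<lbrakk>x \<in> words S; y \<in> words S; s \<in> S\<rbrakk> \<Longrightarrow> special_step S R (x @ [Neg s, Pos s] @ y) (x @ y)"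
| type0_pos_neg:
    "\<lbrakk>x \<in> words S; y \<in> words S; s \<in> S\<rbrakk> \<Longrightarrow> special_step S R (x @ [Pos s, Neg s] @ y) (x @ y)"
| type1_pos:
    "\<lbrakk>x \<in> words S; y \<in> words S; v \<in> lists S; v' \<in> lists S; Upair v v' \<in> R\<rbrakk>
      \<Longrightarrow> special_step S R (x @ pos v @ y) (x @ pos v' @ y)"
| type1_neg:
    "\<lbrakk>x \<in> words S; y \<in> words S; v \<in> lists S; v' \<in> lists S; Upair v v' \<in> R\<rbrakk>
      \<Longrightarrow> special_step S R (x @ inv_word (pos v) @ y) (x @ inv_word (pos v') @ y)"
| type2_right:
    "\<lbrakk>x \<in> words S; y \<in> words S; v \<in> lists S; v' \<in> lists S; u \<in> lists S; u' \<in> lists S;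
      v \<noteq> []; v' \<noteq> []; Upair (v @ u) (v' @ u') \<in> R\<rbrakk>
      \<Longrightarrow> special_step S R (x @ inv_word (pos v) @ pos v' @ y) (x @ pos u @ inv_word (pos u') @ y)"
| type2_left:
    "\<lbrakk>x \<in> words S; y \<in> words S; v \<in> lists S; v' \<in> lists S; u \<in> lists S; u' \<in> lists S;
      v \<noteq> []; v' \<noteq> []; Upair (u @ v) (u' @ v') \<in> R\<rbrakk>
      \<Longrightarrow> special_step S R (x @ pos v @ inv_word (pos v') @ y) (x @ inv_word (pos u) @ pos u' @ y)"

definition property_H :: "'a set \<Rightarrow> 'a list uprod set \<Rightarrow> bool" where
  "property_H S R \<longleftrightarrow>
    (\<forall>w\<in>words S. word_class S R w = \<one>\<^bsub>pres_group S R\<^esub> \<longrightarrow> (special_step S R)\<^sup>*\<^sup>* w [])"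

section \<open>Artin--Tits presentations and type FC\<close>

fun alternating :: "nat \<Rightarrow> 'a \<Rightarrow> 'a \<Rightarrow> 'a list" where
  "alternating 0 s t = []"
| "alternating (Suc m) s t = s # alternating m t s"

definition braid_relation :: "nat \<Rightarrow> 'a \<Rightarrow> 'a \<Rightarrow> 'a list uprod" where
  "braid_relation m s t = Upair (alternating m s t) (alternating m t s)"

definition artin_tits :: "'a set \<Rightarrow> 'a list uprod set \<Rightarrow> bool" where
  "artin_tits S R \<longleftrightarrow>
    (\<forall>r\<in>R. \<exists>s\<in>S. \<exists>t\<in>S. \<exists>m\<ge>2. s \<noteq> t \<and> r = braid_relation m s t) \<and>
    (\<forall>s\<in>S. \<forall>t\<in>S. \<forall>m n. braid_relation m s t \<in> R \<and> braid_relation n s t \<in> R \<longrightarrow> m = n)"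

definition coxeter_group :: "'a set \<Rightarrow> 'a list uprod set \<Rightarrow> 'a letter list set monoid" where
  "coxeter_group S R = pres_group S (R \<union> {Upair [s, s] [] |s. s \<in> S})"

definition spherical :: "'a set \<Rightarrow> 'a list uprod set \<Rightarrow> bool" where
  "spherical S R \<longleftrightarrow> artin_tits S R \<and> finite (carrier (coxeter_group S R))"

definition amalgam_position ::
  "'a set \<Rightarrow> 'a list uprod set \<Rightarrow> 'a set \<Rightarrow> 'a list uprod set \<Rightarrow> bool" where
  "amalgam_position S1 R1 S2 R2 \<longleftrightarrow>
    (\<exists>h \<in> iso (subgroup_generated (pres_group S1 R1) ((\<lambda>s. word_class S1 R1 [Pos s]) ` (S1 \<inter> S2)))
              (subgroup_generated (pres_group S2 R2) ((\<lambda>s. word_class S2 R2 [Pos s]) ` (S1 \<inter> S2))).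
       \<forall>s \<in> S1 \<inter> S2. h (word_class S1 R1 [Pos s]) = word_class S2 R2 [Pos s])"

inductive type_FC :: "'a set \<Rightarrow> 'a list uprod set \<Rightarrow> bool" where
  spherical: "spherical S R \<Longrightarrow> type_FC S R"
| amalgam: "\<lbrakk>type_FC S1 R1; type_FC S2 R2; amalgam_position S1 R1 S2 R2\<rbrakk>
    \<Longrightarrow> type_FC (S1 \<union> S2) (R1 \<union> R2)"

end

theory Submission
  imports Defs Complex_Main
begin

text \<open>Special transformations never introduce new letters, and they are compatible with inverting words.
  Property H is proved in the stronger form that for every coset \<open>g\<langle>X\<rangle>\<close> of a standard parabolic subgroup
  there is a word \<open>r\<close> such that all words representing elements of the coset can be transformed into
  words \<open>r h\<close> with \<open>h\<close> a word in \<open>X\<close>.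

  In spherical type, the finite Coxeter group makes the reduced words a lattice under left divisibility
  with top element \<open>w0\<close>. Hence the positive monoid is cancellative, has common multiples, embeds in the
  group, and transformations of type 2 compute least common multiples. The representative is
  \<open>r = u\<^sup>-\<^sup>1 v\<close>, where \<open>u\<close> is the smallest denominator occurring in the coset \<open>g\<langle>X\<rangle>\<close> and \<open>v\<close> the smallest
  positive element of \<open>u g\<langle>X\<rangle>\<close>.

  In an amalgam, the representatives of the cosets of the common subgroup transform every word into the
  normal form given by the normal form theorem, both from the left and from the right. A right normal
  form splits off a word in \<open>X\<close>, a left normal form then exhibits the syllables common to all elements
  of the coset, and the remaining syllable is treated inside its factor.\<close>

text \<open>Property H alone gives no induction over amalgams. Rewriting along the normal form
  theorem has to turn a syllable lying in the common subgroup into a word over the common letters,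
  and has to lead all syllables of one coset to the same word: special transformations cannot be
  undone in general, so two different outcomes could not be reconciled later. Hence one
  \<open>r\<close> for the whole coset. Arbitrary \<open>X\<close> is forced by iteration, since the
  next amalgam brings its own common generators, and since a parabolic subgroup of an amalgam is
  treated through \<open>X \<inter> S i\<close> in the factors. That no new letters appear keeps
  remainders inside \<open>X\<close> and makes the chosen word of the trivial coset empty.

  In spherical type the obstacle is to leave the finite group. Its lattice of reduced words controls
  only the divisors of \<open>w0\<close>, while fractions need cancellation and least common
  multiples for all positive words. The same reversing argument is therefore run twice, for reduced
  words and for all words, and \<open>lcm_universal\<close> is the bridge between the two.\<close>

section \<open>Braid presentations and alternating words\<close>

definition braid_pres :: "'a set \<Rightarrow> 'a list uprod set \<Rightarrow> bool" where
  "braid_pres S R \<longleftrightarrow> (\<forall>r\<in>R. \<exists>s\<in>S. \<exists>t\<in>S. \<exists>m\<ge>2. s \<noteq> t \<and> r = braid_relation m s t)"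

lemma artin_tits_braid_pres: "artin_tits S R \<Longrightarrow> braid_pres S R"
  by (simp add: artin_tits_def braid_pres_def)

lemma length_alternating [simp]: "length (alternating m s t) = m"
  by (induction m arbitrary: s t) auto

lemma set_alternating_subset: "set (alternating m s t) \<subseteq> {s, t}"
  by (induction m arbitrary: s t) force+

lemma set_alternating: "m \<ge> 2 \<Longrightarrow> set (alternating m s t) = {s, t}"
  using set_alternating_subset[of "m - 2" s t]
  by (cases m; cases "m - 1") auto

lemma alternating_in_lists: "s \<in> S \<Longrightarrow> t \<in> S \<Longrightarrow> alternating m s t \<in> lists S"
  using set_alternating_subset[of m s t] by auto

lemma alternating_snoc:
  "alternating (Suc m) s t = alternating m s t @ [if even m then s else t]"
  by (induction m arbitrary: s t) auto

lemma alternating_add: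
  "alternating (m + n) s t =
     alternating m s t @ (if even m then alternating n s t else alternating n t s)"
  by (induction m arbitrary: s t) auto

lemma rev_alternating:
  "rev (alternating m s t) = (if even m then alternating m t s else alternating m s t)"
proof (induction m arbitrary: s t)
  case (Suc m)
  have "rev (alternating (Suc m) s t) = rev (alternating m t s) @ [s]"
    by simp
  also have "\<dots> = (if even m then alternating m s t @ [s] else alternating m t s @ [s])"
    by (simp add: Suc.IH)
  also have "\<dots> = (if even (Suc m) then alternating (Suc m) t s else alternating (Suc m) s t)"
    by (simp only: alternating_snoc) simp
  finally show ?case .
qed simp

lemma braid_relation_sym: "braid_relation m s t = braid_relation m t s"
  by (auto simp: braid_relation_def)

lemma braid_presE:
  assumes "braid_pres S R" "Upair v v' \<in> R"
  obtains m s t where "s \<in> S" "t \<in> S" "m \<ge> 2" "s \<noteq> t" "v = alternating m s t" "v' = alternating m t s"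
proof -
  obtain m s t where *: "s \<in> S" "t \<in> S" "m \<ge> 2" "s \<noteq> t" "Upair v v' = braid_relation m s t"
    using assms unfolding braid_pres_def by blast
  then show ?thesis
    using that[of s t m] that[of t s m] by (auto simp: braid_relation_def)
qed

lemma Upair_commute: "Upair a b = Upair b a"
  by (simp add: Upair_inject)

text \<open>Reversal fixes both sides of a braid relation of odd length and exchanges them for even
  length. The resulting anti-automorphism later gives right cancellation and left reversing.\<close>

lemma braid_pres_rev:
  assumes "braid_pres S R" "Upair v v' \<in> R"
  shows "Upair (rev v) (rev v') \<in> R"
proof -
  obtain m s t where "v = alternating m s t" "v' = alternating m t s"
    using braid_presE[OF assms] by metis
  then show ?thesis
    using assms(2) by (auto simp: rev_alternating Upair_commute[of "alternating m t s"])
qed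

lemma braid_pres_lists:
  assumes "braid_pres S R" "Upair v v' \<in> R"
  shows "v \<in> lists S" "v' \<in> lists S"
  using braid_presE[OF assms] alternating_in_lists by metis+

section \<open>The positive monoid\<close>

text \<open>Letters are left unrestricted: braid relations preserve the set of letters, so this one
  relation serves \<open>lists S\<close> and \<open>lists X\<close> for every parabolic
  \<open>X\<close>.\<close>

definition pos_step :: "'a list uprod set \<Rightarrow> 'a list \<Rightarrow> 'a list \<Rightarrow> bool" where
  "pos_step R u v \<longleftrightarrow> (\<exists>x y a b. u = x @ a @ y \<and> v = x @ b @ y \<and> Upair a b \<in> R)"

abbreviation pos_eq :: "'a list uprod set \<Rightarrow> 'a list \<Rightarrow> 'a list \<Rightarrow> bool" where
  "pos_eq R \<equiv> (pos_step R)\<^sup>*\<^sup>*"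

lemma pos_step_sym: "pos_step R u v \<Longrightarrow> pos_step R v u"
  unfolding pos_step_def by (metis Upair_inject)

lemma pos_eq_sym: "pos_eq R u v \<Longrightarrow> pos_eq R v u"
  by (induction rule: rtranclp_induct) (auto intro: pos_step_sym converse_rtranclp_into_rtranclp)

lemma pos_step_context: "pos_step R u v \<Longrightarrow> pos_step R (x @ u @ y) (x @ v @ y)"
  unfolding pos_step_def by (metis append.assoc)

lemma pos_eq_context: "pos_eq R u v \<Longrightarrow> pos_eq R (x @ u @ y) (x @ v @ y)"
proof (induction rule: rtranclp_induct)
  case (step v w)
  then show ?case
    using pos_step_context[of R v w x y] by auto
qed auto

lemma pos_eq_append:
  assumes "pos_eq R u u'" "pos_eq R v v'"
  shows "pos_eq R (u @ v) (u' @ v')"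
  using pos_eq_context[OF assms(1), of "[]" v] pos_eq_context[OF assms(2), of u' "[]"] by simp

lemma pos_eq_appendL: "pos_eq R u v \<Longrightarrow> pos_eq R (x @ u) (x @ v)"
  by (simp add: pos_eq_append)

lemma pos_eq_appendR: "pos_eq R u v \<Longrightarrow> pos_eq R (u @ x) (v @ x)"
  by (simp add: pos_eq_append)

lemma pos_eq_Cons: "pos_eq R u v \<Longrightarrow> pos_eq R (s # u) (s # v)"
  using pos_eq_appendL[of R u v "[s]"] by simp

lemma pos_eq_rel: "Upair a b \<in> R \<Longrightarrow> pos_eq R a b"
  unfolding pos_step_def by (rule r_into_rtranclp) (metis append.left_neutral append.right_neutral pos_step_def)

lemma pos_eq_braid: "braid_relation m s t \<in> R \<Longrightarrow> pos_eq R (alternating m s t) (alternating m t s)"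
  by (rule pos_eq_rel) (simp add: braid_relation_def)

lemma pos_eq_set_length:
  assumes "braid_pres S R" "pos_eq R u v"
  shows "set u = set v \<and> length u = length v"
  using assms(2)
proof (induction rule: rtranclp_induct)
  case (step v w)
  then obtain x y a b where *: "v = x @ a @ y" "w = x @ b @ y" "Upair a b \<in> R"
    unfolding pos_step_def by blast
  then obtain m s t where "m \<ge> 2" "a = alternating m s t" "b = alternating m t s"
    using braid_presE[OF assms(1)] by metis
  then have "set a = set b" "length a = length b"
    by (auto simp: set_alternating)
  with * step.IH show ?case
    by auto
qed auto

lemma pos_eq_length: "braid_pres S R \<Longrightarrow> pos_eq R u v \<Longrightarrow> length u = length v"
  using pos_eq_set_length by blast

lemma pos_eq_lists: "braid_pres S R \<Longrightarrow> pos_eq R u v \<Longrightarrow> u \<in> lists X \<longleftrightarrow> v \<in> lists X"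
  using pos_eq_set_length[of S R u v] by (simp add: in_lists_conv_set)

lemma pos_eq_Nil: "braid_pres S R \<Longrightarrow> pos_eq R [] v \<Longrightarrow> v = []"
  using pos_eq_length[of S R "[]" v] by auto

lemma pos_eq_rev:
  assumes "braid_pres S R" "pos_eq R u v"
  shows "pos_eq R (rev u) (rev v)"
  using assms(2)
proof (induction rule: rtranclp_induct)
  case (step v w)
  then obtain x y a b where *: "v = x @ a @ y" "w = x @ b @ y" "Upair a b \<in> R"
    unfolding pos_step_def by blast
  have "rev v = rev y @ rev a @ rev x" "rev w = rev y @ rev b @ rev x"
    using * by simp_all
  then have "pos_step R (rev v) (rev w)"
    unfolding pos_step_def using braid_pres_rev[OF assms(1) *(3)] by (intro exI conjI)
  with step.IH show ?case
    by (rule rtranclp.rtrancl_into_rtrancl)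
qed auto

section \<open>Signed words\<close>

lemma pos_simps [simp]:
  "pos [] = []" "pos (s # u) = Pos s # pos u" "pos (u @ v) = pos u @ pos v" "rev (pos u) = pos (rev u)"
  by (auto simp: pos_def rev_map)

lemma inv_letter_inv [simp]: "inv_letter (inv_letter x) = x"
  by (cases x) auto

lemma inv_word_simps [simp]:
  "inv_word [] = []" "inv_word (a @ b) = inv_word b @ inv_word a" "inv_word (inv_word w) = w"
  by (auto simp: inv_word_def rev_map o_def)

lemma inv_word_eq_Nil [simp]: "inv_word w = [] \<longleftrightarrow> w = []"
  by (simp add: inv_word_def)

lemma inv_word_Cons: "inv_word (x # w) = inv_word w @ [inv_letter x]"
  by (simp add: inv_word_def)

lemma rev_inv_pos [simp]: "rev (inv_word (pos u)) = inv_word (pos (rev u))"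
  by (simp add: inv_word_def pos_def rev_map)

lemma words_Cons_letter: "x # w \<in> words X \<longleftrightarrow> [x] \<in> words X \<and> w \<in> words X"
  by (cases x) auto

lemma words_Int_iff: "w \<in> words (X \<inter> Y) \<longleftrightarrow> w \<in> words X \<and> w \<in> words Y"
proof (induction w)
  case (Cons x w)
  then show ?case by (cases x) auto
qed simp

lemma words_mono: "w \<in> words X \<Longrightarrow> X \<subseteq> Y \<Longrightarrow> w \<in> words Y"
  using words_Int_iff[of w X Y] by (simp add: inf.absorb1)

lemma words_empty [simp]: "w \<in> words {} \<longleftrightarrow> w = []"
  by (auto simp: words_def)

lemma rev_words [simp]: "rev w \<in> words X \<longleftrightarrow> w \<in> words X"
  unfolding words_def by (simp add: in_lists_conv_set)

context
  fixes S :: "'a set" and R :: "'a list uprod set"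
begin

lemma pres_eq_inv_right: "w \<in> words S \<Longrightarrow> pres_eq S R (w @ inv_word w) []"
  using pres_eq_inv_word[of "inv_word w" S R] by simp

lemma pres_eq_move_left:
  assumes "x \<in> words S"
  shows "pres_eq S R (x @ a) b \<longleftrightarrow> pres_eq S R a (inv_word x @ b)"
proof
  assume h: "pres_eq S R (x @ a) b"
  have a: "a \<in> words S"
    using pres_eq_words[OF h] by simp
  have 1: "pres_eq S R ((inv_word x @ x) @ a) ([] @ a)"
    using assms a by (intro pres_eq.append pres_eq_inv_word pres_eq.refl)
  have 2: "pres_eq S R (inv_word x @ (x @ a)) (inv_word x @ b)"
    using assms h by (intro pres_eq.append pres_eq.refl) auto
  show "pres_eq S R a (inv_word x @ b)"
    using pres_eq.trans[OF pres_eq.sym[OF 1]] 2 by simp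
next
  assume h: "pres_eq S R a (inv_word x @ b)"
  have b: "b \<in> words S"
    using pres_eq_words[OF h] by simp
  have 1: "pres_eq S R ((x @ inv_word x) @ b) ([] @ b)"
    using assms b by (intro pres_eq.append pres_eq_inv_right pres_eq.refl)
  have 2: "pres_eq S R (x @ a) (x @ (inv_word x @ b))"
    using assms h by (intro pres_eq.append pres_eq.refl) auto
  show "pres_eq S R (x @ a) b"
    using pres_eq.trans[OF 2] 1 by simp
qed

lemma pres_eq_inv:
  assumes "pres_eq S R a b"
  shows "pres_eq S R (inv_word a) (inv_word b)"
proof -
  have w: "a \<in> words S" "b \<in> words S"
    using pres_eq_words[OF assms] by auto
  have "pres_eq S R (a @ inv_word b) (b @ inv_word b)"
    using assms w by (intro pres_eq.append pres_eq.refl) auto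
  then have "pres_eq S R (a @ inv_word b) []"
    using pres_eq_inv_right[OF w(2)] pres_eq.trans by blast
  then have "pres_eq S R (inv_word b) (inv_word a @ [])"
    using pres_eq_move_left[OF w(1)] by blast
  then show ?thesis
    by (auto intro: pres_eq.sym)
qed

lemma pres_eq_inv_iff: "pres_eq S R (inv_word a) (inv_word b) \<longleftrightarrow> pres_eq S R a b"
  using pres_eq_inv[of a b] pres_eq_inv[of "inv_word a" "inv_word b"] by auto

lemma pres_eq_move_right:
  assumes "x \<in> words S"
  shows "pres_eq S R (a @ x) b \<longleftrightarrow> pres_eq S R a (b @ inv_word x)"
proof -
  have "pres_eq S R (a @ x) b \<longleftrightarrow> pres_eq S R (inv_word x @ inv_word a) (inv_word b)"
    using pres_eq_inv_iff[of "a @ x" b] by simp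
  also have "\<dots> \<longleftrightarrow> pres_eq S R (inv_word a) (x @ inv_word b)"
    using pres_eq_move_left[of "inv_word x" "inv_word a" "inv_word b"] assms by simp
  also have "\<dots> \<longleftrightarrow> pres_eq S R a (b @ inv_word x)"
    using pres_eq_inv_iff[of a "b @ inv_word x"] by simp
  finally show ?thesis .
qed

lemma pres_eq_appendL: "x \<in> words S \<Longrightarrow> pres_eq S R a b \<Longrightarrow> pres_eq S R (x @ a) (x @ b)"
  by (intro pres_eq.append pres_eq.refl)

lemma pres_eq_appendR: "x \<in> words S \<Longrightarrow> pres_eq S R a b \<Longrightarrow> pres_eq S R (a @ x) (b @ x)"
  by (intro pres_eq.append pres_eq.refl)

lemma pres_eq_cancelL: "x \<in> words S \<Longrightarrow> pres_eq S R (x @ a) (x @ b) \<longleftrightarrow> pres_eq S R a b"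
proof
  assume x: "x \<in> words S" and h: "pres_eq S R (x @ a) (x @ b)"
  then have "b \<in> words S"
    using pres_eq_words[OF h] by simp
  then have "pres_eq S R ((inv_word x @ x) @ b) ([] @ b)"
    using x by (intro pres_eq.append pres_eq_inv_word pres_eq.refl)
  moreover have "pres_eq S R a (inv_word x @ x @ b)"
    using h pres_eq_move_left[OF x] by blast
  ultimately show "pres_eq S R a b"
    by (auto intro: pres_eq.trans)
qed (rule pres_eq_appendL)

lemma pres_eq_cancelR: "x \<in> words S \<Longrightarrow> pres_eq S R (a @ x) (b @ x) \<longleftrightarrow> pres_eq S R a b"
  using pres_eq_cancelL[of "inv_word x" "inv_word a" "inv_word b"]
    pres_eq_inv_iff[of "a @ x" "b @ x"] pres_eq_inv_iff[of a b] by simp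

lemma pres_eq_of_pos_eq:
  assumes "braid_pres S R" "pos_eq R u v" "u \<in> lists S"
  shows "pres_eq S R (pos u) (pos v)"
  using assms(2,3)
proof (induction rule: rtranclp_induct)
  case base
  then show ?case by (simp add: pres_eq.refl)
next
  case (step v w)
  then obtain x y a b where *: "v = x @ a @ y" "w = x @ b @ y" "Upair a b \<in> R"
    unfolding pos_step_def by blast
  have "v \<in> lists S"
    using step pos_eq_lists[OF assms(1)] by blast
  then have "pres_eq S R (pos v) (pos w)"
    using * braid_pres_lists[OF assms(1) *(3)]
    by (auto intro!: pres_eq.append pres_eq.refl pres_eq.relation)
  with step show ?case
    using pres_eq.trans by blast
qed

end

lemma pres_eq_mono:
  assumes "pres_eq S R w w'" "S \<subseteq> S'" "R \<subseteq> R'"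
  shows "pres_eq S' R' w w'"
  using assms(1)
proof induction
  case (relation v v')
  then show ?case
    using assms by (intro pres_eq.relation) (auto simp: in_lists_conv_set)
next
  case (refl w)
  then show ?case
    using assms words_mono pres_eq.refl by blast
qed (use assms in \<open>auto intro: pres_eq.intros\<close>)

text \<open>Letters acting on \<open>\<Omega>\<close> by mutually inverse maps that respect the
  relations define an action of the group. Sign, geometric representation and reflection parity of
  the Coxeter group are instances. With \<open>foldr\<close> the last letter acts first, as in a
  left action.\<close>

lemma pres_eq_foldr:
  fixes act :: "'a letter \<Rightarrow> 'b \<Rightarrow> 'b"
  assumes "pres_eq S R w w'" "x \<in> \<Omega>"
    and closed: "\<And>c x. [c] \<in> words S \<Longrightarrow> x \<in> \<Omega> \<Longrightarrow> act c x \<in> \<Omega>"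
    and pos_neg: "\<And>s x. s \<in> S \<Longrightarrow> x \<in> \<Omega> \<Longrightarrow> act (Pos s) (act (Neg s) x) = x"
    and neg_pos: "\<And>s x. s \<in> S \<Longrightarrow> x \<in> \<Omega> \<Longrightarrow> act (Neg s) (act (Pos s) x) = x"
    and rel: "\<And>v v' x. Upair v v' \<in> R \<Longrightarrow> v \<in> lists S \<Longrightarrow> v' \<in> lists S \<Longrightarrow> x \<in> \<Omega> \<Longrightarrow>
      foldr act (pos v) x = foldr act (pos v') x"
  shows "foldr act w x = foldr act w' x"
proof -
  have cl: "foldr act w x \<in> \<Omega>" if "w \<in> words S" "x \<in> \<Omega>" for w x
    using that
  proof (induction w)
    case (Cons c w)
    then show ?case
      using closed words_Cons_letter[of c w S] by simp
  qed simp
  show ?thesis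
    using assms(1,2)
  proof (induction arbitrary: x)
    case (append a a' b b')
    have "foldr act b' x \<in> \<Omega>"
      using cl append.prems pres_eq_words[OF append.hyps(2)] by blast
    then show ?case
      using append.IH(1) append.IH(2)[OF append.prems] by simp
  qed (use pos_neg neg_pos rel in auto)
qed

section \<open>Special transformations\<close>

abbreviation special :: "'a set \<Rightarrow> 'a list uprod set \<Rightarrow> 'a letter list \<Rightarrow> 'a letter list \<Rightarrow> bool" where
  "special S R \<equiv> (special_step S R)\<^sup>*\<^sup>*"

lemma special_step_words: "special_step S R w w' \<Longrightarrow> w \<in> words S \<and> w' \<in> words S"
  by (induction rule: special_step.induct) auto

lemma special_words: "special S R w w' \<Longrightarrow> w \<in> words S \<longleftrightarrow> w' \<in> words S"
  by (induction rule: rtranclp_induct) (auto dest: special_step_words)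

lemma special_step_context:
  assumes "special_step S R w w'" "p \<in> words S" "q \<in> words S"
  shows "special_step S R (p @ w @ q) (p @ w' @ q)"
  using assms(1)
proof cases
  case (type0_neg_pos x y s)
  then show ?thesis
    using special_step.type0_neg_pos[of "p @ x" S "y @ q" s R] assms by simp
next
  case (type0_pos_neg x y s)
  then show ?thesis
    using special_step.type0_pos_neg[of "p @ x" S "y @ q" s R] assms by simp
next
  case (type1_pos x y v v')
  then show ?thesis
    using special_step.type1_pos[of "p @ x" S "y @ q" v v' R] assms by simp
next
  case (type1_neg x y v v')
  then show ?thesis
    using special_step.type1_neg[of "p @ x" S "y @ q" v v' R] assms by simp
next
  case (type2_right x y v v' u u')
  then show ?thesis
    using special_step.type2_right[of "p @ x" S "y @ q" v v' u u' R] assms by simp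
next
  case (type2_left x y v v' u u')
  then show ?thesis
    using special_step.type2_left[of "p @ x" S "y @ q" v v' u u' R] assms by simp
qed

lemma special_context:
  assumes "special S R w w'" "p \<in> words S" "q \<in> words S"
  shows "special S R (p @ w @ q) (p @ w' @ q)"
  using assms(1)
proof (induction rule: rtranclp_induct)
  case (step w w')
  then show ?case
    using special_step_context[OF step(2) assms(2,3)] by auto
qed auto

lemma special_appendL: "special S R w w' \<Longrightarrow> p \<in> words S \<Longrightarrow> special S R (p @ w) (p @ w')"
  using special_context[of S R w w' p "[]"] by simp

lemma special_appendR: "special S R w w' \<Longrightarrow> q \<in> words S \<Longrightarrow> special S R (w @ q) (w' @ q)"
  using special_context[of S R w w' "[]" q] by simp

lemma special_step_inv:
  assumes "special_step S R w w'"
  shows "special_step S R (inv_word w) (inv_word w')"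
  using assms
proof cases
  case (type0_neg_pos x y s)
  then show ?thesis
    using special_step.type0_neg_pos[of "inv_word y" S "inv_word x" s R] by (simp add: inv_word_Cons)
next
  case (type0_pos_neg x y s)
  then show ?thesis
    using special_step.type0_pos_neg[of "inv_word y" S "inv_word x" s R] by (simp add: inv_word_Cons)
next
  case (type1_pos x y v v')
  then show ?thesis
    using special_step.type1_neg[of "inv_word y" S "inv_word x" v v' R] by simp
next
  case (type1_neg x y v v')
  then show ?thesis
    using special_step.type1_pos[of "inv_word y" S "inv_word x" v v' R] by simp
next
  case (type2_right x y v v' u u')
  then show ?thesis
    using special_step.type2_right[of "inv_word y" S "inv_word x" v' v u' u R]
    by (simp add: Upair_commute[of "v' @ u'"])
next
  case (type2_left x y v v' u u')
  then show ?thesis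
    using special_step.type2_left[of "inv_word y" S "inv_word x" v' v u' u R]
    by (simp add: Upair_commute[of "u' @ v'"])
qed

lemma special_inv: "special S R w w' \<Longrightarrow> special S R (inv_word w) (inv_word w')"
  by (induction rule: rtranclp_induct) (auto intro: special_step_inv rtranclp.rtrancl_into_rtrancl)

text \<open>Reversal keeps the signs of letters, so it exchanges the two forms of type 0 and the two
  forms of type 2.\<close>

lemma special_step_rev:
  assumes "braid_pres S R" "special_step S R w w'"
  shows "special_step S R (rev w) (rev w')"
  using assms(2)
proof cases
  case (type0_neg_pos x y s)
  then show ?thesis
    using special_step.type0_pos_neg[of "rev y" S "rev x" s R] by simp
next
  case (type0_pos_neg x y s)
  then show ?thesis
    using special_step.type0_neg_pos[of "rev y" S "rev x" s R] by simp
next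
  case (type1_pos x y v v')
  then show ?thesis
    using special_step.type1_pos[of "rev y" S "rev x" "rev v" "rev v'" R] braid_pres_rev[OF assms(1)]
    by (simp add: in_lists_conv_set)
next
  case (type1_neg x y v v')
  then show ?thesis
    using special_step.type1_neg[of "rev y" S "rev x" "rev v" "rev v'" R] braid_pres_rev[OF assms(1)]
    by (simp add: in_lists_conv_set)
next
  case (type2_right x y v v' u u')
  have "Upair (rev (v' @ u')) (rev (v @ u)) \<in> R"
    using braid_pres_rev[OF assms(1) type2_right(11)] by (metis Upair_commute)
  then show ?thesis
    using type2_right
      special_step.type2_left[of "rev y" S "rev x" "rev v'" "rev v" "rev u'" "rev u" R]
    by (simp add: in_lists_conv_set)
next
  case (type2_left x y v v' u u')
  have "Upair (rev (u' @ v')) (rev (u @ v)) \<in> R"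
    using braid_pres_rev[OF assms(1) type2_left(11)] by (metis Upair_commute)
  then show ?thesis
    using type2_left
      special_step.type2_right[of "rev y" S "rev x" "rev v'" "rev v" "rev u'" "rev u" R]
    by (simp add: in_lists_conv_set)
qed

lemma special_rev: "special S R w w' \<Longrightarrow> braid_pres S R \<Longrightarrow> special S R (rev w) (rev w')"
  by (induction rule: rtranclp_induct)
    (auto intro: special_step_rev rtranclp.rtrancl_into_rtrancl)

lemma special_step_mono:
  assumes "special_step S R w w'" "S \<subseteq> S'" "R \<subseteq> R'"
  shows "special_step S' R' w w'"
proof -
  have w: "\<And>w. w \<in> words S \<Longrightarrow> w \<in> words S'" "\<And>v. v \<in> lists S \<Longrightarrow> v \<in> lists S'"
    using words_mono assms(2) by (auto simp: in_lists_conv_set)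
  show ?thesis
    using assms(1)
  proof cases
    case (type2_right x y v v' u u')
    then show ?thesis
      using w assms(3) by (auto intro!: special_step.type2_right)
  next
    case (type2_left x y v v' u u')
    then show ?thesis
      using w assms(3) by (auto intro!: special_step.type2_left)
  qed (use w assms(2,3) in \<open>blast intro: special_step.intros\<close>)+
qed

lemma special_mono: "special S R w w' \<Longrightarrow> S \<subseteq> S' \<Longrightarrow> R \<subseteq> R' \<Longrightarrow> special S' R' w w'"
  by (induction rule: rtranclp_induct) (auto intro: special_step_mono rtranclp.rtrancl_into_rtrancl)

text \<open>Both letters of a braid relation already occur at the beginnings of its two sides, so special
  transformations introduce no new letters.\<close>

lemma braid_pres_type2_set:
  assumes "braid_pres S R" "Upair (v @ u) (v' @ u') \<in> R" "v \<noteq> []" "v' \<noteq> []"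
  shows "set u \<union> set u' \<subseteq> set v \<union> set v'"
proof -
  obtain m s t where *: "m \<ge> 2" "v @ u = alternating m s t" "v' @ u' = alternating m t s"
    using braid_presE[OF assms(1,2)] by metis
  then obtain n where "m = Suc n"
    by (cases m) auto
  with * assms(3,4) have "s \<in> set v" "t \<in> set v'"
    by (cases v; cases v'; simp)+
  moreover have "set u \<union> set u' \<subseteq> {s, t}"
    using set_alternating_subset[of m s t] set_alternating_subset[of m t s]
      arg_cong[OF *(2), of set] arg_cong[OF *(3), of set] by auto
  ultimately show ?thesis
    by auto
qed

lemma special_step_letters:
  assumes "braid_pres S R" "special_step S R w w'" "w \<in> words X"
  shows "w' \<in> words X"
  using assms(2)
proof cases
  case (type1_pos x y v v')
  then show ?thesis
    using assms pos_eq_lists[OF assms(1) pos_eq_rel] by auto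
next
  case (type1_neg x y v v')
  then show ?thesis
    using assms pos_eq_lists[OF assms(1) pos_eq_rel] by auto
next
  case (type2_right x y v v' u u')
  then show ?thesis
    using assms braid_pres_type2_set[OF assms(1) type2_right(11)] by (auto simp: in_lists_conv_set)
next
  case (type2_left x y v v' u u')
  have "Upair (rev v @ rev u) (rev v' @ rev u') \<in> R"
    using braid_pres_rev[OF assms(1) type2_left(11)] by simp
  from braid_pres_type2_set[OF assms(1) this] type2_left show ?thesis
    using assms by (auto simp: in_lists_conv_set)
qed (use assms in auto)

lemma special_letters: "special S R w w' \<Longrightarrow> braid_pres S R \<Longrightarrow> w \<in> words X \<Longrightarrow> w' \<in> words X"
  by (induction rule: rtranclp_induct) (auto intro: special_step_letters)

text \<open>This rigidity pins down chosen words: it gives trivial cosets the empty representative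
  and turns the coset property into Property H.\<close>

lemma special_Nil:
  assumes "braid_pres S R" "special S R [] w"
  shows "w = []"
  using special_letters[OF assms(2,1), of "{}"] by simp

lemma special_step_pres_eq:
  assumes "braid_pres S R" "special_step S R w w'"
  shows "pres_eq S R w w'"
  using assms(2)
proof cases
  case (type0_neg_pos x y s)
  then show ?thesis
    using pres_eq.append[OF pres_eq.refl[of x] pres_eq.append[OF pres_eq.neg_pos pres_eq.refl[of y]]]
    by simp
next
  case (type0_pos_neg x y s)
  then show ?thesis
    using pres_eq.append[OF pres_eq.refl[of x] pres_eq.append[OF pres_eq.pos_neg pres_eq.refl[of y]]]
    by simp
next
  case (type1_pos x y v v')
  then show ?thesis
    by (auto intro!: pres_eq.append pres_eq.refl pres_eq.relation)
next
  case (type1_neg x y v v')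
  then show ?thesis
    by (auto intro!: pres_eq.append pres_eq.refl pres_eq_inv pres_eq.relation)
next
  case (type2_right x y v v' u u')
  have "pres_eq S R (pos v @ pos u) (pos v' @ pos u')"
    using pres_eq.relation[OF type2_right(11)] type2_right by simp
  then have "pres_eq S R (pos u) ((inv_word (pos v) @ pos v') @ pos u')"
    using pres_eq_move_left[of "pos v" S R] type2_right by simp
  then have "pres_eq S R (inv_word (pos v) @ pos v') (pos u @ inv_word (pos u'))"
    using pres_eq_move_right[of "pos u'" S R "inv_word (pos v) @ pos v'" "pos u"] type2_right pres_eq.sym
    by fastforce
  then have "pres_eq S R (x @ (inv_word (pos v) @ pos v') @ y) (x @ (pos u @ inv_word (pos u')) @ y)"
    using type2_right by (intro pres_eq_appendL pres_eq_appendR)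
  then show ?thesis
    using type2_right by simp
next
  case (type2_left x y v v' u u')
  have "pres_eq S R (pos u @ pos v) (pos u' @ pos v')"
    using pres_eq.relation[OF type2_left(11)] type2_left by simp
  then have "pres_eq S R (pos v) ((inv_word (pos u) @ pos u') @ pos v')"
    using pres_eq_move_left[of "pos u" S R] type2_left by simp
  then have "pres_eq S R (inv_word (pos u) @ pos u') (pos v @ inv_word (pos v'))"
    using pres_eq_move_right[of "pos v'" S R "inv_word (pos u) @ pos u'" "pos v"] type2_left pres_eq.sym
    by fastforce
  then have "pres_eq S R (x @ (pos v @ inv_word (pos v')) @ y) (x @ (inv_word (pos u) @ pos u') @ y)"
    using type2_left by (intro pres_eq_appendL pres_eq_appendR) (auto intro: pres_eq.sym)
  then show ?thesis
    using type2_left by simp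
qed

lemma special_pres_eq:
  assumes "braid_pres S R" "special S R w w'" "w \<in> words S"
  shows "pres_eq S R w w'"
  using assms(2,3)
proof (induction rule: rtranclp_induct)
  case (step y z)
  then show ?case
    using special_step_pres_eq[OF assms(1)] pres_eq.trans by blast
qed (auto intro: pres_eq.refl)

lemma special_pos:
  assumes "braid_pres S R" "pos_eq R u v" "u \<in> lists S"
  shows "special S R (pos u) (pos v)"
  using assms(2,3)
proof (induction rule: rtranclp_induct)
  case (step v w)
  then obtain x y a b where *: "v = x @ a @ y" "w = x @ b @ y" "Upair a b \<in> R"
    unfolding pos_step_def by blast
  have "v \<in> lists S"
    using step pos_eq_lists[OF assms(1)] by blast
  then have "special_step S R (pos v) (pos w)"
    using * special_step.type1_pos[of "pos x" S "pos y" a b R] braid_pres_lists[OF assms(1) *(3)] by simp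
  with step show ?case
    by auto
qed auto

section \<open>Coxeter groups\<close>

text \<open>In the Coxeter group a generator is its own inverse, so positive words reach every
  element and reversal inverts them. Positive words can be compared directly with
  \<open>pos_eq\<close>.\<close>

definition ceq :: "'a set \<Rightarrow> 'a list uprod set \<Rightarrow> 'a list \<Rightarrow> 'a list \<Rightarrow> bool" where
  "ceq S R v v' \<longleftrightarrow> pres_eq S (R \<union> {Upair [s, s] [] |s. s \<in> S}) (pos v) (pos v')"

lemma ceq_lists: "ceq S R v v' \<Longrightarrow> v \<in> lists S \<and> v' \<in> lists S"
  unfolding ceq_def by (drule pres_eq_words) (simp only: pos_words)

lemma ceq_refl: "v \<in> lists S \<Longrightarrow> ceq S R v v"
  unfolding ceq_def by (simp add: pres_eq.refl)

lemma ceq_sym: "ceq S R v v' \<Longrightarrow> ceq S R v' v"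
  unfolding ceq_def by (rule pres_eq.sym)

lemma ceq_trans [trans]: "ceq S R u v \<Longrightarrow> ceq S R v w \<Longrightarrow> ceq S R u w"
  unfolding ceq_def by (rule pres_eq.trans)

lemma ceq_append: "ceq S R u u' \<Longrightarrow> ceq S R v v' \<Longrightarrow> ceq S R (u @ v) (u' @ v')"
  unfolding ceq_def by (simp add: pres_eq.append)

lemma ceq_square: "s \<in> S \<Longrightarrow> ceq S R [s, s] []"
  unfolding ceq_def by (rule pres_eq.relation) auto

lemma ceq_appendL: "x \<in> lists S \<Longrightarrow> ceq S R u v \<Longrightarrow> ceq S R (x @ u) (x @ v)"
  by (simp add: ceq_append ceq_refl)

lemma ceq_appendR: "x \<in> lists S \<Longrightarrow> ceq S R u v \<Longrightarrow> ceq S R (u @ x) (v @ x)"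
  by (simp add: ceq_append ceq_refl)

lemma ceq_Cons: "s \<in> S \<Longrightarrow> ceq S R u v \<Longrightarrow> ceq S R (s # u) (s # v)"
  using ceq_appendL[of "[s]"] by simp

lemma ceq_cancelL: "x \<in> lists S \<Longrightarrow> ceq S R (x @ a) (x @ b) \<longleftrightarrow> ceq S R a b"
  unfolding ceq_def by (simp add: pres_eq_cancelL)

lemma ceq_cancel_Cons: "s \<in> S \<Longrightarrow> ceq S R (s # a) (s # b) \<longleftrightarrow> ceq S R a b"
  using ceq_cancelL[of "[s]" S R a b] by simp

lemma ceq_cancelR: "x \<in> lists S \<Longrightarrow> ceq S R (a @ x) (b @ x) \<longleftrightarrow> ceq S R a b"
  unfolding ceq_def by (simp add: pres_eq_cancelR)

lemma ceq_rev_append: "v \<in> lists S \<Longrightarrow> ceq S R (rev v @ v) []"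
proof (induction v)
  case (Cons s v)
  have "ceq S R (rev v @ ([s, s] @ v)) (rev v @ ([] @ v))"
    using Cons.prems by (intro ceq_appendL ceq_appendR ceq_square) (auto simp: in_lists_conv_set)
  also have "ceq S R (rev v @ ([] @ v)) []"
    using Cons by simp
  finally show ?case by simp
qed (simp add: ceq_refl)

lemma ceq_append_rev: "v \<in> lists S \<Longrightarrow> ceq S R (v @ rev v) []"
  using ceq_rev_append[of "rev v" S R] by (simp add: in_lists_conv_set)

lemma ceq_Cons_Cons: "s \<in> S \<Longrightarrow> v \<in> lists S \<Longrightarrow> ceq S R (s # s # v) v"
  using ceq_append[OF ceq_square[of s S R] ceq_refl[of v]] by simp

lemma ceq_moveL:
  assumes "x \<in> lists S"
  shows "ceq S R (x @ a) b \<longleftrightarrow> ceq S R a (rev x @ b)"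
proof
  assume h: "ceq S R (x @ a) b"
  then have a: "a \<in> lists S" using ceq_lists by fastforce
  have "ceq S R a (rev x @ x @ a)"
    using ceq_appendR[OF a ceq_rev_append[OF assms]] by (simp add: ceq_sym)
  also have "ceq S R (rev x @ x @ a) (rev x @ b)"
    using h assms by (intro ceq_appendL) (auto simp: in_lists_conv_set)
  finally show "ceq S R a (rev x @ b)" .
next
  assume h: "ceq S R a (rev x @ b)"
  then have b: "b \<in> lists S" using ceq_lists by fastforce
  have "ceq S R (x @ a) (x @ rev x @ b)"
    using h assms by (intro ceq_appendL) auto
  also have "ceq S R (x @ rev x @ b) b"
    using ceq_appendR[OF b ceq_append_rev[OF assms]] by simp
  finally show "ceq S R (x @ a) b" .
qed

lemma ceq_moveL_Cons: "s \<in> S \<Longrightarrow> ceq S R (s # a) b \<longleftrightarrow> ceq S R a (s # b)"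
  using ceq_moveL[of "[s]" S R a b] by simp

lemma ceq_conj_iff:
  assumes "s \<in> S"
  shows "ceq S R (s # q @ [s]) p \<longleftrightarrow> ceq S R q (s # p @ [s])"
proof -
  have "ceq S R (s # q @ [s]) p \<longleftrightarrow> ceq S R (q @ [s]) (s # p)"
    using ceq_moveL_Cons[OF assms] by blast
  also have "\<dots> \<longleftrightarrow> ceq S R ((q @ [s]) @ [s]) ((s # p) @ [s])"
    using ceq_cancelR[of "[s]" S R "q @ [s]" "s # p"] assms by simp
  also have "\<dots> \<longleftrightarrow> ceq S R q (s # p @ [s])"
  proof
    have *: "ceq S R ((q @ [s]) @ [s]) q" if "q \<in> lists S"
      using ceq_appendL[OF that ceq_square[OF assms, of R]] by simp
    {
      assume h: "ceq S R ((q @ [s]) @ [s]) ((s # p) @ [s])"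
      then have "q \<in> lists S" using ceq_lists[OF h] by simp
      from ceq_trans[OF ceq_sym[OF *[OF this]] h] show "ceq S R q (s # p @ [s])" by simp
    next
      assume h: "ceq S R q (s # p @ [s])"
      then have "q \<in> lists S" using ceq_lists[OF h] by simp
      from ceq_trans[OF *[OF this] h] show "ceq S R ((q @ [s]) @ [s]) ((s # p) @ [s])" by simp
    }
  qed
  finally show ?thesis .
qed

lemma ceq_foldr:
  assumes "ceq S R v v'" "x \<in> \<Omega>"
    and closed: "\<And>s x. s \<in> S \<Longrightarrow> x \<in> \<Omega> \<Longrightarrow> a s x \<in> \<Omega>"
    and invol: "\<And>s x. s \<in> S \<Longrightarrow> x \<in> \<Omega> \<Longrightarrow> a s (a s x) = x"
    and rel: "\<And>u u' x. Upair u u' \<in> R \<Longrightarrow> u \<in> lists S \<Longrightarrow> u' \<in> lists S \<Longrightarrow> x \<in> \<Omega> \<Longrightarrow>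
      foldr a u x = foldr a u' x"
  shows "foldr a v x = foldr a v' x"
proof -
  define act where "act c = (case c of Pos s \<Rightarrow> a s | Neg s \<Rightarrow> a s)" for c
  have act: "foldr act (pos v) = foldr a v" for v
    by (induction v) (auto simp: act_def)
  have "foldr act (pos v) x = foldr act (pos v') x"
  proof (rule pres_eq_foldr[OF assms(1)[unfolded ceq_def] assms(2)])
    show "act c x \<in> \<Omega>" if "[c] \<in> words S" "x \<in> \<Omega>" for c x
      using that closed by (cases c) (auto simp: act_def)
    fix u u' x
    assume u: "Upair u u' \<in> R \<union> {Upair [s, s] [] |s. s \<in> S}" "u \<in> lists S" "u' \<in> lists S" "x \<in> \<Omega>"
    show "foldr act (pos u) x = foldr act (pos u') x"
    proof (cases "Upair u u' \<in> R")
      case False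
      then obtain s where "s \<in> S" "Upair u u' = Upair [s, s] []"
        using u by blast
      then show ?thesis
        using u invol by (auto simp: Upair_inject act_def)
    qed (use rel u act in auto)
  qed (use invol in \<open>auto simp: act_def\<close>)
  then show ?thesis
    by (simp add: act)
qed

text \<open>The sign character: every generator negates a truth value. In the exchange condition it
  excludes that multiplication by a generator preserves the length.\<close>

lemma ceq_parity:
  assumes "braid_pres S R" "ceq S R v v'"
  shows "even (length v) \<longleftrightarrow> even (length v')"
proof -
  have *: "foldr (\<lambda>_. Not) v True = even (length v)" for v :: "'a list"
    by (induction v) auto
  have "foldr (\<lambda>_. Not) v True = foldr (\<lambda>_. Not) v' True"
  proof (rule ceq_foldr[OF assms(2), of _ UNIV])
    fix u u' :: "'a list" and x
    assume "Upair u u' \<in> R"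
    then have "length u = length u'"
      using pos_eq_length[OF assms(1) pos_eq_rel] by blast
    moreover have "foldr (\<lambda>_. Not) v x = (x = even (length v))" for v :: "'a list"
      by (induction v) auto
    ultimately show "foldr (\<lambda>_. Not) u x = foldr (\<lambda>_. Not) u' x"
      by simp
  qed auto
  then show ?thesis
    by (simp add: *)
qed

lemma ceq_of_pos_eq:
  assumes "braid_pres S R" "pos_eq R u v" "u \<in> lists S"
  shows "ceq S R u v"
  unfolding ceq_def
  by (rule pres_eq_mono[OF pres_eq_of_pos_eq[OF assms]]) auto

lemma ceq_braid:
  assumes "braid_pres S R" "braid_relation m s t \<in> R"
  shows "ceq S R (alternating m s t) (alternating m t s)"
  using ceq_of_pos_eq[OF assms(1) pos_eq_braid[OF assms(2)]]
    braid_pres_lists[OF assms(1)] assms(2) unfolding braid_relation_def by blast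

subsection \<open>The geometric representation\<close>

text \<open>The contragredient form of the Tits representation acts on all functions on \<open>S\<close>, so that no
  finiteness assumption on \<open>S\<close> is needed.\<close>

definition cox_cos :: "'a list uprod set \<Rightarrow> 'a \<Rightarrow> 'a \<Rightarrow> real" where
  "cox_cos R s t = (if \<exists>m. braid_relation m s t \<in> R
     then cos (pi / real (THE m. braid_relation m s t \<in> R)) else 1)"

text \<open>Here \<open>f r\<close> is the value of a linear form on the simple root \<alpha>_r, and
  \<open>geom R s f\<close> is the form composed with the reflection \<alpha>_r -> \<alpha>_r + 2
  cos(pi/m) \<alpha>_s. The default 1 of \<open>cox_cos\<close> is the cosine for m
  infinite.\<close>

definition geom :: "'a list uprod set \<Rightarrow> 'a \<Rightarrow> ('a \<Rightarrow> real) \<Rightarrow> 'a \<Rightarrow> real" where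
  "geom R s f = (\<lambda>r. if r = s then - f s else f r + 2 * cox_cos R s r * f s)"

lemma cox_cos_sym: "cox_cos R s t = cox_cos R t s"
  by (simp add: cox_cos_def braid_relation_sym[of _ s t])

lemma geom_invol: "geom R s (geom R s f) = f"
  by (auto simp: geom_def)

lemma artin_tits_unique:
  assumes "artin_tits S R" "braid_relation m s t \<in> R" "braid_relation n s t \<in> R"
  shows "m = n"
proof -
  obtain s' t' k where *: "s' \<in> S" "t' \<in> S" "k \<ge> 2" "alternating m s t = alternating k s' t'"
    "alternating m t s = alternating k t' s'"
    using braid_presE[OF artin_tits_braid_pres[OF assms(1)], of "alternating m s t" "alternating m t s"]
      assms(2) unfolding braid_relation_def by metis
  have "m = k" using *(4) length_alternating by metis
  then have "set (alternating m s t) = {s, t}" "set (alternating m s t) = {s', t'}"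
    using *(3,4) set_alternating[of k s' t'] set_alternating[of m s t] by metis+
  then have "s \<in> S" "t \<in> S" using * by auto
  then show ?thesis
    using assms unfolding artin_tits_def by blast
qed

lemma cox_cos_eq:
  assumes "artin_tits S R" "braid_relation m s t \<in> R"
  shows "cox_cos R s t = cos (pi / m)"
proof -
  have "(THE m. braid_relation m s t \<in> R) = m"
    using assms(2) artin_tits_unique[OF assms(1)] by (intro the_equality)
  then show ?thesis
    unfolding cox_cos_def using assms(2) by (metis (mono_tags))
qed

text \<open>In the plane of \<open>s\<close> and \<open>t\<close> the two generators act on the parameter \<open>x\<close> of the point
  \<open>(F x, F (\<theta> - x))\<close> by \<open>x \<mapsto> -x\<close> and \<open>x \<mapsto> 2\<theta> - x\<close>; here \<open>F\<close> is the sine, or the identity if \<open>s\<close>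
  and \<open>t\<close> satisfy no relation.\<close>

lemma geom_alternating:
  fixes F :: "real \<Rightarrow> real"
  assumes odd: "\<And>x. F (- x) = - F x"
    and rec: "\<And>x. F (\<theta> + x) = F (\<theta> - x) + 2 * cox_cos R s t * F x"
    and "s \<noteq> t" "f s = A * F x" "f t = A * F (\<theta> - x)"
  shows "\<exists>y. y = (if even k then x - k * \<theta> else - x - (k - 1) * \<theta>) \<and>
      foldr (geom R) (alternating k s t) f s = A * F y \<and>
      foldr (geom R) (alternating k s t) f t = A * F (\<theta> - y)" (is ?A)
    and "\<exists>y. y = (if even k then x + k * \<theta> else - x + (k + 1) * \<theta>) \<and>
      foldr (geom R) (alternating k t s) f s = A * F y \<and>
      foldr (geom R) (alternating k t s) f t = A * F (\<theta> - y)" (is ?B)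
proof -
  have s: "geom R s g s = A * F (- y)" "geom R s g t = A * F (\<theta> - - y)"
    if "g s = A * F y" "g t = A * F (\<theta> - y)" for g y
    using that assms(3) odd[of y] rec[of y] by (auto simp: geom_def algebra_simps)
  have t: "geom R t g s = A * F (2 * \<theta> - y)" "geom R t g t = A * F (\<theta> - (2 * \<theta> - y))"
    if "g s = A * F y" "g t = A * F (\<theta> - y)" for g y
    using that assms(3) odd[of "\<theta> - y"] rec[of "\<theta> - y"] cox_cos_sym[of R s t]
    by (auto simp: geom_def algebra_simps)
  have "?A \<and> ?B"
  proof (induction k)
    case 0
    then show ?case using assms by auto
  next
    case (Suc k)
    then obtain y z where y: "y = (if even k then x - k * \<theta> else - x - (k - 1) * \<theta>)"
       "foldr (geom R) (alternating k s t) f s = A * F y"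
       "foldr (geom R) (alternating k s t) f t = A * F (\<theta> - y)"
      and z: "z = (if even k then x + k * \<theta> else - x + (k + 1) * \<theta>)"
       "foldr (geom R) (alternating k t s) f s = A * F z"
       "foldr (geom R) (alternating k t s) f t = A * F (\<theta> - z)"
      by blast
    have "k \<ge> 1" if "odd k" using that by (cases k) auto
    then have "- z = (if even (Suc k) then x - Suc k * \<theta> else - x - (Suc k - 1) * \<theta>)"
      "2 * \<theta> - y = (if even (Suc k) then x + Suc k * \<theta> else - x + (Suc k + 1) * \<theta>)"
      by (auto simp: y z algebra_simps of_nat_diff)
    then show ?case
      using s[OF z(2,3)] t[OF y(2,3)] by simp
  qed
  then show ?A ?B by auto
qed

text \<open>The two equations say that \<alpha>_r + \<alpha> \<alpha>_s + \<beta> \<alpha>_t is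
  orthogonal to \<alpha>_s and \<alpha>_t, so both reflections fix it; the sum is the value of the
  form on this vector.\<close>

lemma geom_invariant:
  assumes "s \<noteq> t" "r \<noteq> s" "r \<noteq> t" "\<alpha> = \<beta> * cox_cos R s t + cox_cos R s r"
    "\<beta> = \<alpha> * cox_cos R s t + cox_cos R t r" "set v \<subseteq> {s, t}"
  shows "foldr (geom R) v f r + \<alpha> * foldr (geom R) v f s + \<beta> * foldr (geom R) v f t =
    f r + \<alpha> * f s + \<beta> * f t"
  using assms(6)
proof (induction v)
  case (Cons u v)
  define g where "g = foldr (geom R) v f"
  have "geom R s g r + \<alpha> * geom R s g s + \<beta> * geom R s g t =
      g r + \<alpha> * g s + \<beta> * g t + 2 * g s * (\<beta> * cox_cos R s t + cox_cos R s r - \<alpha>)"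
    using assms(1-3) by (simp add: geom_def algebra_simps)
  then have s: "geom R s g r + \<alpha> * geom R s g s + \<beta> * geom R s g t = g r + \<alpha> * g s + \<beta> * g t"
    using assms(4) by simp
  have "geom R t g r + \<alpha> * geom R t g s + \<beta> * geom R t g t =
      g r + \<alpha> * g s + \<beta> * g t + 2 * g t * (\<alpha> * cox_cos R s t + cox_cos R t r - \<beta>)"
    using assms(1-3) cox_cos_sym[of R s t] by (simp add: geom_def algebra_simps)
  then have t: "geom R t g r + \<alpha> * geom R t g s + \<beta> * geom R t g t = g r + \<alpha> * g s + \<beta> * g t"
    using assms(5) by simp
  show ?case
    using s t Cons unfolding g_def by auto
qed simp

lemma sin_recurrence: "sin (\<theta> + x) = sin (\<theta> - x) + 2 * cos \<theta> * sin (x::real)"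
  by (simp add: sin_add sin_diff)

lemma geom_braid:
  assumes "artin_tits S R" "braid_relation m s t \<in> R" "s \<noteq> t" "m \<ge> 2"
  shows "foldr (geom R) (alternating m s t) f = foldr (geom R) (alternating m t s) f"
proof
  fix r
  define \<theta> where "\<theta> = pi / m"
  have m\<theta>: "m * \<theta> = pi" and c: "cox_cos R s t = cos \<theta>"
    using assms(4) cox_cos_eq[OF assms(1,2)] by (auto simp: \<theta>_def)
  have "pi / m < pi" "pi / m > 0"
    using assms(4) by (auto simp: divide_simps)
  then have sin: "sin \<theta> > 0"
    unfolding \<theta>_def using sin_gt_zero by blast
  \<comment> \<open>Solves for x and A in f s = A sin x and f t = A sin(\<theta> - x): expanding the
    second sine forces A cos x to be this quotient.\<close>
  define X where "X = (f t + f s * cos \<theta>) / sin \<theta>"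
  obtain A x where Ax: "X = A * cos x" "f s = A * sin x"
    using polar_Ex by metis
  have "f t = X * sin \<theta> - f s * cos \<theta>"
    using sin by (simp add: X_def)
  then have ft: "f t = A * sin (\<theta> - x)"
    by (simp add: Ax sin_diff algebra_simps)
  have rec: "\<And>x. sin (\<theta> + x) = sin (\<theta> - x) + 2 * cox_cos R s t * sin x"
    using sin_recurrence c by simp
  obtain y where y: "y = (if even m then x - m * \<theta> else - x - (m - 1) * \<theta>)"
      "foldr (geom R) (alternating m s t) f s = A * sin y"
      "foldr (geom R) (alternating m s t) f t = A * sin (\<theta> - y)"
    using geom_alternating(1)[OF sin_minus rec assms(3) Ax(2) ft] by metis
  obtain z where z: "z = (if even m then x + m * \<theta> else - x + (m + 1) * \<theta>)"
      "foldr (geom R) (alternating m t s) f s = A * sin z"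
      "foldr (geom R) (alternating m t s) f t = A * sin (\<theta> - z)"
    using geom_alternating(2)[OF sin_minus rec assms(3) Ax(2) ft] by metis
  \<comment> \<open>The two alternating words move the parameter to points that differ by
    2m\<theta>.\<close>
  have "z = y + 2 * pi"
    using m\<theta> assms(4) by (auto simp: y z algebra_simps of_nat_diff)
  then have "sin z = sin y" "sin (\<theta> - z) = sin (\<theta> - y)"
    by (simp_all add: sin_diff sin_add cos_add)
  then have st: "foldr (geom R) (alternating m s t) f s = foldr (geom R) (alternating m t s) f s"
     "foldr (geom R) (alternating m s t) f t = foldr (geom R) (alternating m t s) f t"
    using y z by simp_all
  show "foldr (geom R) (alternating m s t) f r = foldr (geom R) (alternating m t s) f r"
  proof (cases "r = s \<or> r = t")
    case False
    \<comment> \<open>The determinant of the linear system for \<alpha> and \<beta> in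
      \<open>geom_invariant\<close>; it is sin^2 \<theta>, hence nonzero. With invariance, equality
      at s and t carries over to r.\<close>
    define d where "d = 1 - (cos \<theta>)\<^sup>2"
    define \<beta> where "\<beta> = (cos \<theta> * cox_cos R s r + cox_cos R t r) / d"
    define \<alpha> where "\<alpha> = \<beta> * cos \<theta> + cox_cos R s r"
    have "d = (sin \<theta>)\<^sup>2"
      by (simp add: d_def sin_squared_eq)
    then have "d \<noteq> 0"
      using sin by simp
    then have "\<beta> * d = cos \<theta> * cox_cos R s r + cox_cos R t r"
      by (simp add: \<beta>_def)
    then have \<beta>: "\<beta> = \<alpha> * cos \<theta> + cox_cos R t r"
      by (simp add: \<alpha>_def d_def algebra_simps power2_eq_square)
    have \<alpha>\<beta>: "\<alpha> = \<beta> * cox_cos R s t + cox_cos R s r" "\<beta> = \<alpha> * cox_cos R s t + cox_cos R t r"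
      unfolding c by (fact \<alpha>_def, fact \<beta>)
    have rst: "r \<noteq> s" "r \<noteq> t"
      using False by auto
    have inv: "foldr (geom R) v f r + \<alpha> * foldr (geom R) v f s + \<beta> * foldr (geom R) v f t =
        f r + \<alpha> * f s + \<beta> * f t" if "set v \<subseteq> {s, t}" for v
      by (rule geom_invariant[OF assms(3) rst \<alpha>\<beta> that])
    show ?thesis
      using inv[OF set_alternating_subset, of m] inv[of "alternating m t s"]
        set_alternating_subset[of m t s] st by (simp add: insert_commute)
  qed (use st in auto)
qed

lemma ceq_geom:
  assumes "artin_tits S R" "ceq S R v v'"
  shows "foldr (geom R) v f = foldr (geom R) v' f"
proof (rule ceq_foldr[OF assms(2), of _ UNIV])
  fix u u' and f :: "'a \<Rightarrow> real"
  assume u: "Upair u u' \<in> R"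
  then obtain m s t where "m \<ge> 2" "s \<noteq> t" "u = alternating m s t" "u' = alternating m t s"
    using braid_presE[OF artin_tits_braid_pres[OF assms(1)]] by metis
  with u show "foldr (geom R) u f = foldr (geom R) u' f"
    using geom_braid[OF assms(1), of m s t f] by (simp add: braid_relation_def)
qed (auto simp: geom_invol)

text \<open>The product st shifts the parameter x by 2\<theta>: a rotation of exact order m, or a
  translation if there is no relation. This is the lower bound for the order of st in the Coxeter
  group.\<close>

lemma alternating_not_ceq_Nil:
  assumes "artin_tits S R" "s \<noteq> t" "0 < j" "\<And>m. braid_relation m s t \<in> R \<Longrightarrow> j < m"
  shows "\<not> ceq S R (alternating (2 * j) s t) []"
proof
  assume eq: "ceq S R (alternating (2 * j) s t) []"
  have triv: "foldr (geom R) (alternating (2 * j) s t) f = f" for f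
    using ceq_geom[OF assms(1) eq, of f] by simp
  show False
  proof (cases "\<exists>m. braid_relation m s t \<in> R")
    case False
    then have rec: "\<And>x. 1 + x = 1 - x + 2 * cox_cos R s t * x"
      by (simp add: cox_cos_def)
    \<comment> \<open>The point with parameter x = 0, for \<theta> = 1 and F the identity.\<close>
    let ?f = "\<lambda>r. if r = s then 0 else 1 :: real"
    have "foldr (geom R) (alternating (2 * j) s t) ?f s = - 2 * j"
      using geom_alternating(1)[where F = "\<lambda>x. x" and A = 1 and x = 0 and k = "2 * j" and f = ?f,
          OF _ rec assms(2)] assms(2) by simp
    then show False
      unfolding triv using assms(3) by simp
  next
    case True
    then obtain m where m: "braid_relation m s t \<in> R" "j < m"
      using assms(4) by blast
    define \<theta> where "\<theta> = pi / m"
    have c: "cox_cos R s t = cos \<theta>"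
      using cox_cos_eq[OF assms(1) m(1)] by (auto simp: \<theta>_def)
    have rec: "\<And>x. sin (\<theta> + x) = sin (\<theta> - x) + 2 * cox_cos R s t * sin x"
      using sin_recurrence c by simp
    \<comment> \<open>Again x = 0, now for F = sin. Both coordinates are needed: the s-coordinate
      fixes the shift only modulo pi.\<close>
    let ?f = "\<lambda>r. if r = s then 0 else sin \<theta>"
    have "foldr (geom R) (alternating (2 * j) s t) ?f s = - sin (2 * j * \<theta>) \<and>
        foldr (geom R) (alternating (2 * j) s t) ?f t = sin (\<theta> + 2 * j * \<theta>)"
      using geom_alternating(1)[where F = sin and A = 1 and x = 0 and k = "2 * j" and f = ?f,
          OF sin_minus rec assms(2)] assms(2) by simp
    then have 1: "sin (2 * j * \<theta>) = 0" "sin (\<theta> + 2 * j * \<theta>) = sin \<theta>"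
      unfolding triv using assms(2) by auto
    have "\<theta> < pi" "\<theta> > 0"
      using m assms(3) by (auto simp: \<theta>_def divide_simps)
    then have "sin \<theta> > 0"
      using sin_gt_zero by blast
    then have "cos (2 * j * \<theta>) = 1"
      using 1 by (simp add: sin_add)
    then obtain n :: int where n: "2 * j * \<theta> = real_of_int n * 2 * pi"
      using cos_one_2pi_int by blast
    have "real m * \<theta> = pi"
      using m by (simp add: \<theta>_def)
    then have "2 * pi * real j = real m * (2 * j * \<theta>)"
      by simp
    also have "\<dots> = 2 * pi * (real_of_int n * real m)"
      by (simp only: n) simp
    finally have "real j = real_of_int n * real m"
      by simp
    then have "real_of_int (int j) = real_of_int (n * int m)"
      by simp
    then have "int j = n * int m"
      by (simp only: of_int_eq_iff)
    then have "int m dvd int j"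
      by simp
    then have "m dvd j"
      by simp
    then show False
      using m assms(3) by (auto dest: dvd_imp_le)
  qed
qed

subsection \<open>Reflections and the exchange condition\<close>

definition prefix_refl :: "'a list \<Rightarrow> nat \<Rightarrow> 'a list" where
  "prefix_refl v i = take i v @ [v ! i] @ rev (take i v)"

text \<open>How often the reflection \<open>p\<close> occurs in the sequence attached to
  \<open>v\<close>. The count depends on the word, its parity only on the group element.\<close>

definition refl_count :: "'a set \<Rightarrow> 'a list uprod set \<Rightarrow> 'a list \<Rightarrow> 'a list \<Rightarrow> nat" where
  "refl_count S R v p = (\<Sum>i<length v. of_bool (ceq S R (prefix_refl v i) p))"

text \<open>The parity cocycle N(sv) = {s} + s N(v) s (symmetric difference), written as an action
  on predicates over reflections. The guard \<open>p \<in> lists S\<close> makes images vanish off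
  \<open>lists S\<close>, so that equalities in \<open>refl_space\<close> are equalities of
  functions.\<close>

definition refl_act :: "'a set \<Rightarrow> 'a list uprod set \<Rightarrow> 'a \<Rightarrow> ('a list \<Rightarrow> bool) \<Rightarrow> 'a list \<Rightarrow> bool" where
  "refl_act S R s \<phi> p \<longleftrightarrow> p \<in> lists S \<and> ceq S R [s] p \<noteq> \<phi> (s # p @ [s])"

definition refl_space :: "'a set \<Rightarrow> 'a list uprod set \<Rightarrow> ('a list \<Rightarrow> bool) set" where
  "refl_space S R = {\<phi>. (\<forall>p p'. ceq S R p p' \<longrightarrow> \<phi> p = \<phi> p') \<and> (\<forall>p. \<phi> p \<longrightarrow> p \<in> lists S)}"

lemma prefix_refl_Cons: "prefix_refl (s # v) 0 = [s]"
  "prefix_refl (s # v) (Suc i) = s # prefix_refl v i @ [s]"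
  by (simp_all add: prefix_refl_def)

lemma refl_count_Cons:
  assumes "s \<in> S"
  shows "refl_count S R (s # v) p = of_bool (ceq S R [s] p) + refl_count S R v (s # p @ [s])"
  unfolding refl_count_def
  by (simp add: sum.lessThan_Suc_shift prefix_refl_Cons ceq_conj_iff[OF assms] del: sum.lessThan_Suc)

lemma refl_act_closed:
  assumes "s \<in> S" "\<phi> \<in> refl_space S R"
  shows "refl_act S R s \<phi> \<in> refl_space S R"
proof -
  have "refl_act S R s \<phi> p = refl_act S R s \<phi> p'" if "ceq S R p p'" for p p'
  proof -
    have "ceq S R (s # p @ [s]) (s # p' @ [s])"
      using that assms(1) by (intro ceq_Cons ceq_appendR) auto
    then have "\<phi> (s # p @ [s]) = \<phi> (s # p' @ [s])"
      using assms(2) unfolding refl_space_def by blast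
    moreover have "ceq S R [s] p = ceq S R [s] p'"
      using that ceq_trans ceq_sym by blast
    ultimately show ?thesis
      using ceq_lists[OF that] by (simp add: refl_act_def)
  qed
  then show ?thesis
    by (auto simp: refl_space_def refl_act_def)
qed

lemma refl_act_invol:
  assumes "s \<in> S" "\<phi> \<in> refl_space S R"
  shows "refl_act S R s (refl_act S R s \<phi>) = \<phi>"
proof
  fix p
  show "refl_act S R s (refl_act S R s \<phi>) p = \<phi> p"
  proof (cases "p \<in> lists S")
    case True
    have "ceq S R (s # (s # p @ [s]) @ [s]) p"
      using ceq_conj_iff[OF assms(1), of R "s # p @ [s]" p] assms(1) True by (simp add: ceq_refl)
    then have "\<phi> (s # (s # p @ [s]) @ [s]) = \<phi> p"
      using assms(2) unfolding refl_space_def by blast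
    moreover have "ceq S R [s] (s # p @ [s]) \<longleftrightarrow> ceq S R [s] p"
    proof -
      have "ceq S R (s # [s] @ [s]) [s]"
        using ceq_Cons_Cons[of s S "[s]" R] assms(1) by simp
      then show ?thesis
        using ceq_conj_iff[OF assms(1), of R "[s]" p] ceq_trans ceq_sym by blast
    qed
    ultimately show ?thesis
      using True assms(1) by (auto simp: refl_act_def)
  qed (use assms in \<open>auto simp: refl_act_def refl_space_def\<close>)
qed

lemma foldr_refl_act:
  assumes "v \<in> lists S" "p \<in> lists S"
  shows "foldr (refl_act S R) v \<phi> p \<longleftrightarrow> odd (refl_count S R v p) \<noteq> \<phi> (rev v @ p @ v)"
  using assms
proof (induction v arbitrary: p)
  case Nil
  then show ?case by (simp add: refl_count_def)
next
  case (Cons s v)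
  have *: "s \<in> S" "v \<in> lists S" "s # p @ [s] \<in> lists S"
    using Cons.hyps Cons.prems by simp_all
  show ?case
    using Cons.IH[OF *(3)] Cons.prems unfolding refl_count_Cons[OF *(1)]
    by (auto simp: refl_act_def)
qed

lemma take_alternating: "i \<le> m \<Longrightarrow> take i (alternating m s t) = alternating i s t"
  by (induction m arbitrary: i s t) (auto simp: take_Cons split: nat.splits)

lemma nth_alternating: "i < m \<Longrightarrow> alternating m s t ! i = (if even i then s else t)"
  by (induction m arbitrary: i s t) (auto simp: nth_Cons split: nat.splits)

lemma prefix_refl_alternating:
  assumes "i < m"
  shows "prefix_refl (alternating m s t) i = alternating (2 * i + 1) s t"
proof -
  have "2 * i + 1 = i + (1 + i)" by simp
  then have "alternating (2 * i + 1) s t =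
      alternating i s t @ (if even i then alternating (1 + i) s t else alternating (1 + i) t s)"
    using alternating_add by metis
  then show ?thesis
    using assms by (simp add: prefix_refl_def take_alternating nth_alternating rev_alternating)
qed

lemma alternating_square_ceq:
  assumes "braid_pres S R" "braid_relation m s t \<in> R"
  shows "ceq S R (alternating (2 * m) s t) []"
proof -
  let ?w = "alternating m s t"
  have w: "?w \<in> lists S"
    using assms braid_pres_lists unfolding braid_relation_def by blast
  have "ceq S R (alternating m s t) (alternating m t s)"
    using ceq_braid[OF assms] .
  then have "ceq S R (alternating m s t @ alternating m s t) (alternating m s t @ alternating m t s)"
    using w ceq_appendL by blast
  moreover have "alternating (2 * m) s t = ?w @ (if even m then alternating m s t else alternating m t s)"
    using alternating_add[of m m s t] by (simp add: mult_2)
  ultimately show ?thesis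
    using ceq_append_rev[OF w, of R]
    by (cases "even m") (simp_all add: rev_alternating, metis ceq_trans, metis ceq_trans ceq_sym)
qed

text \<open>Both sides run through the same reflections in opposite orders: the trivial alternating
  word of length 2m splits into two odd alternating words, which are palindromes and thus
  involutions, so they are equal.\<close>

lemma refl_count_braid:
  assumes "braid_pres S R" "braid_relation m s t \<in> R"
  shows "refl_count S R (alternating m s t) p = refl_count S R (alternating m t s) p"
proof -
  have st: "ceq S R (alternating (2 * (m - Suc i) + 1) s t) (alternating (2 * i + 1) t s)"
    if "i < m" for i
  proof -
    let ?u = "alternating (2 * (m - Suc i) + 1) s t" and ?v = "alternating (2 * i + 1) t s"
    have "2 * m = (2 * (m - Suc i) + 1) + (2 * i + 1)"
      using that by simp
    then have eq: "alternating (2 * m) s t = ?u @ ?v"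
      using alternating_add[of "2 * (m - Suc i) + 1" "2 * i + 1" s t] by (simp del: alternating.simps)
    then have *: "ceq S R (?u @ ?v) []"
      using alternating_square_ceq[OF assms] by simp
    then have "?u \<in> lists S"
      using ceq_lists[OF *] by simp
    from ceq_moveL[OF this] * have "ceq S R ?v (rev ?u @ [])"
      by blast
    then have "ceq S R ?v ?u"
      by (simp add: rev_alternating del: alternating.simps)
    then show ?thesis
      by (rule ceq_sym)
  qed
  have "refl_count S R (alternating m s t) p =
      (\<Sum>i<m. of_bool (ceq S R (alternating (2 * i + 1) s t) p))"
    unfolding refl_count_def by (simp add: prefix_refl_alternating del: alternating.simps)
  also have "\<dots> = (\<Sum>i<m. of_bool (ceq S R (alternating (2 * (m - Suc i) + 1) s t) p))"
    by (rule sum.nat_diff_reindex[symmetric])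
  also have "\<dots> = (\<Sum>i<m. of_bool (ceq S R (alternating (2 * i + 1) t s) p))"
  proof (rule sum.cong[OF HOL.refl])
    fix i assume "i \<in> {..<m}"
    then show "of_bool (ceq S R (alternating (2 * (m - Suc i) + 1) s t) p) =
        (of_bool (ceq S R (alternating (2 * i + 1) t s) p) :: nat)"
      using ceq_trans[OF st[of i], of p] ceq_trans[OF ceq_sym[OF st[of i]], of p] by auto
  qed
  also have "\<dots> = refl_count S R (alternating m t s) p"
    unfolding refl_count_def by (simp add: prefix_refl_alternating del: alternating.simps)
  finally show ?thesis .
qed

text \<open>Applied to the constantly false predicate, the action returns exactly the parity of the
  count.\<close>

lemma refl_count_ceq:
  assumes "braid_pres S R" "ceq S R v v'" "p \<in> lists S"
  shows "odd (refl_count S R v p) = odd (refl_count S R v' p)"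
proof -
  have "foldr (refl_act S R) v (\<lambda>_. False) = foldr (refl_act S R) v' (\<lambda>_. False)"
  proof (rule ceq_foldr[OF assms(2)])
    show "(\<lambda>_. False) \<in> refl_space S R"
      by (simp add: refl_space_def)
    fix u u' \<phi>
    assume u: "Upair u u' \<in> R" "u \<in> lists S" "u' \<in> lists S" "\<phi> \<in> refl_space S R"
    have fc: "foldr (refl_act S R) w \<phi> \<in> refl_space S R" if "w \<in> lists S" for w
      using that by (induction w) (auto simp: u(4) refl_act_closed)
    obtain m s t where m: "u = alternating m s t" "u' = alternating m t s"
      using braid_presE[OF assms(1) u(1)] by metis
    show "foldr (refl_act S R) u \<phi> = foldr (refl_act S R) u' \<phi>"
    proof
      fix p
      show "foldr (refl_act S R) u \<phi> p = foldr (refl_act S R) u' \<phi> p"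
      proof (cases "p \<in> lists S")
        case True
        have "braid_relation m s t \<in> R"
          using m u(1) by (simp add: braid_relation_def)
        then have "refl_count S R u p = refl_count S R u' p"
          using m refl_count_braid[OF assms(1)] by metis
        moreover have uu: "ceq S R u u'"
          using ceq_of_pos_eq[OF assms(1) pos_eq_rel[OF u(1)] u(2)] .
        have "ceq S R (rev u) (rev u')"
          using ceq_of_pos_eq[OF assms(1) pos_eq_rel[OF braid_pres_rev[OF assms(1) u(1)]]] u(2)
          by (simp add: in_lists_conv_set)
        then have "ceq S R (rev u @ p @ u) (rev u' @ p @ u')"
          using uu True by (intro ceq_append ceq_refl)
        then have "\<phi> (rev u @ p @ u) = \<phi> (rev u' @ p @ u')"
          using u(4) unfolding refl_space_def by blast
        ultimately show ?thesis
          using foldr_refl_act True u(2,3) by metis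
      next
        case False
        then show ?thesis
          using fc[OF u(2)] fc[OF u(3)] unfolding refl_space_def by blast
      qed
    qed
  qed (auto intro: refl_act_closed refl_act_invol)
  then show ?thesis
    using foldr_refl_act[of v S p R "\<lambda>_. False"] foldr_refl_act[of v' S p R "\<lambda>_. False"]
      ceq_lists[OF assms(2)] assms(3) by simp
qed

text \<open>The reflection retraces the prefix of \<open>v\<close> and cancels its letter number
  \<open>i\<close>.\<close>

lemma prefix_refl_delete:
  assumes "i < length v" "v \<in> lists S" "ceq S R (prefix_refl v i) [s]"
  shows "ceq S R (s # v) (take i v @ drop (Suc i) v)"
proof -
  let ?a = "take i v" and ?x = "v ! i" and ?b = "drop (Suc i) v"
  have v: "v = ?a @ [?x] @ ?b"
    using assms(1) id_take_nth_drop by fastforce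
  have "set v \<subseteq> S"
    using assms(2) by (auto simp: in_lists_conv_set)
  then have ab: "?a \<in> lists S" "?x \<in> S" "?b \<in> lists S"
    using assms(1) set_take_subset[of i v] set_drop_subset[of "Suc i" v]
    by (auto simp: in_lists_conv_set nth_mem subset_iff)
  have "ceq S R ([s] @ v) (prefix_refl v i @ v)"
    using ceq_appendR[OF assms(2) ceq_sym[OF assms(3)]] .
  also have "prefix_refl v i @ v = prefix_refl v i @ (?a @ [?x] @ ?b)"
    by (simp only: v[symmetric])
  also have "\<dots> = ?a @ [?x] @ (rev ?a @ ?a) @ ([?x] @ ?b)"
    by (simp add: prefix_refl_def)
  also have "ceq S R \<dots> (?a @ [?x] @ [] @ ([?x] @ ?b))"
    using ab by (intro ceq_appendL ceq_appendR ceq_rev_append) auto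
  also have "ceq S R \<dots> (?a @ ?b)"
    using ceq_appendL[OF ab(1) ceq_Cons_Cons[OF ab(2,3)]] by simp
  finally show ?thesis by simp
qed

definition reduced :: "'a set \<Rightarrow> 'a list uprod set \<Rightarrow> 'a list \<Rightarrow> bool" where
  "reduced S R v \<longleftrightarrow> v \<in> lists S \<and> (\<forall>v'. ceq S R v v' \<longrightarrow> length v \<le> length v')"

lemma reduced_ex:
  assumes "v \<in> lists S"
  shows "\<exists>v'. ceq S R v v' \<and> reduced S R v'"
proof -
  obtain v' where *: "ceq S R v v'" "\<And>u. ceq S R v u \<Longrightarrow> length v' \<le> length u"
    using ex_has_least_nat[of "ceq S R v" v length] ceq_refl[OF assms] by metis
  have "reduced S R v'"
    using * ceq_lists[OF *(1)] ceq_trans[OF *(1)] unfolding reduced_def by blast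
  with * show ?thesis by blast
qed

lemma reduced_length: "reduced S R v \<Longrightarrow> reduced S R v' \<Longrightarrow> ceq S R v v' \<Longrightarrow> length v = length v'"
  unfolding reduced_def by (meson ceq_sym le_antisym)

lemma reduced_ceq: "reduced S R v \<Longrightarrow> ceq S R v v' \<Longrightarrow> length v' \<le> length v \<Longrightarrow> reduced S R v'"
  unfolding reduced_def by (meson ceq_lists ceq_sym ceq_trans le_trans)

lemma reduced_append:
  assumes "reduced S R (u @ v)"
  shows "reduced S R u" "reduced S R v"
proof -
  have l: "u \<in> lists S" "v \<in> lists S"
    using assms by (auto simp: reduced_def)
  have "length u \<le> length u'" if "ceq S R u u'" for u'
    using assms ceq_appendR[OF l(2) that] unfolding reduced_def by fastforce
  then show "reduced S R u" using l by (simp add: reduced_def)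
  have "length v \<le> length v'" if "ceq S R v v'" for v'
    using assms ceq_appendL[OF l(1) that] unfolding reduced_def by fastforce
  then show "reduced S R v" using l by (simp add: reduced_def)
qed

lemma reduced_Cons: "reduced S R (s # v) \<Longrightarrow> reduced S R v"
  using reduced_append(2)[of S R "[s]" v] by simp

text \<open>By parity the reduced form \<open>u\<close> of sv is shorter than \<open>v\<close>, and
  v = su. The reflection s is absent from the sequence of \<open>u\<close>, as deleting a letter
  would shorten \<open>v\<close>; hence it occurs exactly once for su. Odd parity is shared by
  \<open>v\<close>, so s occurs there too.\<close>

lemma exchange:
  assumes "braid_pres S R" "reduced S R v" "s \<in> S" "\<not> reduced S R (s # v)"
  shows "\<exists>i<length v. ceq S R (prefix_refl v i) [s]"
proof (rule ccontr)
  assume contra: "\<not> ?thesis"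
  have v: "v \<in> lists S"
    using assms(2) by (simp add: reduced_def)
  obtain u where u: "ceq S R (s # v) u" "reduced S R u"
    using reduced_ex[of "s # v" S R] v assms(3) by auto
  have "length u \<noteq> length (s # v)"
    using reduced_ceq[OF u(2) ceq_sym[OF u(1)]] assms(4) by auto
  moreover have "length u \<le> length (s # v)"
    using u ceq_sym[OF u(1)] unfolding reduced_def by blast
  moreover have "even (length (s # v)) = even (length u)"
    using ceq_parity[OF assms(1) u(1)] .
  ultimately have len: "length u < length v"
    by (cases "length u = length v") auto
  have vu: "ceq S R v (s # u)"
    using u(1) ceq_moveL_Cons[OF assms(3)] by blast
  have no: "\<not> ceq S R (prefix_refl u i) [s]" if "i < length u" for i
  proof
    assume "ceq S R (prefix_refl u i) [s]"
    then have "ceq S R v (take i u @ drop (Suc i) u)"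
      using prefix_refl_delete[OF that] u(2) vu ceq_trans unfolding reduced_def by blast
    then have "length v \<le> length (take i u @ drop (Suc i) u)"
      using assms(2) unfolding reduced_def by blast
    then show False
      using len that by simp
  qed
  have s: "ceq S R (s # [s] @ [s]) [s]"
    using ceq_Cons_Cons[of s S "[s]" R] assms(3) by simp
  have "\<not> ceq S R (prefix_refl u i) (s # [s] @ [s])" if "i < length u" for i
    using no[OF that] ceq_trans[OF _ s] by blast
  then have "refl_count S R u (s # [s] @ [s]) = 0"
    by (simp add: refl_count_def)
  then have "refl_count S R (s # u) [s] = 1"
    using refl_count_Cons[OF assms(3), of R u "[s]"] assms(3) by (simp add: ceq_refl)
  moreover have "refl_count S R v [s] = 0"
    using contra by (simp add: refl_count_def)
  ultimately show False
    using refl_count_ceq[OF assms(1) vu, of "[s]"] assms(3) by simp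
qed

lemma exchange_delete:
  assumes "braid_pres S R" "reduced S R v" "s \<in> S" "ceq S R v (s # b)" "length b < length v"
  shows "\<exists>i<length v. ceq S R (prefix_refl v i) [s]"
proof (rule exchange[OF assms(1-3)])
  have "ceq S R (s # v) b"
    using assms(3,4) ceq_moveL_Cons ceq_sym by metis
  then show "\<not> reduced S R (s # v)"
    using assms(5) unfolding reduced_def by fastforce
qed

subsection \<open>Dihedral subgroups and Matsumoto's theorem\<close>

text \<open>If \<open>w\<close> can start with both s and t, an alternating prefix starting with x
  can be lengthened: exchange puts the other letter y in front at the cost of one deleted letter,
  and that letter lies behind the prefix. The first letter changes each time, hence the unordered
  pair.\<close>

lemma reduced_alternating_prefix:
  assumes "artin_tits S R" "reduced S R w" "s \<noteq> t" "s \<in> S" "t \<in> S"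
    and "ceq S R w (s # a)" "length w = Suc (length a)"
    and "ceq S R w (t # b)" "length w = Suc (length b)"
    and "1 \<le> k" "\<And>m. braid_relation m s t \<in> R \<Longrightarrow> k \<le> m"
  shows "\<exists>x y c. {x, y} = {s, t} \<and> ceq S R w (alternating k x y @ c) \<and> length w = k + length c"
  using assms(10,11)
proof (induction k rule: dec_induct)
  case base
  show ?case
    using assms(6,7) by (intro exI[of _ s] exI[of _ t] exI[of _ a]) auto
next
  case (step k)
  have bp: "braid_pres S R"
    using artin_tits_braid_pres[OF assms(1)] .
  obtain x y c where *: "{x, y} = {s, t}" "ceq S R w (alternating k x y @ c)" "length w = k + length c"
    using step.IH step.prems Suc_leD by blast
  have xy_cases: "x = s \<and> y = t \<or> x = t \<and> y = s"
    using *(1) by (auto simp: doubleton_eq_iff)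
  have xy: "x \<noteq> y" "x \<in> S" "y \<in> S"
    using xy_cases assms(3-5) by auto
  have rel: "braid_relation n x y = braid_relation n s t" for n
    using xy_cases by (auto intro: braid_relation_sym)
  obtain d where d: "ceq S R w (y # d)" "length d < length w"
    using xy_cases assms(6-9) by auto
  let ?v = "alternating k x y @ c"
  have v: "reduced S R ?v" "?v \<in> lists S"
    using reduced_ceq[OF assms(2) *(2)] *(3) by (auto simp: reduced_def)
  obtain i where i: "i < length ?v" "ceq S R (prefix_refl ?v i) [y]"
    using exchange_delete[OF bp v(1) xy(3) ceq_trans[OF ceq_sym[OF *(2)] d(1)]] d(2) *(3) by auto
  \<comment> \<open>A deletion inside the prefix would make the alternating word of length 2(i + 1)
    trivial, although i + 1 is below every exponent of a relation.\<close>
  have "k \<le> i"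
  proof (rule ccontr)
    assume "\<not> k \<le> i"
    then have "i < k" by simp
    then have "prefix_refl ?v i = prefix_refl (alternating k x y) i"
      by (simp add: prefix_refl_def nth_append)
    then have "ceq S R (alternating (2 * i + 1) x y) [y]"
      using prefix_refl_alternating[OF \<open>i < k\<close>] i(2) by metis
    then have "ceq S R (alternating (2 * i + 1) x y @ [y]) ([y] @ [y])"
      using xy by (intro ceq_appendR) auto
    also have "ceq S R ([y] @ [y]) []"
      using ceq_square[OF xy(3)] by simp
    also have "alternating (2 * i + 1) x y @ [y] = alternating (2 * Suc i) x y"
      using alternating_snoc[of "2 * i + 1" x y] by simp
    finally have "ceq S R (alternating (2 * Suc i) x y) []" .
    moreover have "Suc i < n" if "braid_relation n x y \<in> R" for n
      using step.prems[of n] rel[of n] that \<open>i < k\<close> by simp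
    ultimately show False
      using alternating_not_ceq_Nil[OF assms(1) xy(1), of "Suc i"] by blast
  qed
  then have "take i ?v @ drop (Suc i) ?v = alternating k x y @ take (i - k) c @ drop (Suc i - k) c"
    by (simp add: Suc_diff_le)
  then obtain c' where c': "take i ?v @ drop (Suc i) ?v = alternating k x y @ c'" "Suc (length c') = length c"
    using \<open>k \<le> i\<close> i(1) by (auto simp: Suc_diff_le)
  have "ceq S R (y # ?v) (alternating k x y @ c')"
    using prefix_refl_delete[OF i(1) v(2) i(2)] c'(1) by simp
  then have "ceq S R ?v (y # alternating k x y @ c')"
    by (rule iffD1[OF ceq_moveL_Cons[OF xy(3)]])
  with *(2) have "ceq S R w (y # alternating k x y @ c')"
    by (rule ceq_trans)
  then have "ceq S R w (alternating (Suc k) y x @ c')"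
    by (simp only: alternating.simps append_Cons)
  moreover have "{y, x} = {s, t}"
    unfolding *(1)[symmetric] by (rule insert_commute)
  moreover have "length w = Suc k + length c'"
    using *(3) c'(2) by simp
  ultimately show ?case
    by blast
qed

lemma reduced_dihedral:
  assumes "artin_tits S R" "reduced S R w" "s \<noteq> t" "s \<in> S" "t \<in> S"
    and "ceq S R w (s # a)" "length w = Suc (length a)"
    and "ceq S R w (t # b)" "length w = Suc (length b)"
  shows "\<exists>m c. braid_relation m s t \<in> R \<and> m \<ge> 2 \<and> ceq S R w (alternating m s t @ c) \<and>
    length w = m + length c"
proof -
  note bp = artin_tits_braid_pres[OF assms(1)]
  \<comment> \<open>Without a relation nothing bounds the alternating prefix, and it would become
    longer than \<open>w\<close>.\<close>
  have "\<exists>m. braid_relation m s t \<in> R"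
  proof (rule ccontr)
    assume "\<not> ?thesis"
    then have "\<exists>x y c. {x, y} = {s, t} \<and> ceq S R w (alternating (Suc (length w)) x y @ c) \<and>
        length w = Suc (length w) + length c"
      by (intro reduced_alternating_prefix[OF assms]) auto
    then show False
      by simp
  qed
  then obtain m where m: "braid_relation m s t \<in> R"
    by blast
  obtain m' s' t' where m': "m' \<ge> 2" "alternating m s t = alternating m' s' t'"
    using braid_presE[OF bp] m unfolding braid_relation_def by metis
  have "m \<ge> 2"
    using m'(1) arg_cong[OF m'(2), of length] by simp
  then have "\<exists>x y c. {x, y} = {s, t} \<and> ceq S R w (alternating m x y @ c) \<and> length w = m + length c"
    using artin_tits_unique[OF assms(1) m] by (intro reduced_alternating_prefix[OF assms]) auto
  then obtain x y c where *: "{x, y} = {s, t}" "ceq S R w (alternating m x y @ c)" "length w = m + length c"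
    by blast
  consider "x = s" "y = t" | "x = t" "y = s"
    using *(1) by (auto simp: doubleton_eq_iff)
  then have "ceq S R w (alternating m s t @ c)"
  proof cases
    case 1
    then show ?thesis
      using *(2) by simp
  next
    case 2
    have "c \<in> lists S"
      using ceq_lists[OF *(2)] by simp
    from ceq_appendR[OF this ceq_sym[OF ceq_braid[OF bp m]]] *(2) 2 show ?thesis
      by (auto intro: ceq_trans)
  qed
  then show ?thesis
    using m \<open>m \<ge> 2\<close> *(3) by blast
qed

lemma alternating_Cons: "m \<ge> 1 \<Longrightarrow> alternating m s t = s # alternating (m - 1) t s"
  by (cases m) auto

text \<open>Transfers equality in the Coxeter group to the positive monoid. When the first letters
  differ, \<open>reduced_dihedral\<close> inserts a word that begins with a full side of their braid
  relation; the induction hypothesis then applies behind either first letter.\<close>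

lemma matsumoto:
  assumes "artin_tits S R" "reduced S R v" "ceq S R v v'" "length v = length v'"
  shows "pos_eq R v v'"
  using assms(2-4)
proof (induction "length v" arbitrary: v v' rule: less_induct)
  case less
  note bp = artin_tits_braid_pres[OF assms(1)]
  show ?case
  proof (cases v)
    case Nil
    then show ?thesis using less.prems by simp
  next
    case (Cons s a)
    then obtain t b where v': "v' = t # b"
      using less.prems(3) by (cases v') auto
    have ST: "s \<in> S" "t \<in> S" "a \<in> lists S" "b \<in> lists S"
      using ceq_lists[OF less.prems(2)] Cons v' by auto
    have red: "reduced S R a" "reduced S R b"
      using reduced_Cons less.prems reduced_ceq[OF less.prems(1,2)] Cons v' by auto
    show ?thesis
    proof (cases "s = t")
      case True
      then have "ceq S R a b"
        using less.prems(2) Cons v' ceq_cancel_Cons[OF ST(1)] by simp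
      then show ?thesis
        using less.hyps[of a b] red less.prems(3) Cons v' True pos_eq_Cons by auto
    next
      case False
      obtain m c where m: "braid_relation m s t \<in> R" "m \<ge> 2" "ceq S R v (alternating m s t @ c)"
          "length v = m + length c"
        using reduced_dihedral[OF assms(1) less.prems(1) False ST(1,2), of a b] less.prems(2,3) Cons v'
          ceq_refl[of v S R] less.prems(1) unfolding reduced_def by auto
      have c: "c \<in> lists S"
        using ceq_lists[OF m(3)] by simp
      have st: "alternating m s t = s # alternating (m - 1) t s" "alternating m t s = t # alternating (m - 1) s t"
        using alternating_Cons[of m s t] alternating_Cons[of m t s] m(2) by simp_all
      have "ceq S R a (alternating (m - 1) t s @ c)"
        using m(3) ceq_cancel_Cons[OF ST(1)] Cons st by simp
      then have 1: "pos_eq R a (alternating (m - 1) t s @ c)"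
        using less.hyps[of a] red m(2,4) Cons by simp
      have "ceq S R v (alternating m t s @ c)"
        using m(3) ceq_appendR[OF c ceq_braid[OF bp m(1)]] ceq_trans by blast
      then have "ceq S R (t # b) (alternating m t s @ c)"
        using less.prems(2) v' ceq_sym ceq_trans by blast
      then have "ceq S R b (alternating (m - 1) s t @ c)"
        using ceq_cancel_Cons[OF ST(2)] st by simp
      then have 2: "pos_eq R b (alternating (m - 1) s t @ c)"
        using less.hyps[of b] red m(2,4) Cons v' less.prems(3) by simp
      have "pos_eq R v (alternating m s t @ c)"
        using pos_eq_Cons[OF 1] Cons st by simp
      also have "pos_eq R \<dots> (alternating m t s @ c)"
        using pos_eq_appendR[OF pos_eq_braid[OF m(1)]] .
      also have "pos_eq R \<dots> v'"
        using pos_eq_sym[OF pos_eq_Cons[OF 2, of t]] v' st by simp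
      finally show ?thesis .
    qed
  qed
qed

subsection \<open>The longest element\<close>

lemma reduced_bounded:
  assumes "finite (carrier (coxeter_group S R))"
  shows "finite (length ` Collect (reduced S R))"
proof -
  let ?Q = "R \<union> {Upair [s, s] [] |s. s \<in> S}"
  let ?f = "\<lambda>C. length (SOME v. reduced S R v \<and> word_class S ?Q (pos v) = C)"
  have "length v \<in> ?f ` carrier (coxeter_group S R)" if v: "reduced S R v" for v
  proof
    have l: "v \<in> lists S" using v by (simp add: reduced_def)
    then show "word_class S ?Q (pos v) \<in> carrier (coxeter_group S R)"
      by (auto simp: coxeter_group_def pres_group_simps)
    define u where "u = (SOME u. reduced S R u \<and> word_class S ?Q (pos u) = word_class S ?Q (pos v))"
    have u: "reduced S R u \<and> word_class S ?Q (pos u) = word_class S ?Q (pos v)"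
      unfolding u_def by (rule someI[where x = v]) (simp add: v)
    moreover have "pos v \<in> words S" using l by simp
    ultimately have "ceq S R v u"
      unfolding ceq_def using word_class_eq_iff[of "pos v" S ?Q "pos u"] by simp
    then have "length v = length u"
      using reduced_length v u by blast
    then show "length v = ?f (word_class S ?Q (pos v))"
      by (simp add: u_def)
  qed
  then have "length ` Collect (reduced S R) \<subseteq> ?f ` carrier (coxeter_group S R)"
    by blast
  then show ?thesis
    using assms finite_surj by blast
qed

lemma reduced_Nil: "reduced S R []"
  by (simp add: reduced_def)

lemma longest_ex:
  assumes "spherical S R"
  shows "\<exists>w. reduced S R w \<and> (\<forall>v. reduced S R v \<longrightarrow> length v \<le> length w)"
proof -
  let ?L = "length ` Collect (reduced S R)"
  have fin: "finite ?L"
    using assms reduced_bounded unfolding spherical_def by blast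
  have "?L \<noteq> {}"
    using reduced_Nil by blast
  then have "Max ?L \<in> ?L"
    using fin Max_in by blast
  then show ?thesis
    using Max_ge[OF fin] by fastforce
qed

text \<open>A completion vx of \<open>v\<close> is turned into one of sv. Maximality makes svx not
  reduced, so exchange deletes a letter; as sv is reduced the letter lies in x, leaving vy, and svx
  = vy gives svy = vx.\<close>

lemma longest_complete:
  assumes "braid_pres S R" "reduced S R w" "\<And>v. reduced S R v \<Longrightarrow> length v \<le> length w"
    and "reduced S R v"
  shows "\<exists>x. ceq S R (v @ x) w \<and> length v + length x = length w"
  using assms(4)
proof (induction v)
  case Nil
  then show ?case
    using assms(2) ceq_refl[of w S R] by (auto simp: reduced_def)
next
  case (Cons s v)
  have v: "reduced S R v" and s: "s \<in> S"
    using reduced_Cons[OF Cons.prems] Cons.prems by (auto simp: reduced_def)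
  obtain x where x: "ceq S R (v @ x) w" "length v + length x = length w"
    using Cons.IH[OF v] by blast
  have red: "reduced S R (v @ x)"
    using reduced_ceq[OF assms(2) ceq_sym[OF x(1)]] x(2) by simp
  then have vx: "v @ x \<in> lists S"
    by (simp add: reduced_def)
  have "\<not> reduced S R (s # v @ x)"
    using assms(3)[of "s # v @ x"] x(2) by auto
  then obtain i where i: "i < length (v @ x)" "ceq S R (prefix_refl (v @ x) i) [s]"
    using exchange[OF assms(1) red s] by blast
  have "length v \<le> i"
  proof (rule ccontr)
    assume "\<not> length v \<le> i"
    then have i': "i < length v" by simp
    then have "prefix_refl (v @ x) i = prefix_refl v i"
      by (simp add: prefix_refl_def nth_append)
    then have "ceq S R (s # v) (take i v @ drop (Suc i) v)"
      using prefix_refl_delete[OF i'] v i(2) unfolding reduced_def by metis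
    then have "length (s # v) \<le> length (take i v @ drop (Suc i) v)"
      using Cons.prems unfolding reduced_def by blast
    then show False
      using i' by simp
  qed
  then have "take i (v @ x) @ drop (Suc i) (v @ x) =
      v @ take (i - length v) x @ drop (Suc i - length v) x"
    by (simp add: Suc_diff_le)
  then obtain y where y: "take i (v @ x) @ drop (Suc i) (v @ x) = v @ y" "Suc (length y) = length x"
    using \<open>length v \<le> i\<close> i(1) by (auto simp: Suc_diff_le)
  have "ceq S R (s # v @ x) (v @ y)"
    using prefix_refl_delete[OF i(1) vx i(2)] y(1) by simp
  then have "ceq S R (s # v @ y) (v @ x)"
    using ceq_moveL_Cons[OF s] ceq_sym by blast
  then have "ceq S R ((s # v) @ y) w"
    using x(1) ceq_trans by fastforce
  then show ?case
    using x(2) y(2) by (intro exI[of _ y]) auto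
qed

section \<open>Common multiples and reversing\<close>

text \<open>Reversing uses only these two rules about first letters: left cancellation, and that
  common multiples of distinct letters factor through their braid relation. \<open>Q\<close> will be
  first reducedness, then membership in \<open>lists S\<close>.\<close>

locale braid_head =
  fixes S :: "'a set" and R :: "'a list uprod set" and Q :: "'a list \<Rightarrow> bool"
  assumes at: "artin_tits S R"
    and Q_lists: "Q w \<Longrightarrow> w \<in> lists S"
    and Q_prefix: "Q (u @ v) \<Longrightarrow> Q u"
    and Q_suffix: "Q (u @ v) \<Longrightarrow> Q v"
    and Q_pos_eq: "Q u \<Longrightarrow> pos_eq R u v \<Longrightarrow> Q v"
    and head_eq: "Q (s # a) \<Longrightarrow> pos_eq R (s # a) (s # b) \<Longrightarrow> pos_eq R a b"
    and head_neq: "Q (s # a) \<Longrightarrow> s \<noteq> t \<Longrightarrow> pos_eq R (s # a) (t # b) \<Longrightarrow>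
      \<exists>m c. m \<ge> 2 \<and> braid_relation m s t \<in> R \<and> pos_eq R a (alternating (m - 1) t s @ c) \<and>
        pos_eq R b (alternating (m - 1) s t @ c)"
begin

lemma bp: "braid_pres S R"
  using artin_tits_braid_pres[OF at] .

text \<open>Complements \<open>x\<close>, \<open>y\<close> for which ux = vy is the least common
  right multiple. Leastness is tested only against multiples in \<open>Q\<close>.\<close>

definition lcm_compl :: "'a list \<Rightarrow> 'a list \<Rightarrow> 'a list \<Rightarrow> 'a list \<Rightarrow> bool" where
  "lcm_compl u v x y \<longleftrightarrow> Q (u @ x) \<and> pos_eq R (u @ x) (v @ y) \<and>
    (\<forall>a b. Q (u @ a) \<longrightarrow> pos_eq R (u @ a) (v @ b) \<longrightarrow> (\<exists>z. pos_eq R a (x @ z) \<and> pos_eq R b (y @ z)))"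

lemma lcm_complD:
  assumes "lcm_compl u v x y" "Q (u @ a)" "pos_eq R (u @ a) (v @ b)"
  obtains z where "pos_eq R a (x @ z)" "pos_eq R b (y @ z)"
  using assms unfolding lcm_compl_def by blast

lemma lcm_complI:
  assumes "Q (u @ a0)" "pos_eq R (u @ a0) (v @ b0)" "pos_eq R (u @ x) (v @ y)"
    and "\<And>a b. Q (u @ a) \<Longrightarrow> pos_eq R (u @ a) (v @ b) \<Longrightarrow> \<exists>z. pos_eq R a (x @ z) \<and> pos_eq R b (y @ z)"
  shows "lcm_compl u v x y"
proof -
  obtain z where "pos_eq R a0 (x @ z)"
    using assms(4)[OF assms(1,2)] by blast
  then have "pos_eq R (u @ a0) ((u @ x) @ z)"
    using pos_eq_appendL[of R a0 "x @ z" u] by simp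
  then have "Q (u @ x)"
    using assms(1) Q_pos_eq Q_prefix by blast
  then show ?thesis
    using assms(3,4) unfolding lcm_compl_def by blast
qed

lemma pos_eq_alternating_Cons:
  assumes "m \<ge> 2" "braid_relation m s t \<in> R"
  shows "pos_eq R (s # alternating (m - 1) t s @ x) (t # alternating (m - 1) s t @ x)"
  using pos_eq_appendR[OF pos_eq_braid[OF assms(2)], of x] assms(1)
    alternating_Cons[of m s t] alternating_Cons[of m t s] by simp

text \<open>The given common multiple u a0 = v b0 is both guarantee and clock: it shows that
  differing first letters satisfy a relation, and its length decreases in every recursive call. Type
  2 is applied to single letters only.\<close>

lemma reversing:
  assumes "Q (u @ a0)" "pos_eq R (u @ a0) (v @ b0)"
  shows "\<exists>x y. special S R (inv_word (pos u) @ pos v) (pos x @ inv_word (pos y)) \<and> lcm_compl u v x y"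
  using assms
proof (induction "length (u @ a0)" arbitrary: u v a0 b0 rule: less_induct)
  case less
  have l: "u \<in> lists S" "v \<in> lists S" "a0 \<in> lists S" "b0 \<in> lists S"
    using Q_lists[OF less.prems(1)] Q_lists[OF Q_pos_eq[OF less.prems]] by auto
  have len: "length (u @ a0) = length (v @ b0)"
    using pos_eq_length[OF bp less.prems(2)] .
  consider "u = []" | "v = []" | s u' t v' where "u = s # u'" "v = t # v'"
    by (cases u; cases v) auto
  then show ?case
  proof cases
    case 1
    have "lcm_compl u v v []"
      by (rule lcm_complI[OF less.prems]) (auto simp: 1)
    then show ?thesis
      using 1 by (intro exI[of _ v] exI[of _ "[]"]) simp
  next
    case 2
    have "lcm_compl u v [] u"
      by (rule lcm_complI[OF less.prems]) (auto simp: 2 intro: pos_eq_sym)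
    then show ?thesis
      using 2 by (intro exI[of _ u] exI[of _ "[]"]) simp
  next
    case (3 s u' t v')
    have ST: "s \<in> S" "t \<in> S" "u' \<in> lists S" "v' \<in> lists S"
      using l 3 by auto
    show ?thesis
    proof (cases "s = t")
      case True
      have *: "Q (u' @ a) \<and> pos_eq R (u' @ a) (v' @ b)" if "Q (u @ a)" "pos_eq R (u @ a) (v @ b)" for a b
        using that head_eq[of s "u' @ a" "v' @ b"] Q_suffix[of "[s]" "u' @ a"] True 3 by simp
      obtain x y where xy: "special S R (inv_word (pos u') @ pos v') (pos x @ inv_word (pos y))"
          "lcm_compl u' v' x y"
        using less.hyps[of u' a0 v' b0] *[OF less.prems] 3 by auto
      have "special_step S R (inv_word (pos u) @ pos v) (inv_word (pos u') @ pos v')"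
        using special_step.type0_neg_pos[of "inv_word (pos u')" S "pos v'" s R] ST True 3
        by (simp add: inv_word_Cons)
      then have 1: "special S R (inv_word (pos u) @ pos v) (pos x @ inv_word (pos y))"
        using xy(1) by (rule converse_rtranclp_into_rtranclp)
      have "pos_eq R (u' @ x) (v' @ y)"
        using xy(2) unfolding lcm_compl_def by blast
      then have "pos_eq R (u @ x) (v @ y)"
        using True 3 pos_eq_Cons by fastforce
      then have "lcm_compl u v x y"
        using * lcm_complD[OF xy(2)] by (intro lcm_complI[OF less.prems]) metis+
      with 1 show ?thesis by blast
    next
      case False
      obtain m c0 where m: "m \<ge> 2" "braid_relation m s t \<in> R"
          "pos_eq R (u' @ a0) (alternating (m - 1) t s @ c0)" "pos_eq R (v' @ b0) (alternating (m - 1) s t @ c0)"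
        using head_neq[of s "u' @ a0" t "v' @ b0"] less.prems 3 False by auto
      define p where "p = alternating (m - 1) t s"
      define q where "q = alternating (m - 1) s t"
      have pq: "p \<in> lists S" "q \<in> lists S"
        unfolding p_def q_def by (rule alternating_in_lists[OF ST(2,1)], rule alternating_in_lists[OF ST(1,2)])
      \<comment> \<open>Any other common multiple involves the same relation, since the exponent of
        a pair is unique, and therefore passes through the same \<open>p\<close> and
        \<open>q\<close>.\<close>
      have split: "\<exists>c. pos_eq R (u' @ a) (p @ c) \<and> pos_eq R (v' @ b) (q @ c)"
        if ab: "Q (u @ a)" "pos_eq R (u @ a) (v @ b)" for a b
      proof -
        obtain n c where n: "n \<ge> 2" "braid_relation n s t \<in> R"
          "pos_eq R (u' @ a) (alternating (n - 1) t s @ c)" "pos_eq R (v' @ b) (alternating (n - 1) s t @ c)"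
          using head_neq[of s "u' @ a" t "v' @ b"] ab 3 False by auto
        have "n = m"
          using artin_tits_unique[OF at n(2) m(2)] .
        then show ?thesis
          using n(3,4) unfolding p_def q_def by blast
      qed
      have Qu: "Q (u' @ a)" if "Q (u @ a)" for a
        using that Q_suffix[of "[s]" "u' @ a"] 3 by simp
      have m': "pos_eq R (u' @ a0) (p @ c0)" "pos_eq R (v' @ b0) (q @ c0)"
        using m by (simp_all add: p_def q_def)
      obtain x1 y1 where 1: "special S R (inv_word (pos u') @ pos p) (pos x1 @ inv_word (pos y1))"
          "lcm_compl u' p x1 y1"
        using less.hyps[of u' a0 p c0] Qu[OF less.prems(1)] m'(1) 3 by auto
      obtain z0 where z0: "pos_eq R a0 (x1 @ z0)" "pos_eq R c0 (y1 @ z0)"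
        using lcm_complD[OF 1(2) Qu[OF less.prems(1)] m'(1)] .
      have qv: "pos_eq R ((q @ y1) @ z0) (v' @ b0)"
        using rtranclp_trans[OF pos_eq_appendL[OF pos_eq_sym[OF z0(2)], of q] pos_eq_sym[OF m'(2)]] by simp
      have Qv: "Q (v' @ b0)"
        using Q_pos_eq[OF less.prems] Q_suffix[of "[t]" "v' @ b0"] 3 by simp
      \<comment> \<open>Reversing u'^-1 p into x1 y1^-1 leaves y1^-1 q^-1 v' = (q y1)^-1 v' as the
        second problem; this is its common multiple, one letter shorter than u a0.\<close>
      have Qq: "Q ((q @ y1) @ z0)"
        using Q_pos_eq[OF Qv pos_eq_sym[OF qv]] .
      have "length ((q @ y1) @ z0) < length (u @ a0)"
        using pos_eq_length[OF bp qv] len 3 by simp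
      then obtain x2 y2 where 2: "special S R (inv_word (pos (q @ y1)) @ pos v') (pos x2 @ inv_word (pos y2))"
          "lcm_compl (q @ y1) v' x2 y2"
        using less.hyps[of "q @ y1" z0 v' b0] Qq qv by auto
      have w: "x1 \<in> lists S" "y1 \<in> lists S"
        using special_words[OF 1(1)] ST pq by simp_all
      have spq: "pos_eq R (s # p @ e) (t # q @ e)" for e
        unfolding p_def q_def using pos_eq_alternating_Cons[OF m(1,2)] .
      have "special_step S R (inv_word (pos u') @ inv_word (pos [s]) @ pos [t] @ pos v')
          (inv_word (pos u') @ pos p @ inv_word (pos q) @ pos v')"
      proof (rule special_step.type2_right)
        show "Upair ([s] @ p) ([t] @ q) \<in> R"
          using m(1,2) alternating_Cons[of m s t] alternating_Cons[of m t s]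
          by (simp add: p_def q_def braid_relation_def)
      qed (use ST pq in auto)
      then have "special_step S R (inv_word (pos u) @ pos v)
          ((inv_word (pos u') @ pos p) @ (inv_word (pos q) @ pos v'))"
        using 3 by (simp add: inv_word_Cons)
      also have "special S R \<dots> ((pos x1 @ inv_word (pos y1)) @ (inv_word (pos q) @ pos v'))"
        using 1(1) pq ST by (intro special_appendR) simp_all
      also have "\<dots> = pos x1 @ (inv_word (pos (q @ y1)) @ pos v')"
        by simp
      also have "special S R \<dots> (pos x1 @ (pos x2 @ inv_word (pos y2)))"
        using 2(1) w by (intro special_appendL) simp_all
      finally have sp: "special S R (inv_word (pos u) @ pos v) (pos (x1 @ x2) @ inv_word (pos y2))"
        by simp
      have "pos_eq R (s # (u' @ x1) @ x2) (s # (p @ y1) @ x2)"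
        using 1(2) unfolding lcm_compl_def by (intro pos_eq_Cons pos_eq_appendR) blast
      also have "pos_eq R (s # (p @ y1) @ x2) (t # (q @ y1) @ x2)"
        using spq[of "y1 @ x2"] by simp
      also have "pos_eq R \<dots> (t # v' @ y2)"
        using 2(2) unfolding lcm_compl_def by (intro pos_eq_Cons) blast
      finally have "pos_eq R (u @ (x1 @ x2)) (v @ y2)"
        using 3 by simp
      then have "lcm_compl u v (x1 @ x2) y2"
      proof (rule lcm_complI[OF less.prems])
        fix a b assume ab: "Q (u @ a)" "pos_eq R (u @ a) (v @ b)"
        obtain c where c: "pos_eq R (u' @ a) (p @ c)" "pos_eq R (v' @ b) (q @ c)"
          using split[OF ab] by blast
        obtain z1 where z1: "pos_eq R a (x1 @ z1)" "pos_eq R c (y1 @ z1)"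
          using lcm_complD[OF 1(2) Qu[OF ab(1)] c(1)] .
        have qv: "pos_eq R ((q @ y1) @ z1) (v' @ b)"
          using rtranclp_trans[OF pos_eq_appendL[OF pos_eq_sym[OF z1(2)], of q] pos_eq_sym[OF c(2)]] by simp
        have "Q (v' @ b)"
          using Q_pos_eq[OF ab] Q_suffix[of "[t]" "v' @ b"] 3 by simp
        then have "Q ((q @ y1) @ z1)"
          using Q_pos_eq pos_eq_sym[OF qv] by blast
        then obtain z2 where z2: "pos_eq R z1 (x2 @ z2)" "pos_eq R b (y2 @ z2)"
          using lcm_complD[OF 2(2) _ qv] by blast
        have "pos_eq R a ((x1 @ x2) @ z2)"
          using rtranclp_trans[OF z1(1) pos_eq_appendL[OF z2(1)]] by simp
        then show "\<exists>z. pos_eq R a ((x1 @ x2) @ z) \<and> pos_eq R b (y2 @ z)"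
          using z2(2) by blast
      qed
      with sp show ?thesis by blast
    qed
  qed
qed

lemma cancel_left: "Q (u @ a) \<Longrightarrow> pos_eq R (u @ a) (u @ b) \<Longrightarrow> pos_eq R a b"
proof (induction u)
  case (Cons s u)
  then show ?case
    using head_eq[of s "u @ a" "u @ b"] Q_suffix[of "[s]" "u @ a"] by simp
qed simp

end

section \<open>The lattice of reduced words\<close>

locale spherical_pres =
  fixes S :: "'a set" and R :: "'a list uprod set" and w0 :: "'a list"
  assumes sph: "spherical S R"
    and w0: "reduced S R w0" "\<And>v. reduced S R v \<Longrightarrow> length v \<le> length w0"
begin

lemma artin: "artin_tits S R"
  using sph by (simp add: spherical_def)

lemma braid: "braid_pres S R"
  using artin_tits_braid_pres[OF artin] .

lemma reduced_pos_eq: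
  assumes "reduced S R u" "pos_eq R u v"
  shows "reduced S R v"
proof -
  have "ceq S R u v"
    using ceq_of_pos_eq[OF braid assms(2)] assms(1) by (simp add: reduced_def)
  then show ?thesis
    using reduced_ceq[OF assms(1)] pos_eq_length[OF braid assms(2)] by simp
qed

text \<open>First instance: letters are cancelled in the Coxeter group, and Matsumoto's theorem
  lifts the result to the monoid.\<close>

sublocale red: braid_head S R "reduced S R"
proof
  show "artin_tits S R" by (rule artin)
next
  fix w assume "reduced S R w"
  then show "w \<in> lists S" by (simp add: reduced_def)
next
  fix u v assume "reduced S R (u @ v)"
  then show "reduced S R u" "reduced S R v" using reduced_append by blast+
next
  fix u v assume "reduced S R u" "pos_eq R u v"
  then show "reduced S R v" by (rule reduced_pos_eq)
next
  fix s a b assume *: "reduced S R (s # a)" "pos_eq R (s # a) (s # b)"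
  then have l: "s # a \<in> lists S"
    by (simp add: reduced_def)
  have "ceq S R a b"
    using ceq_of_pos_eq[OF braid *(2) l] l ceq_cancel_Cons[of s S R a b] by simp
  then show "pos_eq R a b"
    using matsumoto[OF artin reduced_Cons[OF *(1)]] pos_eq_length[OF braid *(2)] by simp
next
  fix s a t b assume *: "reduced S R (s # a)" "s \<noteq> t" "pos_eq R (s # a) (t # b)"
  then have l: "s # a \<in> lists S" "t # b \<in> lists S"
    using pos_eq_lists[OF braid *(3), of S] *(1) by (simp_all add: reduced_def)
  have c: "ceq S R (s # a) (t # b)"
    using ceq_of_pos_eq[OF braid *(3) l(1)] .
  have red: "reduced S R (t # b)"
    using reduced_pos_eq[OF *(1,3)] .
  have len: "length a = length b"
    using pos_eq_length[OF braid *(3)] by simp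
  have "\<exists>m c. braid_relation m s t \<in> R \<and> m \<ge> 2 \<and> ceq S R (s # a) (alternating m s t @ c) \<and>
    length (s # a) = m + length c"
    by (rule reduced_dihedral[OF artin *(1,2) _ _ ceq_refl[OF l(1)] _ c]) (use l len in auto)
  then obtain m c' where m: "braid_relation m s t \<in> R" "m \<ge> 2" "ceq S R (s # a) (alternating m s t @ c')"
    "length (s # a) = m + length c'"
    by blast
  have c': "c' \<in> lists S"
    using ceq_lists[OF m(3)] by simp
  have alt: "alternating m s t = s # alternating (m - 1) t s" "alternating m t s = t # alternating (m - 1) s t"
    using alternating_Cons[of m s t] alternating_Cons[of m t s] m(2) by simp_all
  have "ceq S R a (alternating (m - 1) t s @ c')"
    using m(3) l(1) ceq_cancel_Cons[of s S R a "alternating (m - 1) t s @ c'"] unfolding alt by simp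
  then have 1: "pos_eq R a (alternating (m - 1) t s @ c')"
    using matsumoto[OF artin reduced_Cons[OF *(1)]] m(2,4) by simp
  have "ceq S R (t # b) (alternating m t s @ c')"
    using ceq_trans[OF ceq_trans[OF ceq_sym[OF c] m(3)] ceq_appendR[OF c' ceq_braid[OF braid m(1)]]] .
  then have "ceq S R b (alternating (m - 1) s t @ c')"
    using l(2) ceq_cancel_Cons[of t S R b "alternating (m - 1) s t @ c'"] unfolding alt by simp
  then have 2: "pos_eq R b (alternating (m - 1) s t @ c')"
    using matsumoto[OF artin reduced_Cons[OF red]] m(2,4) len by simp
  show "\<exists>m c. m \<ge> 2 \<and> braid_relation m s t \<in> R \<and> pos_eq R a (alternating (m - 1) t s @ c) \<and>
        pos_eq R b (alternating (m - 1) s t @ c)"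
    using m 1 2 by blast
qed

lemma complete:
  assumes "reduced S R v"
  obtains x where "pos_eq R w0 (v @ x)" "reduced S R (v @ x)"
proof -
  obtain x where x: "ceq S R (v @ x) w0" "length v + length x = length w0"
    using longest_complete[OF braid w0 assms] by blast
  have "pos_eq R w0 (v @ x)"
    using matsumoto[OF artin w0(1) ceq_sym[OF x(1)]] x(2) by simp
  then show ?thesis
    using that reduced_pos_eq[OF w0(1)] by blast
qed

text \<open>Both words divide \<open>w0\<close>, and the common prefix \<open>r\<close> is cancelled
  from the two completions. Keeping \<open>r\<close> in front is what later shows joins to be
  reduced after multiplication by it.\<close>

lemma common_complete:
  assumes "reduced S R (r @ p)" "reduced S R (r @ q)"
  obtains x y where "reduced S R (r @ p @ x)" "pos_eq R (p @ x) (q @ y)"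
proof -
  obtain x where x: "pos_eq R w0 (r @ p @ x)" "reduced S R (r @ p @ x)"
    using complete[OF assms(1)] by auto
  obtain y where y: "pos_eq R w0 (r @ q @ y)"
    using complete[OF assms(2)] by auto
  have "pos_eq R (r @ p @ x) (r @ q @ y)"
    using rtranclp_trans[OF pos_eq_sym[OF x(1)] y] .
  then show ?thesis
    using that x(2) red.cancel_left[of r "p @ x" "q @ y"] by blast
qed

lemma lcm_ex:
  assumes "reduced S R u" "reduced S R v"
  obtains x y where "red.lcm_compl u v x y"
proof -
  obtain a b where ab: "reduced S R (u @ a)" "pos_eq R (u @ a) (v @ b)"
    using common_complete[of "[]" u v] assms by auto
  show ?thesis
    using red.reversing[OF ab] that by blast
qed

text \<open>The join of \<open>p\<close> and \<open>q\<close> divides every common multiple, in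
  particular one that stays reduced behind \<open>r\<close>; prefixes of reduced words are
  reduced.\<close>

lemma lcm_shift:
  assumes "reduced S R (r @ p)" "reduced S R (r @ q)" "red.lcm_compl p q x y"
  shows "reduced S R (r @ p @ x)" "pos_eq R (r @ p @ x) (r @ q @ y)"
proof -
  obtain a b where ab: "reduced S R (r @ p @ a)" "pos_eq R (p @ a) (q @ b)"
    using common_complete[OF assms(1,2)] .
  obtain z where z: "pos_eq R a (x @ z)"
    using red.lcm_complD[OF assms(3) reduced_append(2)[OF ab(1)] ab(2)] by blast
  have "pos_eq R (r @ p @ a) ((r @ p @ x) @ z)"
    using pos_eq_appendL[OF z, of "r @ p"] by simp
  then show "reduced S R (r @ p @ x)"
    using reduced_pos_eq[OF ab(1)] reduced_append(1) by blast
  show "pos_eq R (r @ p @ x) (r @ q @ y)"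
    using assms(3) pos_eq_appendL unfolding red.lcm_compl_def by blast
qed

lemma reduced_single:
  assumes "r \<in> S"
  shows "reduced S R [r]"
proof -
  have "length v \<noteq> 0" if "ceq S R [r] v" for v
    using ceq_parity[OF braid that] by auto
  then have "length [r] \<le> length v" if "ceq S R [r] v" for v
    using that by (simp add: Suc_le_eq)
  then show ?thesis
    using assms unfolding reduced_def by simp
qed

text \<open>The letters s and t have a reduced common multiple, which by \<open>head_neq\<close>
  begins with the alternating word.\<close>

lemma reduced_alternating:
  assumes "braid_relation m s t \<in> R" "s \<noteq> t" "s \<in> S" "t \<in> S"
  shows "reduced S R (alternating m s t)"
proof -
  obtain x y where xy: "reduced S R ([s] @ x)" "pos_eq R ([s] @ x) ([t] @ y)"
    using common_complete[of "[]" "[s]" "[t]"] reduced_single assms by auto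
  obtain n c where n: "n \<ge> 2" "braid_relation n s t \<in> R" "pos_eq R x (alternating (n - 1) t s @ c)"
    using red.head_neq[of s x t y] xy assms(2) by auto
  have "n = m"
    using artin_tits_unique[OF artin n(2) assms(1)] .
  then have "pos_eq R ([s] @ x) (alternating m s t @ c)"
    using pos_eq_Cons[OF n(3), of s] alternating_Cons[of m s t] n(1) by simp
  then show ?thesis
    using reduced_pos_eq[OF xy(1)] reduced_append(1) by blast
qed

text \<open>The proof is Garside's double induction, on the length and on the number of elementary steps.
  The associativity of joins of reduced words replaces the verification of the cube condition for
  triples of generators.\<close>

lemma lcm_universal:
  assumes "u @ a \<in> lists S" "pos_eq R (u @ a) (v @ b)"
    and "reduced S R u" "reduced S R v" "red.lcm_compl u v x y"
  shows "\<exists>z. pos_eq R a (x @ z) \<and> pos_eq R b (y @ z)"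
  using assms
proof (induction "length (u @ a)" arbitrary: u a v b x y rule: less_induct)
  case less
  note IH = less.hyps
  note lcmD = red.lcm_complD
  \<comment> \<open>The inner induction, on the elementary steps leading away from
    \<open>s # a'\<close>. Its claim concerns every intermediate word with its own first letter, and
    keeps s fixed.\<close>
  have letters: "\<exists>z. pos_eq R a' (x @ z) \<and> pos_eq R b' (y @ z)"
    if "pos_eq R (s # a') (t # b')" "s # a' \<in> lists S" "length (s # a') = length (u @ a)"
      "red.lcm_compl [s] [t] x y" for s a' t b' x y
  proof -
    have "\<forall>t b' x y. v' = t # b' \<longrightarrow> red.lcm_compl [s] [t] x y \<longrightarrow>
        (\<exists>z. pos_eq R a' (x @ z) \<and> pos_eq R b' (y @ z))" if "pos_eq R (s # a') v'" for v'
      using that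
    proof (induction rule: rtranclp_induct)
      case base
      show ?case
      proof (intro allI impI)
        fix t b' x y
        assume *: "s # a' = t # b'" "red.lcm_compl [s] [t] x y"
        then have "reduced S R ([s] @ [])"
          using reduced_append(1) unfolding red.lcm_compl_def by fastforce
        then obtain z where "pos_eq R [] (x @ z)" "pos_eq R [] (y @ z)"
          using lcmD[OF *(2), of "[]" "[]"] *(1) by auto
        then have "x = []" "y = []"
          using pos_eq_Nil[OF braid] by fastforce+
        then show "\<exists>z. pos_eq R a' (x @ z) \<and> pos_eq R b' (y @ z)"
          using * by auto
      qed
    next
      case (step v' w')
      show ?case
      proof (intro allI impI)
        fix t b' x y
        assume *: "w' = t # b'" "red.lcm_compl [s] [t] x y"
        have len: "length v' = length (s # a')" "v' \<in> lists S"
          using pos_eq_length[OF braid step.hyps(1)] pos_eq_lists[OF braid step.hyps(1)]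
            \<open>s # a' \<in> lists S\<close> by auto
        then obtain r c where v': "v' = r # c"
          by (cases v') auto
        have S3: "s \<in> S" "r \<in> S" "c \<in> lists S"
          using len(2) v' \<open>s # a' \<in> lists S\<close> by auto
        have w'l: "w' \<in> lists S"
          using pos_eq_lists[OF braid r_into_rtranclp[of "pos_step R", OF step.hyps(2)]] len(2) by blast
        then have tS: "t \<in> S" using * by simp
        obtain x1 y1 where J1: "red.lcm_compl [s] [r] x1 y1"
          using lcm_ex[OF reduced_single[OF S3(1)] reduced_single[OF S3(2)]] .
        obtain x2 y2 where J2: "red.lcm_compl [r] [t] x2 y2"
          using lcm_ex[OF reduced_single[OF S3(2)] reduced_single[OF tS]] .
        obtain z1 where z1: "pos_eq R a' (x1 @ z1)" "pos_eq R c (y1 @ z1)"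
          using step.IH v' J1 by blast
        \<comment> \<open>A single step either applies a relation at the very front, whose two sides
          are the join of r and t, or leaves the first letter alone, and then r = t.\<close>
        obtain z2 where z2: "pos_eq R c (x2 @ z2)" "pos_eq R b' (y2 @ z2)"
        proof -
          obtain p g d q where pq: "v' = p @ g @ q" "w' = p @ d @ q" "Upair g d \<in> R"
            using step.hyps(2) unfolding pos_step_def by blast
          obtain m g1 g2 where g: "m \<ge> 2" "g1 \<noteq> g2" "g1 \<in> S" "g2 \<in> S" "g = alternating m g1 g2" "d = alternating m g2 g1"
            using braid_presE[OF braid pq(3)] by metis
          show ?thesis
          proof (cases p)
            case Nil
            have rel: "braid_relation m g1 g2 \<in> R"
              using pq(3) g by (simp add: braid_relation_def)
            have gd: "g = g1 # alternating (m - 1) g2 g1" "d = g2 # alternating (m - 1) g1 g2"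
              using g alternating_Cons[of m g1 g2] alternating_Cons[of m g2 g1] by simp_all
            then have rt: "r = g1" "t = g2" "c = alternating (m - 1) g2 g1 @ q" "b' = alternating (m - 1) g1 g2 @ q"
              using Nil pq v' *(1) by simp_all
            have "reduced S R ([r] @ alternating (m - 1) g2 g1)"
              using reduced_alternating[OF rel] g rt gd by simp
            moreover have "pos_eq R ([r] @ alternating (m - 1) g2 g1) ([t] @ alternating (m - 1) g1 g2)"
              using pos_eq_braid[OF rel] g rt gd by simp
            ultimately obtain z where "pos_eq R (alternating (m - 1) g2 g1) (x2 @ z)"
                "pos_eq R (alternating (m - 1) g1 g2) (y2 @ z)"
              using lcmD[OF J2] by blast
            then have "pos_eq R c (x2 @ z @ q)" "pos_eq R b' (y2 @ z @ q)"
              using pos_eq_appendR[of R _ _ q] rt by fastforce+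
            then show ?thesis using that by blast
          next
            case (Cons p0 p')
            then have rt: "r = t" "c = p' @ g @ q" "b' = p' @ d @ q"
              using pq v' *(1) by simp_all
            then have cb: "pos_eq R c b'"
              using pos_eq_context[OF pos_eq_rel[OF pq(3)]] by simp
            obtain z where "pos_eq R [] (x2 @ z)" "pos_eq R [] (y2 @ z)"
              using lcmD[OF J2, of "[]" "[]"] rt reduced_single[OF S3(2)] by auto
            then have "x2 = []" "y2 = []"
              using pos_eq_Nil[OF braid] by fastforce+
            then show ?thesis
              using that[of c] pos_eq_sym[OF cb] by simp
          qed
        qed
        have red12: "reduced S R ([r] @ y1)" "reduced S R ([r] @ x2)"
          using J1 J2 reduced_pos_eq unfolding red.lcm_compl_def by blast+
        \<comment> \<open>Joins the pair joins of (s, r) and (r, t): r y1 x3 = r x2 y3 is the triple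
          join, still a divisor of \<open>w0\<close>.\<close>
        obtain x3 y3 where J3: "red.lcm_compl y1 x2 x3 y3"
          using lcm_ex[OF reduced_append(2)[OF red12(1)] reduced_append(2)[OF red12(2)]] .
        \<comment> \<open>Both sides equal \<open>c\<close>, which has lost the letter r, so the
          outer induction on length applies.\<close>
        have "pos_eq R (y1 @ z1) (x2 @ z2)"
          using rtranclp_trans[OF pos_eq_sym[OF z1(2)] z2(1)] .
        moreover have "length (y1 @ z1) < length (u @ a)" "y1 @ z1 \<in> lists S"
          using pos_eq_length[OF braid z1(2)] pos_eq_lists[OF braid z1(2)] len v' S3
            \<open>length (s # a') = length (u @ a)\<close> by auto
        ultimately obtain z3 where z3: "pos_eq R z1 (x3 @ z3)" "pos_eq R z2 (y3 @ z3)"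
          using IH[of y1 z1 x2 z2 x3 y3] J3 reduced_append(2)[OF red12(1)] reduced_append(2)[OF red12(2)]
          by blast
        have r1: "reduced S R ([r] @ y1 @ x3)" "pos_eq R ([r] @ y1 @ x3) ([r] @ x2 @ y3)"
          using lcm_shift[OF red12 J3] .
        have e1: "pos_eq R ([s] @ x1 @ x3) ([r] @ y1 @ x3)"
          using J1 pos_eq_appendR[of R "[s] @ x1" "[r] @ y1" x3] unfolding red.lcm_compl_def by simp
        have e2: "pos_eq R ([r] @ x2 @ y3) ([t] @ y2 @ y3)"
          using J2 pos_eq_appendR[of R "[r] @ x2" "[t] @ y2" y3] unfolding red.lcm_compl_def by simp
        \<comment> \<open>Associativity of joins: the triple join is a reduced common multiple of s
          and t, hence a multiple of their join.\<close>
        have "pos_eq R ([s] @ x1 @ x3) ([t] @ y2 @ y3)"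
          using rtranclp_trans[OF e1 rtranclp_trans[OF r1(2) e2]] .
        moreover have "reduced S R ([s] @ x1 @ x3)"
          using reduced_pos_eq[OF r1(1) pos_eq_sym[OF e1]] .
        ultimately obtain z' where z': "pos_eq R (x1 @ x3) (x @ z')" "pos_eq R (y2 @ y3) (y @ z')"
          using lcmD[OF *(2)] by blast
        have "pos_eq R a' (x1 @ x3 @ z3)"
          using rtranclp_trans[OF z1(1) pos_eq_appendL[OF z3(1), of x1]] .
        also have "pos_eq R (x1 @ x3 @ z3) (x @ z' @ z3)"
          using pos_eq_appendR[OF z'(1), of z3] by simp
        finally have 1: "pos_eq R a' (x @ z' @ z3)" .
        have "pos_eq R b' (y2 @ y3 @ z3)"
          using rtranclp_trans[OF z2(2) pos_eq_appendL[OF z3(2), of y2]] .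
        also have "pos_eq R (y2 @ y3 @ z3) (y @ z' @ z3)"
          using pos_eq_appendR[OF z'(2), of z3] by simp
        finally have 2: "pos_eq R b' (y @ z' @ z3)" .
        show "\<exists>z. pos_eq R a' (x @ z) \<and> pos_eq R b' (y @ z)"
          using 1 2 by blast
      qed
    qed
    then show ?thesis
      using that(1,4) by blast
  qed
  have J: "red.lcm_compl u v x y" by (rule less.prems(5))
  have len: "length (u @ a) = length (v @ b)"
    using pos_eq_length[OF braid less.prems(2)] .
  consider "u = []" | "v = []" | s u' t v' where "u = s # u'" "v = t # v'"
    by (cases u; cases v) auto
  then show ?case
  proof cases
    case 1
    obtain z where z: "pos_eq R v (x @ z)" "pos_eq R [] (y @ z)"
      using lcmD[OF J, of v "[]"] less.prems(4) 1 by auto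
    then have "z = []" "y = []"
      using pos_eq_Nil[OF braid] by fastforce+
    then have "pos_eq R a (x @ b)"
      using rtranclp_trans[OF less.prems(2) pos_eq_appendR[OF z(1), of b]] 1 by simp
    then show ?thesis
      using \<open>y = []\<close> by auto
  next
    case 2
    obtain z where z: "pos_eq R [] (x @ z)" "pos_eq R u (y @ z)"
      using lcmD[OF J, of "[]" u] less.prems(3) 2 by auto
    then have "z = []" "x = []"
      using pos_eq_Nil[OF braid] by fastforce+
    then have "pos_eq R b (y @ a)"
      using rtranclp_trans[OF pos_eq_sym[OF less.prems(2)] pos_eq_appendR[OF z(2), of a]] 2 by simp
    then show ?thesis
      using \<open>x = []\<close> by auto
  next
    case (3 s u' t v')
    have red: "reduced S R ([s] @ u')" "reduced S R ([t] @ v')"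
      using less.prems(3,4) 3 by simp_all
    \<comment> \<open>The join of the first letters is enlarged to include \<open>u\<close>, then
      \<open>v\<close>. Each enlargement is justified for the given multiple by the induction
      hypothesis on a shorter word, and the reduced result factors through the join of
      \<open>u\<close> and \<open>v\<close>.\<close>
    obtain x1 y1 where J1: "red.lcm_compl [s] [t] x1 y1"
      using lcm_ex[OF reduced_append(1)[OF red(1)] reduced_append(1)[OF red(2)]] .
    obtain z1 where z1: "pos_eq R (u' @ a) (x1 @ z1)" "pos_eq R (v' @ b) (y1 @ z1)"
      using letters[of s "u' @ a" t "v' @ b" x1 y1] less.prems(1,2) 3 J1 by auto
    have red1: "reduced S R ([s] @ x1)" and e0: "pos_eq R ([s] @ x1) ([t] @ y1)"
      using J1 unfolding red.lcm_compl_def by blast+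
    obtain x2 y2 where J2: "red.lcm_compl u' x1 x2 y2"
      using lcm_ex[OF reduced_append(2)[OF red(1)] reduced_append(2)[OF red1]] .
    obtain z2 where z2: "pos_eq R a (x2 @ z2)" "pos_eq R z1 (y2 @ z2)"
      using IH[of u' a x1 z1 x2 y2] z1(1) J2 reduced_append(2)[OF red(1)] reduced_append(2)[OF red1]
        less.prems(1) 3 by auto
    have r2: "reduced S R ([s] @ u' @ x2)" "pos_eq R ([s] @ u' @ x2) ([s] @ x1 @ y2)"
      using lcm_shift[OF red(1) red1 J2] .
    have e1: "pos_eq R ([s] @ x1 @ y2) ([t] @ y1 @ y2)"
      using pos_eq_appendR[OF e0, of y2] by simp
    have red2: "reduced S R ([t] @ y1 @ y2)"
      using reduced_pos_eq[OF reduced_pos_eq[OF r2] e1] .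
    obtain x3 y3 where J3: "red.lcm_compl v' (y1 @ y2) x3 y3"
      using lcm_ex[OF reduced_append(2)[OF red(2)] reduced_append(2)[OF red2]] .
    have "pos_eq R (v' @ b) ((y1 @ y2) @ z2)"
      using rtranclp_trans[OF z1(2) pos_eq_appendL[OF z2(2)]] by simp
    moreover have "length (v' @ b) < length (u @ a)" "v' @ b \<in> lists S"
      using len pos_eq_lists[OF braid less.prems(2)] less.prems(1) 3 by auto
    ultimately obtain z3 where z3: "pos_eq R b (x3 @ z3)" "pos_eq R z2 (y3 @ z3)"
      using IH[of v' b "y1 @ y2" z2 x3 y3] J3 reduced_append(2)[OF red(2)] reduced_append(2)[OF red2]
      by blast
    have r3: "reduced S R ([t] @ v' @ x3)" "pos_eq R ([t] @ v' @ x3) ([t] @ (y1 @ y2) @ y3)"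
      using lcm_shift[OF red(2) red2 J3] .
    have "pos_eq R ([s] @ u' @ x2 @ y3) ([t] @ (y1 @ y2) @ y3)"
      using pos_eq_appendR[OF rtranclp_trans[OF r2(2) e1], of y3] by simp
    then have e2: "pos_eq R ([t] @ v' @ x3) ([s] @ u' @ x2 @ y3)"
      using rtranclp_trans[OF r3(2) pos_eq_sym] by blast
    have "reduced S R (u @ x2 @ y3)" "pos_eq R (u @ x2 @ y3) (v @ x3)"
      using reduced_pos_eq[OF r3(1) e2] pos_eq_sym[OF e2] 3 by simp_all
    then obtain z' where z': "pos_eq R (x2 @ y3) (x @ z')" "pos_eq R x3 (y @ z')"
      using lcmD[OF J] by blast
    have "pos_eq R a (x2 @ y3 @ z3)"
      using rtranclp_trans[OF z2(1) pos_eq_appendL[OF z3(2)]] .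
    also have "pos_eq R (x2 @ y3 @ z3) (x @ z' @ z3)"
      using pos_eq_appendR[OF z'(1), of z3] by simp
    finally have "pos_eq R a (x @ z' @ z3)" .
    moreover have "pos_eq R b (y @ z' @ z3)"
      using rtranclp_trans[OF z3(1)] pos_eq_appendR[OF z'(2), of z3] by simp
    ultimately show ?thesis by blast
  qed
qed

end

section \<open>Canonical coset representatives\<close>

definition coset :: "'a set \<Rightarrow> 'a list uprod set \<Rightarrow> 'a set \<Rightarrow> 'a letter list \<Rightarrow> 'a letter list set" where
  "coset S R X g = {w. \<exists>h\<in>words X. pres_eq S R w (g @ h)}"

text \<open>The strengthening of Property H that is inherited by amalgams; the case \<open>X = {}\<close>, \<open>g = []\<close> is
  Property H, because only the empty word can be reached from the empty word.\<close>

definition coset_property :: "'a set \<Rightarrow> 'a list uprod set \<Rightarrow> bool" where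
  "coset_property S R \<longleftrightarrow> (\<forall>X\<subseteq>S. \<forall>g\<in>words S. \<exists>r\<in>words S.
     \<forall>w\<in>coset S R X g. \<exists>h\<in>words X. special S R w (r @ h))"

lemma coset_words: "w \<in> coset S R X g \<Longrightarrow> w \<in> words S"
  unfolding coset_def using pres_eq_words by blast

lemma coset_refl: "g \<in> words S \<Longrightarrow> g \<in> coset S R X g"
  unfolding coset_def by (auto intro!: bexI[of _ "[]"] pres_eq.refl)

lemma coset_append:
  assumes "X \<subseteq> S" "w \<in> coset S R X g" "h \<in> words X" "pres_eq S R w' (w @ h)"
  shows "w' \<in> coset S R X g"
proof -
  obtain k where k: "k \<in> words X" "pres_eq S R w (g @ k)"
    using assms(2) unfolding coset_def by blast
  have "h \<in> words S"
    using assms(1,3) words_mono by blast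
  then have "pres_eq S R (w @ h) ((g @ k) @ h)"
    using k pres_eq_appendR by blast
  then have "pres_eq S R w' (g @ (k @ h))"
    using assms(4) pres_eq.trans by fastforce
  then show ?thesis
    using k(1) assms(3) unfolding coset_def by auto
qed

lemma coset_diff:
  assumes "X \<subseteq> S" "w \<in> coset S R X g" "w' \<in> coset S R X g"
  obtains h where "h \<in> words X" "pres_eq S R w' (w @ h)"
proof -
  obtain k k' where k: "k \<in> words X" "pres_eq S R w (g @ k)" "k' \<in> words X" "pres_eq S R w' (g @ k')"
    using assms unfolding coset_def by blast
  have kS: "k \<in> words S"
    using k(1) assms(1) words_mono by blast
  have "pres_eq S R (w @ inv_word k) g"
    using k(2) pres_eq_move_right[of "inv_word k" S R w g] kS by simp
  moreover have "k' \<in> words S"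
    using k(3) assms(1) words_mono by blast
  ultimately have "pres_eq S R ((w @ inv_word k) @ k') (g @ k')"
    using pres_eq_appendR by blast
  then have "pres_eq S R w' (w @ (inv_word k @ k'))"
    using pres_eq.trans[OF k(4) pres_eq.sym] by fastforce
  moreover have "inv_word k @ k' \<in> words X"
    using k by simp
  ultimately show ?thesis
    using that by blast
qed

lemma special_pos_inv:
  assumes "braid_pres S R" "pos_eq R u v" "u \<in> lists S"
  shows "special S R (inv_word (pos u)) (inv_word (pos v))"
  using special_inv[OF special_pos[OF assms]] .

context spherical_pres
begin

lemma lcm_generators:
  assumes "s \<in> S" "t \<in> S" "s \<noteq> t"
  shows "\<exists>m\<ge>2. braid_relation m s t \<in> R \<and>
    red.lcm_compl [s] [t] (alternating (m - 1) t s) (alternating (m - 1) s t)"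
proof -
  obtain x y where xy: "reduced S R ([s] @ x)" "pos_eq R ([s] @ x) ([t] @ y)"
    using common_complete[of "[]" "[s]" "[t]"] reduced_single assms by auto
  obtain m where m: "m \<ge> 2" "braid_relation m s t \<in> R"
    using red.head_neq[of s x t y] xy assms(3) by auto
  have alt: "s # alternating (m - 1) t s = alternating m s t" "t # alternating (m - 1) s t = alternating m t s"
    using alternating_Cons[of m s t] alternating_Cons[of m t s] m(1) by simp_all
  have "red.lcm_compl [s] [t] (alternating (m - 1) t s) (alternating (m - 1) s t)"
  proof (rule red.lcm_complI[OF xy])
    show "pos_eq R ([s] @ alternating (m - 1) t s) ([t] @ alternating (m - 1) s t)"
      using pos_eq_braid[OF m(2)] alt by simp
    fix a b assume ab: "reduced S R ([s] @ a)" "pos_eq R ([s] @ a) ([t] @ b)"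
    obtain n c where n: "n \<ge> 2" "braid_relation n s t \<in> R" "pos_eq R a (alternating (n - 1) t s @ c)"
        "pos_eq R b (alternating (n - 1) s t @ c)"
      using red.head_neq[of s a t b] ab assms(3) by auto
    have "n = m"
      using artin_tits_unique[OF artin n(2) m(2)] .
    then show "\<exists>z. pos_eq R a (alternating (m - 1) t s @ z) \<and> pos_eq R b (alternating (m - 1) s t @ z)"
      using n(3,4) by blast
  qed
  then show ?thesis
    using m by blast
qed

text \<open>Second instance: joins of generators, found among reduced words, are universal among all
  words by \<open>lcm_universal\<close>, and this yields both rules.\<close>

sublocale mon: braid_head S R "\<lambda>w. w \<in> lists S"
proof
  show "artin_tits S R" by (rule artin)
next
  fix u v assume "u \<in> lists S" "pos_eq R u v"
  then show "v \<in> lists S" using pos_eq_lists[OF braid] by blast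
next
  fix s a b assume *: "s # a \<in> lists S" "pos_eq R (s # a) (s # b)"
  then have red: "reduced S R [s]"
    using reduced_single by simp
  \<comment> \<open>Cancellation of s is read as universality of the trivial join of s with
    itself.\<close>
  have "red.lcm_compl [s] [s] [] []"
  proof (rule red.lcm_complI)
    fix a b assume "reduced S R ([s] @ a)" "pos_eq R ([s] @ a) ([s] @ b)"
    then have "pos_eq R a b"
      by (rule red.cancel_left)
    then show "\<exists>z. pos_eq R a ([] @ z) \<and> pos_eq R b ([] @ z)"
      using pos_eq_sym by auto
  qed (use red in auto)
  then obtain z where "pos_eq R a ([] @ z)" "pos_eq R b ([] @ z)"
    using lcm_universal[of "[s]" a "[s]" b "[]" "[]"] * red by auto
  then show "pos_eq R a b"
    using rtranclp_trans[OF _ pos_eq_sym] by fastforce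
next
  fix s a t b assume *: "s # a \<in> lists S" "s \<noteq> t" "pos_eq R (s # a) (t # b)"
  then have ST: "s \<in> S" "t \<in> S"
    using pos_eq_lists[OF braid *(3), of S] by simp_all
  obtain m where m: "m \<ge> 2" "braid_relation m s t \<in> R"
      "red.lcm_compl [s] [t] (alternating (m - 1) t s) (alternating (m - 1) s t)"
    using lcm_generators[OF ST *(2)] by blast
  then show "\<exists>m c. m \<ge> 2 \<and> braid_relation m s t \<in> R \<and> pos_eq R a (alternating (m - 1) t s @ c) \<and>
        pos_eq R b (alternating (m - 1) s t @ c)"
    using lcm_universal[of "[s]" a "[t]" b] * reduced_single ST by fastforce
qed (auto simp: in_lists_conv_set)

section \<open>The Garside element and common multiples\<close>

lemma w0_lists: "w0 \<in> lists S"
  using w0(1) by (simp add: reduced_def)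

lemma w0_divisible:
  assumes "s \<in> S"
  obtains x where "x \<in> lists S" "pos_eq R w0 (s # x)"
proof -
  obtain x where "pos_eq R w0 ([s] @ x)"
    using complete[OF reduced_single[OF assms]] by auto
  then show ?thesis
    using that[of x] pos_eq_lists[OF braid, of w0 "s # x" S] w0_lists by simp
qed

text \<open>Write w0 = sx and complete x to w0 = xy; then y is one letter s', and s w0 = s x s' = w0
  s'. So generators can be moved past \<open>w0\<close>.\<close>

lemma w0_twist:
  assumes "s \<in> S"
  obtains s' where "s' \<in> S" "pos_eq R (s # w0) (w0 @ [s'])"
proof -
  obtain x where x: "pos_eq R w0 ([s] @ x)" "reduced S R ([s] @ x)"
    using complete[OF reduced_single[OF assms]] .
  obtain y where y: "pos_eq R w0 (x @ y)"
    using complete[OF reduced_append(2)[OF x(2)]] by auto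
  have "length y = 1"
    using pos_eq_length[OF braid x(1)] pos_eq_length[OF braid y] by simp
  then obtain s' where s': "y = [s']"
    by (cases y) auto
  have "s' \<in> S"
    using pos_eq_lists[OF braid y, of S] w0_lists s' by simp
  moreover have "pos_eq R ([s] @ w0) (w0 @ [s'])"
    using rtranclp_trans[OF pos_eq_appendL[OF y, of "[s]"], of "w0 @ y"]
      pos_eq_appendR[OF pos_eq_sym[OF x(1)], of y] s' by simp
  ultimately show ?thesis
    using that by simp
qed

text \<open>Each letter costs one factor \<open>w0\<close>: it is moved to the far end of the power
  already obtained and completed there to another \<open>w0\<close>. All words thus have common
  multiples.\<close>

lemma w0_power_divisible:
  assumes "u \<in> lists S" "length u \<le> n"
  shows "\<exists>a. pos_eq R (u @ a) (concat (replicate n w0))"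
proof -
  have twist: "\<exists>s'\<in>S. pos_eq R (s # concat (replicate n w0)) (concat (replicate n w0) @ [s'])"
    if "s \<in> S" for s n
    using that
  proof (induction n arbitrary: s)
    case (Suc n)
    obtain s' where s': "s' \<in> S" "pos_eq R (s # w0) (w0 @ [s'])"
      using w0_twist[OF Suc.prems] .
    obtain s'' where s'': "s'' \<in> S" "pos_eq R (s' # concat (replicate n w0)) (concat (replicate n w0) @ [s''])"
      using Suc.IH[OF s'(1)] by blast
    have "pos_eq R (s # w0 @ concat (replicate n w0)) (w0 @ [s'] @ concat (replicate n w0))"
      using pos_eq_appendR[OF s'(2), of "concat (replicate n w0)"] by simp
    also have "pos_eq R \<dots> (w0 @ concat (replicate n w0) @ [s''])"
      using pos_eq_appendL[OF s''(2), of w0] by simp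
    finally show ?case
      using s''(1) by auto
  qed auto
  have "\<exists>a. pos_eq R (u @ a) (concat (replicate (length u) w0))"
    using assms(1)
  proof (induction u)
    case (Cons s u)
    define P where "P = concat (replicate (length u) w0)"
    obtain a where a: "pos_eq R (u @ a) P"
      using Cons.IH P_def by blast
    obtain s' where s': "s' \<in> S" "pos_eq R (s # P) (P @ [s'])"
      using twist[OF Cons.hyps(1)] P_def by blast
    obtain x where x: "pos_eq R w0 (s' # x)"
      using w0_divisible[OF s'(1)] by blast
    have "pos_eq R (s # (u @ a) @ x) (s # P @ x)"
      using pos_eq_Cons[OF pos_eq_appendR[OF a]] .
    also have "pos_eq R (s # P @ x) (P @ s' # x)"
      using pos_eq_appendR[OF s'(2), of x] by simp
    also have "pos_eq R (P @ s' # x) (P @ w0)"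
      using pos_eq_appendL[OF pos_eq_sym[OF x]] .
    finally have "pos_eq R ((s # u) @ (a @ x)) (P @ w0)"
      by simp
    moreover have "P @ w0 = concat (replicate (length (s # u)) w0)"
      unfolding P_def by (metis append.right_neutral concat.simps concat_append length_Cons
        replicate_Suc replicate_append_same)
    ultimately show ?case
      by metis
  qed auto
  then obtain a where "pos_eq R (u @ a) (concat (replicate (length u) w0))"
    by blast
  from pos_eq_appendR[OF this, of "concat (replicate (n - length u) w0)"]
  have "pos_eq R (u @ a @ concat (replicate (n - length u) w0)) (concat (replicate n w0))"
    using assms(2) by (simp add: concat_append[symmetric] replicate_add[symmetric] del: concat_append)
  then show ?thesis by blast
qed

lemma common_multiple:
  assumes "u \<in> lists S" "v \<in> lists S"
  obtains a b where "u @ a \<in> lists S" "pos_eq R (u @ a) (v @ b)"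
proof -
  define n where "n = max (length u) (length v)"
  obtain a where a: "pos_eq R (u @ a) (concat (replicate n w0))"
    using w0_power_divisible[OF assms(1), of n] by (auto simp: n_def)
  obtain b where b: "pos_eq R (v @ b) (concat (replicate n w0))"
    using w0_power_divisible[OF assms(2), of n] by (auto simp: n_def)
  have "concat (replicate n w0) \<in> lists S"
    using w0_lists by (auto simp: in_lists_conv_set)
  then have "u @ a \<in> lists S"
    using pos_eq_lists[OF braid a] by blast
  then show ?thesis
    using that rtranclp_trans[OF a pos_eq_sym[OF b]] by blast
qed

lemma rev_lists: "rev u \<in> lists X \<longleftrightarrow> u \<in> lists X"
  by (simp add: in_lists_conv_set)

lemma cancel_right:
  assumes "a @ u \<in> lists S" "pos_eq R (a @ u) (b @ u)"
  shows "pos_eq R a b"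
proof -
  have "pos_eq R (rev u @ rev a) (rev u @ rev b)"
    using pos_eq_rev[OF braid assms(2)] by simp
  then have "pos_eq R (rev a) (rev b)"
    using mon.cancel_left[of "rev u" "rev a" "rev b"] assms(1) rev_lists[of "a @ u"] by simp
  then show ?thesis
    using pos_eq_rev[OF braid] by fastforce
qed

text \<open>Right reversing of the reversed words: the denominator \<open>v\<close> becomes the left
  argument there, so the complements return in exchanged order.\<close>

lemma left_reversing:
  assumes "u \<in> lists S" "v \<in> lists S"
  obtains x y where "x \<in> lists S" "y \<in> lists S"
    "special S R (pos u @ inv_word (pos v)) (inv_word (pos x) @ pos y)"
    "\<And>a b. a @ u \<in> lists S \<Longrightarrow> pos_eq R (a @ u) (b @ v) \<Longrightarrow> \<exists>z. pos_eq R a (z @ x) \<and> pos_eq R b (z @ y)"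
proof -
  have r: "rev u \<in> lists S" "rev v \<in> lists S"
    using assms by (simp_all only: rev_lists)
  obtain a0 b0 where "rev v @ a0 \<in> lists S" "pos_eq R (rev v @ a0) (rev u @ b0)"
    using common_multiple[OF r(2,1)] .
  then obtain p q where pq: "special S R (inv_word (pos (rev v)) @ pos (rev u)) (pos p @ inv_word (pos q))"
      "mon.lcm_compl (rev v) (rev u) p q"
    using mon.reversing by blast
  have l: "p \<in> lists S" "q \<in> lists S"
    using special_words[OF pq(1)] r by simp_all
  have "special S R (pos u @ inv_word (pos v)) (inv_word (pos (rev q)) @ pos (rev p))"
    using special_rev[OF pq(1) braid] by simp
  moreover have "\<exists>z. pos_eq R a (z @ rev q) \<and> pos_eq R b (z @ rev p)"
    if *: "a @ u \<in> lists S" "pos_eq R (a @ u) (b @ v)" for a b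
  proof -
    have "rev v @ rev b \<in> lists S"
      using pos_eq_lists[OF braid *(2), of S] *(1) rev_lists[of "b @ v"] by simp
    moreover have "pos_eq R (rev v @ rev b) (rev u @ rev a)"
      using pos_eq_rev[OF braid pos_eq_sym[OF *(2)]] by simp
    ultimately obtain z where z: "pos_eq R (rev b) (p @ z)" "pos_eq R (rev a) (q @ z)"
      using mon.lcm_complD[OF pq(2)] by blast
    show ?thesis
      using pos_eq_rev[OF braid z(1)] pos_eq_rev[OF braid z(2)] by auto
  qed
  ultimately show ?thesis
    using that[of "rev q" "rev p"] l by (simp only: rev_lists)
qed

lemma right_reversing:
  assumes "u \<in> lists S" "v \<in> lists S"
  obtains x y where "x \<in> lists S" "y \<in> lists S"
    "special S R (inv_word (pos u) @ pos v) (pos x @ inv_word (pos y))"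
    "\<And>a b. u @ a \<in> lists S \<Longrightarrow> pos_eq R (u @ a) (v @ b) \<Longrightarrow> \<exists>z. pos_eq R a (x @ z) \<and> pos_eq R b (y @ z)"
proof -
  obtain a0 b0 where "u @ a0 \<in> lists S" "pos_eq R (u @ a0) (v @ b0)"
    using common_multiple[OF assms] .
  then obtain x y where xy: "special S R (inv_word (pos u) @ pos v) (pos x @ inv_word (pos y))"
      "mon.lcm_compl u v x y"
    using mon.reversing by blast
  have "x \<in> lists S" "y \<in> lists S"
    using special_words[OF xy(1)] assms by simp_all
  then show ?thesis
    using that[OF _ _ xy(1)] mon.lcm_complD[OF xy(2)] by metis
qed

subsection \<open>The embedding of the monoid into the group\<close>

text \<open>A signed word acts on the monoid as a partial map. Its domain is a nonempty right ideal, and any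
  two such ideals meet, so equivalent words act alike.\<close>

fun left_act :: "'a letter list \<Rightarrow> 'a list \<Rightarrow> 'a list \<Rightarrow> bool" where
  "left_act [] b a = pos_eq R a b"
| "left_act (Pos s # w) b a = (\<exists>c. left_act w b c \<and> pos_eq R a (s # c))"
| "left_act (Neg s # w) b a = (\<exists>c. left_act w b c \<and> pos_eq R (s # a) c)"

lemma left_act_lists: "left_act w b a \<Longrightarrow> w \<in> words S \<Longrightarrow> b \<in> lists S \<Longrightarrow> a \<in> lists S"
proof (induction w b a rule: left_act.induct)
  case (1 b a)
  then show ?case using pos_eq_lists[OF braid, of a b S] by simp
next
  case (2 s w b a)
  then obtain c where c: "left_act w b c" "pos_eq R a (s # c)" by auto
  then have "c \<in> lists S" using 2 by simp
  then show ?case using pos_eq_lists[OF braid c(2), of S] 2 by simp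
next
  case (3 s w b a)
  then obtain c where c: "left_act w b c" "pos_eq R (s # a) c" by auto
  then have "c \<in> lists S" using 3 by simp
  then show ?case using pos_eq_lists[OF braid c(2), of S] 3 by simp
qed

lemma left_act_cong: "left_act w b a \<Longrightarrow> pos_eq R b b' \<Longrightarrow> pos_eq R a a' \<Longrightarrow> left_act w b' a'"
proof (induction w b a arbitrary: a' rule: left_act.induct)
  case (1 b a)
  then have "pos_eq R a' b'"
    using rtranclp_trans[OF pos_eq_sym[OF 1(3)] rtranclp_trans[OF _ 1(2)]] by simp
  then show ?case by simp
next
  case (2 s w b a)
  then obtain c where c: "left_act w b c" "pos_eq R a (s # c)" by auto
  then have "left_act w b' c" using 2 by blast
  then show ?case
    using rtranclp_trans[OF pos_eq_sym[OF 2(4)] c(2)] by auto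
next
  case (3 s w b a)
  then obtain c where c: "left_act w b c" "pos_eq R (s # a) c" by auto
  then have "left_act w b' c" using 3 by blast
  then show ?case
    using rtranclp_trans[OF pos_eq_sym[OF pos_eq_Cons[OF 3(4)]] c(2)] by auto
qed

lemma left_act_fun:
  "left_act w b a \<Longrightarrow> left_act w b a' \<Longrightarrow> w \<in> words S \<Longrightarrow> b \<in> lists S \<Longrightarrow> pos_eq R a a'"
proof (induction w b a arbitrary: a' rule: left_act.induct)
  case (1 b a)
  then show ?case using rtranclp_trans[OF _ pos_eq_sym[of R a' b]] by simp
next
  case (2 s w b a)
  then obtain c c' where c: "left_act w b c" "pos_eq R a (s # c)" "left_act w b c'" "pos_eq R a' (s # c')"
    by auto
  then have "pos_eq R c c'" using 2 by auto
  then have "pos_eq R (s # c) (s # c')" by (rule pos_eq_Cons)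
  then show ?case
    using rtranclp_trans[OF c(2) rtranclp_trans[OF _ pos_eq_sym[OF c(4)]]] by blast
next
  case (3 s w b a)
  then obtain c c' where c: "left_act w b c" "pos_eq R (s # a) c" "left_act w b c'" "pos_eq R (s # a') c'"
    by auto
  then have "pos_eq R c c'" using 3 by auto
  then have *: "pos_eq R (s # a) (s # a')"
    using rtranclp_trans[OF c(2) rtranclp_trans[OF _ pos_eq_sym[OF c(4)]]] by blast
  have "a \<in> lists S"
    using left_act_lists 3(2,4,5) by blast
  then show ?case
    using mon.head_eq[OF _ *] 3(4) by simp
qed

lemma left_act_ext: "left_act w b a \<Longrightarrow> left_act w (b @ c) (a @ c)"
proof (induction w b a rule: left_act.induct)
  case (1 b a)
  then show ?case by (simp add: pos_eq_appendR)
next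
  case (2 s w b a)
  then obtain d where d: "left_act w b d" "pos_eq R a (s # d)" by auto
  then show ?case using 2 pos_eq_appendR[OF d(2), of c] by auto
next
  case (3 s w b a)
  then obtain d where d: "left_act w b d" "pos_eq R (s # a) d" by auto
  then show ?case using 3 pos_eq_appendR[OF d(2), of c] by auto
qed

lemma left_act_append: "left_act (w @ w') b a \<longleftrightarrow> (\<exists>c. left_act w' b c \<and> left_act w c a)"
proof (induction w arbitrary: a)
  case Nil
  show ?case
    using left_act_cong[of w' b _ b a] pos_eq_sym by auto
next
  case (Cons x w)
  then show ?case by (cases x) auto
qed

text \<open>Applying a negative letter requires divisibility by it. A common multiple with that
  letter provides this after the argument is extended on the right, which earlier letters tolerate
  by \<open>left_act_ext\<close>.\<close>

lemma left_act_ex: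
  assumes "w \<in> words S" "b \<in> lists S"
  shows "\<exists>c a. c \<in> lists S \<and> left_act w (b @ c) a"
  using assms(1)
proof (induction w)
  case Nil
  show ?case by (intro exI[of _ "[]"] exI[of _ b]) simp
next
  case (Cons x w)
  then have w: "w \<in> words S"
    by (cases x) auto
  obtain c a where ca: "c \<in> lists S" "left_act w (b @ c) a"
    using Cons.IH[OF w] by blast
  show ?case
  proof (cases x)
    case (Pos s)
    then show ?thesis using ca by auto
  next
    case (Neg s)
    have a: "a \<in> lists S" "s \<in> S"
      using left_act_lists[OF ca(2) w] ca(1) assms(2) Cons.prems Neg by auto
    obtain d e where de: "[s] @ d \<in> lists S" "pos_eq R ([s] @ d) (a @ e)"
      using common_multiple[of "[s]" a] a by auto
    have "e \<in> lists S"
      using pos_eq_lists[OF braid de(2), of S] de(1) by simp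
    moreover have "left_act w (b @ c @ e) (a @ e)"
      using left_act_ext[OF ca(2), of e] by simp
    ultimately show ?thesis
      using de(2) ca(1) Neg by (intro exI[of _ "c @ e"] exI[of _ d]) auto
  qed
qed

lemma left_act_pos: "left_act (pos v) b a \<longleftrightarrow> pos_eq R a (v @ b)"
proof (induction v arbitrary: a)
  case (Cons s v)
  have "pos_eq R a (s # v @ b)" if "pos_eq R c (v @ b)" "pos_eq R a (s # c)" for c
    using rtranclp_trans[OF that(2) pos_eq_Cons[OF that(1)]] .
  then show ?case
    by (auto simp: Cons.IH)
qed simp

lemma left_act_pres_eq:
  assumes "pres_eq S R w w'" "left_act w b a" "left_act w' b a'" "b \<in> lists S"
  shows "pos_eq R a a'"
  using assms
proof (induction arbitrary: b a a')
  case (pos_neg s)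
  then obtain c where c: "pos_eq R (s # c) b" "pos_eq R a (s # c)" "pos_eq R a' b"
    by (auto dest: pos_eq_sym intro: rtranclp_trans)
  then show ?case
    using rtranclp_trans[OF c(2) rtranclp_trans[OF c(1) pos_eq_sym[OF c(3)]]] by simp
next
  case (neg_pos s)
  then obtain c d where c: "pos_eq R d b" "pos_eq R c (s # d)" "pos_eq R (s # a) c" "pos_eq R a' b"
    by auto
  have "pos_eq R (s # a) (s # b)"
    using rtranclp_trans[OF c(3) rtranclp_trans[OF c(2) pos_eq_Cons[OF c(1)]]] .
  then have "pos_eq R b a"
    using neg_pos by (intro mon.head_eq[of s b a] pos_eq_sym[of R "s # a"]) simp_all
  then have "pos_eq R a b"
    by (rule pos_eq_sym)
  then show ?case
    using rtranclp_trans[OF _ pos_eq_sym[OF c(4)]] by simp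
next
  case (relation v v')
  then have *: "pos_eq R a (v @ b)" "pos_eq R a' (v' @ b)"
    by (simp_all add: left_act_pos)
  have "pos_eq R (v @ b) (v' @ b)"
    using pos_eq_appendR[OF pos_eq_rel[OF relation.hyps(1)]] .
  then show ?case
    using rtranclp_trans[OF *(1) rtranclp_trans[OF _ pos_eq_sym[OF *(2)]]] by simp
next
  case (refl w)
  then show ?case using left_act_fun by blast
next
  case (sym w w')
  then show ?case using pos_eq_sym by blast
next
  case (trans w w' w'')
  have w: "w' \<in> words S" "w \<in> words S" 
    using pres_eq_words trans.hyps by blast+
  \<comment> \<open>The intermediate word may be undefined at \<open>b\<close>; it is evaluated at
    an extension \<open>b @ c\<close>, and \<open>c\<close> is cancelled afterwards.\<close>
  obtain c e where c: "c \<in> lists S" "left_act w' (b @ c) e"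
    using left_act_ex[OF w(1) trans.prems(3)] by blast
  have bc: "b @ c \<in> lists S"
    using c trans.prems by simp
  have 1: "pos_eq R (a @ c) e"
    using trans.IH(1)[OF left_act_ext[OF trans.prems(1)] c(2) bc] .
  have 2: "pos_eq R e (a' @ c)"
    using trans.IH(2)[OF c(2) left_act_ext[OF trans.prems(2)] bc] .
  have "a @ c \<in> lists S"
    using left_act_lists[OF trans.prems(1) w(2) trans.prems(3)] c(1) by simp
  then show ?case
    using cancel_right rtranclp_trans[OF 1 2] by blast
next
  case (append w1 w1' w2 w2')
  have w: "w2 \<in> words S"
    using pres_eq_words append.hyps(2) by blast
  obtain c where c: "left_act w2 b c" "left_act w1 c a"
    using append.prems(1) left_act_append by blast
  obtain c' where c': "left_act w2' b c'" "left_act w1' c' a'"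
    using append.prems(2) left_act_append by blast
  have "pos_eq R c c'"
    using append.IH(2)[OF c(1) c'(1) append.prems(3)] .
  then have "left_act w1' c a'"
    using left_act_cong[OF c'(2) pos_eq_sym] by blast
  then show ?case
    using append.IH(1)[OF c(2)] left_act_lists[OF c(1) w append.prems(3)] by blast
qed

lemma pos_eq_of_pres_eq:
  assumes "pres_eq S R (pos u) (pos v)"
  shows "pos_eq R u v"
  using left_act_pres_eq[OF assms, of "[]" u v] by (simp add: left_act_pos)

subsection \<open>Fractions and cosets\<close>

lemma right_fraction:
  assumes "w \<in> words S"
  obtains x y where "x \<in> lists S" "y \<in> lists S" "special S R w (pos x @ inv_word (pos y))"
proof -
  have "\<exists>x y. x \<in> lists S \<and> y \<in> lists S \<and> special S R w (pos x @ inv_word (pos y))"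
    using assms
  proof (induction w)
    case Nil
    show ?case by (auto intro!: exI[of _ "[]"])
  next
    case (Cons c w)
    then have w: "w \<in> words S" "[c] \<in> words S"
      using words_Cons_letter[of c w S] by auto
    then obtain x y where xy: "x \<in> lists S" "y \<in> lists S" "special S R w (pos x @ inv_word (pos y))"
      using Cons.IH by blast
    have sp: "special S R ([c] @ w) ([c] @ (pos x @ inv_word (pos y)))"
      using special_appendL[OF xy(3) w(2)] .
    show ?case
    proof (cases c)
      case (Pos s)
      then show ?thesis
        using sp xy w by (intro exI[of _ "s # x"] exI[of _ y]) simp
    next
      case (Neg s)
      then have s: "[s] \<in> lists S" using w by simp
      obtain x' y' where xy': "x' \<in> lists S" "y' \<in> lists S"
          "special S R (inv_word (pos [s]) @ pos x) (pos x' @ inv_word (pos y'))"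
        using right_reversing[OF s xy(1)] .
      have "special S R ((inv_word (pos [s]) @ pos x) @ inv_word (pos y)) ((pos x' @ inv_word (pos y')) @ inv_word (pos y))"
        using xy(2) by (intro special_appendR[OF xy'(3)]) simp
      then have "special S R ([c] @ (pos x @ inv_word (pos y))) (pos x' @ inv_word (pos (y @ y')))"
        using Neg by (simp add: inv_word_Cons)
      from rtranclp_trans[OF sp this] show ?thesis
        using xy(2) xy'(1,2) by (intro exI[of _ x'] exI[of _ "y @ y'"]) simp
    qed
  qed
  then show ?thesis using that by blast
qed

text \<open>The least left fraction of \<open>w\<close>: every other one is obtained by multiplying
  \<open>u\<close> and \<open>p\<close> by a common left factor. Being reached from \<open>w\<close>
  by special transformations is part of the notion.\<close>

definition irred_fraction :: "'a letter list \<Rightarrow> 'a list \<Rightarrow> 'a list \<Rightarrow> bool" where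
  "irred_fraction w u p \<longleftrightarrow> u \<in> lists S \<and> p \<in> lists S \<and> special S R w (inv_word (pos u) @ pos p) \<and>
    (\<forall>u'\<in>lists S. \<forall>q\<in>lists S. pres_eq S R (pos u' @ w) (pos q) \<longrightarrow>
      (\<exists>z. pos_eq R u' (z @ u) \<and> pos_eq R q (z @ p)))"

lemma irred_fraction_ex:
  assumes "w \<in> words S"
  obtains u p where "irred_fraction w u p"
proof -
  obtain x y where xy: "x \<in> lists S" "y \<in> lists S" "special S R w (pos x @ inv_word (pos y))"
    using right_fraction[OF assms] .
  obtain u p where up: "u \<in> lists S" "p \<in> lists S"
      "special S R (pos x @ inv_word (pos y)) (inv_word (pos u) @ pos p)"
      "\<And>a b. a @ x \<in> lists S \<Longrightarrow> pos_eq R (a @ x) (b @ y) \<Longrightarrow> \<exists>z. pos_eq R a (z @ u) \<and> pos_eq R b (z @ p)"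
    using left_reversing[OF xy(1,2)] by blast
  \<comment> \<open>If u'w = q is positive then u'x = qy is a common left multiple of
    \<open>x\<close> and \<open>y\<close>, and left reversing has produced the least one.\<close>
  have "\<exists>z. pos_eq R u' (z @ u) \<and> pos_eq R q (z @ p)"
    if *: "u' \<in> lists S" "q \<in> lists S" "pres_eq S R (pos u' @ w) (pos q)" for u' q
  proof -
    have "pres_eq S R (pos u' @ w) ((pos u' @ pos x) @ inv_word (pos y))"
      using pres_eq_appendL[OF _ special_pres_eq[OF braid xy(3) assms], of "pos u'"] *(1) by simp
    then have "pres_eq S R ((pos u' @ pos x) @ inv_word (pos y)) (pos q)"
      using *(3) pres_eq.sym pres_eq.trans by blast
    then have "pres_eq S R (pos u' @ pos x) (pos q @ pos y)"
      using pres_eq_move_right[of "inv_word (pos y)" S R "pos u' @ pos x" "pos q"] xy(2) by simp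
    then have "pos_eq R (u' @ x) (q @ y)"
      using pos_eq_of_pres_eq[of "u' @ x" "q @ y"] by simp
    then show ?thesis
      using up(4) *(1) xy(1) by simp
  qed
  then have "irred_fraction w u p"
    using up rtranclp_trans[OF xy(3) up(3)] unfolding irred_fraction_def by blast
  then show ?thesis using that by blast
qed

lemma irred_fraction_pres_eq:
  assumes "irred_fraction w u p" "w \<in> words S"
  shows "pres_eq S R (pos u @ w) (pos p)"
proof -
  have "pres_eq S R w (inv_word (pos u) @ pos p)"
    using special_pres_eq[OF braid _ assms(2)] assms(1) unfolding irred_fraction_def by blast
  then show ?thesis
    using pres_eq_move_left[of "pos u" S R w "pos p"] assms(1) unfolding irred_fraction_def by simp
qed

text \<open>The fraction is found by special transformations, so numerator and denominator use
  letters of \<open>X\<close> only.\<close>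

lemma parabolic_fraction:
  assumes "X \<subseteq> S" "h \<in> words X"
  obtains a b where "a \<in> lists X" "b \<in> lists X" "pres_eq S R h (pos a @ inv_word (pos b))"
proof -
  have h: "h \<in> words S"
    using assms words_mono by blast
  obtain a b where "a \<in> lists S" "b \<in> lists S" and ab: "special S R h (pos a @ inv_word (pos b))"
    using right_fraction[OF h] .
  have "pos a @ inv_word (pos b) \<in> words X"
    using special_letters[OF ab braid assms(2)] .
  then show ?thesis
    using that[of a b] special_pres_eq[OF braid ab h] by simp
qed

lemma coset_representative:
  assumes X: "X \<subseteq> S" and g: "g \<in> words S"
  shows "\<exists>r\<in>words S. \<forall>w\<in>coset S R X g. \<exists>h\<in>words X. special S R w (r @ h)"
proof -
  define C where "C = coset S R X g"
  have C_words: "w \<in> words S" if "w \<in> C" for w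
    using that coset_words C_def by metis
  have C_diff: "\<exists>a b. a \<in> lists X \<and> b \<in> lists X \<and> pres_eq S R (w' @ pos b) (w @ pos a)"
    if ww: "w \<in> C" "w' \<in> C" for w w'
  proof -
    obtain h where h: "h \<in> words X" "pres_eq S R w' (w @ h)"
      using coset_diff[OF X, of w R g w'] ww C_def by blast
    obtain a b where ab: "a \<in> lists X" "b \<in> lists X" "pres_eq S R h (pos a @ inv_word (pos b))"
      using parabolic_fraction[OF X h(1)] .
    have b: "pos b \<in> words S"
      using ab(2) X by (auto simp: in_lists_conv_set)
    have "pres_eq S R w' ((w @ pos a) @ inv_word (pos b))"
      using pres_eq.trans[OF h(2) pres_eq_appendL[OF C_words[OF ww(1)] ab(3)]] by simp
    then have "pres_eq S R (w' @ pos b) (w @ pos a)"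
      using pres_eq_move_right[OF b] by blast
    with ab show ?thesis by blast
  qed
  have lX: "a \<in> lists S" if "a \<in> lists X" for a
    using that X by (auto simp: in_lists_conv_set)
  have C_append: "w' \<in> C" if "w \<in> C" "h \<in> words X" "pres_eq S R w' (w @ h)" for w h w'
    using coset_append[OF X, of w R g h w'] that C_def by blast
  have C_refl: "w @ h \<in> C" if "w \<in> C" "h \<in> words X" for w h
    using C_append[OF that pres_eq.refl] C_words[OF that(1)] words_mono[OF that(2) X] by simp
  have "g \<in> C"
    using coset_refl[OF g] C_def by blast
  then have "\<exists>u. \<exists>w\<in>C. \<exists>p. irred_fraction w u p"
    using irred_fraction_ex[OF g] by blast
  then obtain u where u: "\<exists>w\<in>C. \<exists>p. irred_fraction w u p"
      and u_min: "\<And>u'. \<exists>w\<in>C. \<exists>p. irred_fraction w u' p \<Longrightarrow> length u \<le> length u'"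
    using ex_has_least_nat[of "\<lambda>u. \<exists>w\<in>C. \<exists>p. irred_fraction w u p" _ length] by metis
  then obtain wu p where wu: "wu \<in> C" "irred_fraction wu u p"
    by blast
  have uS: "u \<in> lists S" "p \<in> lists S"
    using wu(2) unfolding irred_fraction_def by blast+
  \<comment> \<open>\<open>w\<close> and \<open>wu\<close> are brought to a common k = wu a = w b in
    the coset. As uk is positive, the denominator of k right divides \<open>u\<close>, hence equals
    it by minimality; as dk is positive, it right divides \<open>d\<close> too.\<close>
  have den: "\<exists>c. pos_eq R d (c @ u)" if w: "w \<in> C" "irred_fraction w d q" for w d q
  proof -
    obtain a b where ab: "a \<in> lists X" "b \<in> lists X" "pres_eq S R (w @ pos b) (wu @ pos a)"
      using C_diff[OF wu(1) w(1)] by blast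
    define k where "k = wu @ pos a"
    have k: "k \<in> C"
      using C_refl[OF wu(1)] ab(1) k_def by simp
    obtain u' p' where up': "irred_fraction k u' p'"
      using irred_fraction_ex[OF C_words[OF k]] .
    have dS: "d \<in> lists S" "q \<in> lists S"
      using w(2) unfolding irred_fraction_def by blast+
    have "pres_eq S R ((pos u @ wu) @ pos a) (pos p @ pos a)"
      using irred_fraction_pres_eq[OF wu(2) C_words[OF wu(1)]] lX[OF ab(1)] by (intro pres_eq_appendR) simp_all
    then have "pres_eq S R (pos u @ k) (pos (p @ a))"
      by (simp add: k_def)
    moreover have "p @ a \<in> lists S"
      using uS lX[OF ab(1)] by simp
    ultimately obtain z where z: "pos_eq R u (z @ u')"
      using up' uS(1) unfolding irred_fraction_def by blast
    have "length u \<le> length u'"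
      using u_min k up' by blast
    then have "z = []"
      using pos_eq_length[OF braid z] by simp
    then have uu': "pos_eq R u' u"
      using pos_eq_sym[OF z] by simp
    have "pres_eq S R (pos d @ (w @ pos b)) (pos q @ pos b)"
      using pres_eq_appendR[OF _ irred_fraction_pres_eq[OF w(2) C_words[OF w(1)]], of "pos b"] lX[OF ab(2)]
      by simp
    moreover have "pres_eq S R (pos d @ (w @ pos b)) (pos d @ k)"
      using dS(1) ab(3) by (auto simp: k_def intro!: pres_eq_appendL)
    ultimately have "pres_eq S R (pos d @ k) (pos (q @ b))"
      using pres_eq.sym pres_eq.trans by fastforce
    moreover have "q @ b \<in> lists S"
      using dS lX[OF ab(2)] by simp
    ultimately obtain z' where "pos_eq R d (z' @ u')"
      using up' dS(1) unfolding irred_fraction_def by blast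
    then show ?thesis
      using rtranclp_trans[OF _ pos_eq_appendL[OF uu']] by blast
  qed
  define V where "V = {q \<in> lists S. \<exists>w\<in>C. pres_eq S R (pos u @ w) (pos q)}"
  have "p \<in> V"
    using irred_fraction_pres_eq[OF wu(2) C_words[OF wu(1)]] wu(1) uS V_def by blast
  then obtain v where v: "v \<in> V" and v_min: "\<And>v'. v' \<in> V \<Longrightarrow> length v \<le> length v'"
    using ex_has_least_nat[of "\<lambda>v. v \<in> V" p length] by blast
  then obtain wv where wv: "wv \<in> C" "pres_eq S R (pos u @ wv) (pos v)" and vS: "v \<in> lists S"
    using V_def by blast
  have uw: "\<exists>a b. a \<in> lists X \<and> b \<in> lists X \<and> pres_eq S R ((pos u @ w) @ pos b) (pos (v @ a))"
    if w: "w \<in> C" for w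
  proof -
    obtain a b where ab: "a \<in> lists X" "b \<in> lists X" "pres_eq S R (w @ pos b) (wv @ pos a)"
      using C_diff[OF wv(1) w] by blast
    have "pres_eq S R (pos u @ (w @ pos b)) (pos u @ (wv @ pos a))"
      using ab(3) uS by (intro pres_eq_appendL) simp_all
    moreover have "pres_eq S R ((pos u @ wv) @ pos a) (pos v @ pos a)"
      using wv(2) lX[OF ab(1)] by (intro pres_eq_appendR) simp_all
    ultimately have "pres_eq S R ((pos u @ w) @ pos b) (pos (v @ a))"
      using pres_eq.trans by fastforce
    with ab show ?thesis by blast
  qed
  \<comment> \<open>From va = qb, left reversing of a b^-1 inside the letters of \<open>X\<close>
    gives v = zx and q = zy. Then z lies in \<open>V\<close>, so minimality of \<open>v\<close>
    leaves x empty and q = vy.\<close>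
  have num: "\<exists>h\<in>lists X. pos_eq R q (v @ h)" if q: "q \<in> V" for q
  proof -
    obtain w where w: "w \<in> C" "pres_eq S R (pos u @ w) (pos q)" and qS: "q \<in> lists S"
      using q V_def by blast
    obtain a b where ab: "a \<in> lists X" "b \<in> lists X" "pres_eq S R ((pos u @ w) @ pos b) (pos (v @ a))"
      using uw[OF w(1)] by blast
    have "pres_eq S R ((pos u @ w) @ pos b) (pos q @ pos b)"
      using w(2) lX[OF ab(2)] by (intro pres_eq_appendR) simp_all
    then have "pres_eq S R (pos (v @ a)) (pos (q @ b))"
      using ab(3) pres_eq.sym pres_eq.trans by fastforce
    then have va: "pos_eq R (v @ a) (q @ b)"
      by (rule pos_eq_of_pres_eq)
    obtain x y where xy: "x \<in> lists S" "y \<in> lists S"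
        "special S R (pos a @ inv_word (pos b)) (inv_word (pos x) @ pos y)"
        "\<And>a' b'. a' @ a \<in> lists S \<Longrightarrow> pos_eq R (a' @ a) (b' @ b) \<Longrightarrow> \<exists>z. pos_eq R a' (z @ x) \<and> pos_eq R b' (z @ y)"
      using left_reversing[OF lX[OF ab(1)] lX[OF ab(2)]] by blast
    have "inv_word (pos x) @ pos y \<in> words X"
      using special_letters[OF xy(3) braid] ab by simp
    then have xX: "x \<in> lists X" "y \<in> lists X"
      by simp_all
    obtain z where z: "pos_eq R v (z @ x)" "pos_eq R q (z @ y)"
      using xy(4)[OF _ va] vS lX[OF ab(1)] by auto
    have zx: "z @ x \<in> lists S"
      using pos_eq_lists[OF braid z(1)] vS by blast
    have "pres_eq S R (pos u @ wv) (pos z @ pos x)"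
      using pres_eq.trans[OF wv(2) pres_eq_of_pos_eq[OF braid z(1) vS]] by simp
    then have "pres_eq S R (pos u @ (wv @ inv_word (pos x))) (pos z)"
      using pres_eq_move_right[of "inv_word (pos x)" S R "pos u @ wv" "pos z"] xy(1) by simp
    moreover have "wv @ inv_word (pos x) \<in> C"
      using C_refl[OF wv(1)] xX(1) by simp
    ultimately have "z \<in> V"
      using zx V_def by auto
    then have "x = []"
      using v_min[of z] pos_eq_length[OF braid z(1)] by simp
    then have "pos_eq R q (v @ y)"
      using rtranclp_trans[OF z(2) pos_eq_appendR[OF pos_eq_sym[of R v z]]] z(1) by simp
    then show ?thesis
      using xX(2) by blast
  qed
  have "\<exists>h\<in>words X. special S R w ((inv_word (pos u) @ pos v) @ h)" if w: "w \<in> C" for w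
  proof -
    note wS = C_words[OF w]
    obtain d q where dq: "irred_fraction w d q"
      using irred_fraction_ex[OF wS] .
    have dS: "d \<in> lists S" "q \<in> lists S"
      using dq unfolding irred_fraction_def by blast+
    obtain c where c: "pos_eq R d (c @ u)"
      using den[OF w dq] by blast
    have cS: "c \<in> lists S"
      using pos_eq_lists[OF braid c, of S] dS by simp
    \<comment> \<open>With d = cu, the fraction of \<open>w\<close> becomes u^-1 (c^-1 q), and c^-1
      q is reversed to x y^-1.\<close>
    obtain x y where xy: "x \<in> lists S" "y \<in> lists S"
      "special S R (inv_word (pos c) @ pos q) (pos x @ inv_word (pos y))"
      "\<And>a b. c @ a \<in> lists S \<Longrightarrow> pos_eq R (c @ a) (q @ b) \<Longrightarrow> \<exists>z. pos_eq R a (x @ z) \<and> pos_eq R b (y @ z)"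
      using right_reversing[OF cS dS(2)] by blast
    have "special S R w (inv_word (pos d) @ pos q)"
      using dq unfolding irred_fraction_def by blast
    also have "special S R \<dots> (inv_word (pos (c @ u)) @ pos q)"
      using dS by (intro special_appendR special_pos_inv[OF braid c]) simp_all
    also have "\<dots> = inv_word (pos u) @ (inv_word (pos c) @ pos q)"
      by simp
    also have "special S R \<dots> (inv_word (pos u) @ (pos x @ inv_word (pos y)))"
      using uS by (intro special_appendL[OF xy(3)]) simp
    finally have sp: "special S R w (inv_word (pos u) @ (pos x @ inv_word (pos y)))" .
    have "pres_eq S R w (inv_word (pos u) @ (pos x @ inv_word (pos y)))"
      using special_pres_eq[OF braid sp wS] .
    then have ux: "pres_eq S R (pos u @ w) (pos x @ inv_word (pos y))"
      using pres_eq_move_left[of "pos u" S R w] uS by simp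
    have cq: "pres_eq S R (pos c @ (pos u @ w)) (pos q)"
    proof -
      have "pres_eq S R (pos d @ w) (pos (c @ u) @ w)"
        using wS by (intro pres_eq_appendR pres_eq_of_pos_eq[OF braid c] dS)
      then show ?thesis
        using irred_fraction_pres_eq[OF dq wS] pres_eq.sym pres_eq.trans by fastforce
    qed
    obtain a b where ab: "a \<in> lists X" "b \<in> lists X" "pres_eq S R ((pos u @ w) @ pos b) (pos (v @ a))"
      using uw[OF w] by blast
    have "pres_eq S R (pos c @ ((pos u @ w) @ pos b)) (pos c @ pos (v @ a))"
      using cS ab(3) by (intro pres_eq_appendL) simp_all
    moreover have "pres_eq S R ((pos c @ (pos u @ w)) @ pos b) (pos q @ pos b)"
      using cq lX[OF ab(2)] by (intro pres_eq_appendR) simp_all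
    ultimately have "pres_eq S R (pos (c @ (v @ a))) (pos (q @ b))"
      using pres_eq.sym pres_eq.trans by fastforce
    then have "pos_eq R (c @ (v @ a)) (q @ b)"
      by (rule pos_eq_of_pres_eq)
    \<comment> \<open>\<open>y\<close> left divides \<open>b\<close>, because c(va) = qb is a common
      multiple of \<open>c\<close> and \<open>q\<close>. So y is a word over \<open>X\<close>, wy
      stays in the coset, and x = uwy belongs to \<open>V\<close>.\<close>
    then obtain z where z: "pos_eq R b (y @ z)"
      using xy(4)[of "v @ a" b] cS vS lX[OF ab(1)] by auto
    have yX: "y \<in> lists X"
      using pos_eq_lists[OF braid z, of X] ab(2) by simp
    have "pres_eq S R (pos u @ (w @ pos y)) (pos x)"
      using ux pres_eq_move_right[of "pos y" S R "pos u @ w" "pos x"] xy(2) by simp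
    moreover have "w @ pos y \<in> C"
      using C_refl[OF w] yX by simp
    ultimately have "x \<in> V"
      using xy(1) V_def by blast
    then obtain h where h: "h \<in> lists X" "pos_eq R x (v @ h)"
      using num by blast
    have "special S R (inv_word (pos u) @ pos x @ inv_word (pos y)) (inv_word (pos u) @ pos (v @ h) @ inv_word (pos y))"
      using uS xy by (intro special_context[OF special_pos[OF braid h(2)]]) simp_all
    with sp have "special S R w ((inv_word (pos u) @ pos v) @ (pos h @ inv_word (pos y)))"
      by (auto intro: rtranclp_trans)
    moreover have "pos h @ inv_word (pos y) \<in> words X"
      using h(1) yX by simp
    ultimately show ?thesis by blast
  qed
  moreover have "inv_word (pos u) @ pos v \<in> words S"
    using uS vS by simp
  ultimately show ?thesis
    unfolding C_def by blast
qed

end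

lemma spherical_coset_property:
  assumes "spherical S R"
  shows "coset_property S R"
proof -
  obtain w0 where "reduced S R w0" "\<And>v. reduced S R v \<Longrightarrow> length v \<le> length w0"
    using longest_ex[OF assms] by blast
  then interpret spherical_pres S R w0
    by unfold_locales (use assms in auto)
  show ?thesis
    unfolding coset_property_def by (intro allI impI ballI coset_representative)
qed

section \<open>Amalgams\<close>

text \<open>The right-handed form of \<open>pres_eq_foldr\<close>, with letters applied from left to
  right; normal forms are multiplied on the right.\<close>

lemma pres_eq_fold:
  fixes act :: "'a letter \<Rightarrow> 'b \<Rightarrow> 'b"
  assumes "pres_eq S R w w'" "x \<in> \<Omega>"
    and closed: "\<And>c x. [c] \<in> words S \<Longrightarrow> x \<in> \<Omega> \<Longrightarrow> act c x \<in> \<Omega>"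
    and pos_neg: "\<And>s x. s \<in> S \<Longrightarrow> x \<in> \<Omega> \<Longrightarrow> act (Neg s) (act (Pos s) x) = x"
    and neg_pos: "\<And>s x. s \<in> S \<Longrightarrow> x \<in> \<Omega> \<Longrightarrow> act (Pos s) (act (Neg s) x) = x"
    and rel: "\<And>v v' x. Upair v v' \<in> R \<Longrightarrow> v \<in> lists S \<Longrightarrow> v' \<in> lists S \<Longrightarrow> x \<in> \<Omega> \<Longrightarrow>
      fold act (pos v) x = fold act (pos v') x"
  shows "fold act w x = fold act w' x"
proof -
  have cl: "fold act w x \<in> \<Omega>" if "w \<in> words S" "x \<in> \<Omega>" for w x
    using that
  proof (induction w arbitrary: x)
    case (Cons c w)
    then show ?case
      using closed words_Cons_letter[of c w S] by simp
  qed simp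
  show ?thesis
    using assms(1,2)
  proof (induction arbitrary: x)
    case (append a a' b b')
    have "fold act a' x \<in> \<Omega>"
      using cl append.prems pres_eq_words[OF append.hyps(1)] by blast
    then show ?case
      using append.IH(2) append.IH(1)[OF append.prems] by simp
  qed (use pos_neg neg_pos rel in auto)
qed

text \<open>Transports the isomorphism of subgroups to words, letter by letter. Negative letters are
  matched because inverses in the generated subgroup are those of the ambient group. Injectivity
  gives the equivalence.\<close>

lemma amalgam_position_pres_eq:
  assumes "amalgam_position S1 R1 S2 R2" "w \<in> words (S1 \<inter> S2)" "w' \<in> words (S1 \<inter> S2)"
  shows "pres_eq S1 R1 w w' \<longleftrightarrow> pres_eq S2 R2 w w'"
proof -
  define c1 where "c1 = word_class S1 R1"
  define c2 where "c2 = word_class S2 R2"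
  define G1 where "G1 = pres_group S1 R1"
  define G2 where "G2 = pres_group S2 R2"
  define K1 where "K1 = subgroup_generated G1 ((\<lambda>s. c1 [Pos s]) ` (S1 \<inter> S2))"
  define K2 where "K2 = subgroup_generated G2 ((\<lambda>s. c2 [Pos s]) ` (S1 \<inter> S2))"
  obtain h where h: "h \<in> iso K1 K2" and hs: "\<And>s. s \<in> S1 \<inter> S2 \<Longrightarrow> h (c1 [Pos s]) = c2 [Pos s]"
    using assms(1) unfolding amalgam_position_def K1_def K2_def G1_def G2_def c1_def c2_def by blast
  interpret G1: group G1 unfolding G1_def by (rule group_pres_group)
  interpret G2: group G2 unfolding G2_def by (rule group_pres_group)
  interpret K1: group K1 unfolding K1_def by (rule G1.group_subgroup_generated)
  interpret K2: group K2 unfolding K2_def by (rule G2.group_subgroup_generated)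
  interpret h: group_hom K1 K2 h
    by unfold_locales (use h in \<open>simp add: iso_def\<close>)
  have inj: "inj_on h (carrier K1)"
    using h by (simp add: iso_def bij_betw_def)
  have mult: "mult K1 = mult G1" "mult K2 = mult G2" "one K1 = one G1" "one K2 = one G2"
    by (simp_all add: K1_def K2_def)
  have m1: "c1 a \<otimes>\<^bsub>G1\<^esub> c1 b = c1 (a @ b)" if "a \<in> words S1" "b \<in> words S1" for a b
    using that unfolding c1_def G1_def by (rule pres_group_mult)
  have m2: "c2 a \<otimes>\<^bsub>G2\<^esub> c2 b = c2 (a @ b)" if "a \<in> words S2" "b \<in> words S2" for a b
    using that unfolding c2_def G2_def by (rule pres_group_mult)
  have o: "\<one>\<^bsub>G1\<^esub> = c1 []" "\<one>\<^bsub>G2\<^esub> = c2 []"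
    by (simp_all add: G1_def G2_def c1_def c2_def pres_group_simps)
  have gen: "c1 [Pos s] \<in> carrier K1" if "s \<in> S1 \<inter> S2" for s
    unfolding K1_def carrier_subgroup_generated
    by (rule generate.incl) (use that in \<open>auto simp: G1_def c1_def pres_group_simps\<close>)
  have inv: "c1 [Neg s] \<in> carrier K1 \<and> h (c1 [Neg s]) = c2 [Neg s]" if s: "s \<in> S1 \<inter> S2" for s
  proof -
    have "c1 [Neg s] \<otimes>\<^bsub>G1\<^esub> c1 [Pos s] = \<one>\<^bsub>G1\<^esub>"
      using s m1[of "[Neg s]" "[Pos s]"] o
      by (simp add: c1_def word_class_eq_iff pres_eq.neg_pos)
    moreover have in1: "c1 [Neg s] \<in> carrier G1" "c1 [Pos s] \<in> carrier G1"
      using s by (auto simp: G1_def c1_def pres_group_simps)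
    ultimately have "c1 [Neg s] = inv\<^bsub>G1\<^esub> (c1 [Pos s])"
      using G1.inv_equality by metis
    also have "\<dots> = inv\<^bsub>K1\<^esub> (c1 [Pos s])"
      using gen[OF s] unfolding K1_def by (rule G1.inv_subgroup_generated[symmetric])
    finally have 1: "c1 [Neg s] = inv\<^bsub>K1\<^esub> (c1 [Pos s])" .
    have "c2 [Neg s] \<otimes>\<^bsub>G2\<^esub> c2 [Pos s] = \<one>\<^bsub>G2\<^esub>"
      using s m2[of "[Neg s]" "[Pos s]"] o
      by (simp add: c2_def word_class_eq_iff pres_eq.neg_pos)
    moreover have in2: "c2 [Neg s] \<in> carrier G2" "c2 [Pos s] \<in> carrier G2"
      using s by (auto simp: G2_def c2_def pres_group_simps)
    ultimately have "c2 [Neg s] = inv\<^bsub>G2\<^esub> (c2 [Pos s])"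
      using G2.inv_equality by metis
    moreover have "c2 [Pos s] \<in> carrier K2"
      using h.hom_closed[OF gen[OF s]] hs[OF s] by simp
    ultimately have 2: "c2 [Neg s] = inv\<^bsub>K2\<^esub> (c2 [Pos s])"
      using G2.inv_subgroup_generated unfolding K2_def by metis
    show ?thesis
      using 1 2 gen[OF s] hs[OF s] h.hom_inv[OF gen[OF s]] K1.inv_closed by metis
  qed
  have hw: "c1 w \<in> carrier K1 \<and> h (c1 w) = c2 w" if "w \<in> words (S1 \<inter> S2)" for w
    using that
  proof (induction w)
    case Nil
    have "h \<one>\<^bsub>K1\<^esub> = \<one>\<^bsub>K2\<^esub>" "\<one>\<^bsub>K1\<^esub> \<in> carrier K1"
      by simp_all
    then show ?case
      unfolding mult o by simp
  next
    case (Cons x w)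
    have xw: "[x] \<in> words (S1 \<inter> S2)" "w \<in> words (S1 \<inter> S2)"
      using Cons.prems words_Cons_letter by blast+
    have x: "c1 [x] \<in> carrier K1 \<and> h (c1 [x]) = c2 [x]"
      using xw(1) gen hs inv by (cases x) auto
    have "h (c1 [x] \<otimes>\<^bsub>K1\<^esub> c1 w) = c2 [x] \<otimes>\<^bsub>K2\<^esub> c2 w" "c1 [x] \<otimes>\<^bsub>K1\<^esub> c1 w \<in> carrier K1"
      using x Cons.IH[OF xw(2)] by simp_all
    moreover have "c1 [x] \<otimes>\<^bsub>K1\<^esub> c1 w = c1 (x # w)" "c2 [x] \<otimes>\<^bsub>K2\<^esub> c2 w = c2 (x # w)"
      using xw m1[of "[x]" w] m2[of "[x]" w] by (simp_all add: mult words_Int_iff)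
    ultimately show ?case by simp
  qed
  have "pres_eq S1 R1 w w' \<longleftrightarrow> c1 w = c1 w'"
    using assms(2) by (simp add: c1_def word_class_eq_iff words_Int_iff)
  also have "\<dots> \<longleftrightarrow> h (c1 w) = h (c1 w')"
    using inj hw[OF assms(2)] hw[OF assms(3)] by (metis inj_onD)
  also have "\<dots> \<longleftrightarrow> c2 w = c2 w'"
    using hw[OF assms(2)] hw[OF assms(3)] by simp
  also have "\<dots> \<longleftrightarrow> pres_eq S2 R2 w w'"
    using assms(2) by (simp add: c2_def word_class_eq_iff words_Int_iff)
  finally show ?thesis .
qed

lemma coset_eq:
  assumes "X \<subseteq> S" "w \<in> coset S R X g" "g \<in> words S"
  shows "coset S R X w = coset S R X g"
proof -
  obtain h where h: "h \<in> words X" "pres_eq S R w (g @ h)"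
    using assms(2) unfolding coset_def by blast
  have hS: "h \<in> words S" "w \<in> words S"
    using h words_mono[OF h(1) assms(1)] pres_eq_words[OF h(2)] by blast+
  have "pres_eq S R g (w @ inv_word h)"
    using pres_eq_move_right[of "inv_word h" S R w g] h(2) hS(1) pres_eq.sym by fastforce
  then have g: "g \<in> coset S R X w"
    unfolding coset_def using h(1) by auto
  have "x \<in> coset S R X w \<longleftrightarrow> x \<in> coset S R X g" for x
  proof
    assume "x \<in> coset S R X w"
    then obtain k where "k \<in> words X" "pres_eq S R x (w @ k)"
      unfolding coset_def by blast
    then show "x \<in> coset S R X g"
      using coset_append[OF assms(1,2)] by blast
  next
    assume "x \<in> coset S R X g"
    then obtain k where "k \<in> words X" "pres_eq S R x (g @ k)"
      unfolding coset_def by blast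
    then show "x \<in> coset S R X w"
      using coset_append[OF assms(1) g] by blast
  qed
  then show ?thesis by blast
qed

section \<open>The amalgam and the cosets of its common subgroup\<close>

type_synonym 'a syllables = "(bool \<times> 'a letter list) list"

text \<open>Indexing the factors by \<open>bool\<close> allows each argument to be given once, for
  an arbitrary factor \<open>i\<close>.\<close>

locale amalgam =
  fixes S :: "bool \<Rightarrow> 'a set" and R :: "bool \<Rightarrow> 'a list uprod set"
  assumes bp: "braid_pres (S i) (R i)"
    and cp: "coset_property (S i) (R i)"
    and agree: "\<And>h h'. h \<in> words (S True \<inter> S False) \<Longrightarrow> h' \<in> words (S True \<inter> S False) \<Longrightarrow>
      pres_eq (S True) (R True) h h' \<longleftrightarrow> pres_eq (S False) (R False) h h'"
begin

abbreviation "T \<equiv> S True \<inter> S False"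
abbreviation "U \<equiv> S True \<union> S False"
abbreviation "Q \<equiv> R True \<union> R False"
abbreviation "E i \<equiv> pres_eq (S i) (R i)"
abbreviation "EE \<equiv> pres_eq U Q"

lemma T_subset: "T \<subseteq> S i"
  by (cases i) auto

lemma S_subset: "S i \<subseteq> U" "R i \<subseteq> Q"
  by (cases i; auto)+

lemma T_words: "h \<in> words T \<Longrightarrow> h \<in> words (S i)" "h \<in> words T \<Longrightarrow> h \<in> words U"
  by (erule words_mono, rule T_subset) (erule words_mono, auto)

lemma S_words: "x \<in> words (S i) \<Longrightarrow> x \<in> words U"
  by (erule words_mono) (rule S_subset)

lemma E_imp_EE: "E i x y \<Longrightarrow> EE x y"
  by (erule pres_eq_mono) (rule S_subset)+

lemma special_factor: "special (S i) (R i) x y \<Longrightarrow> special U Q x y"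
  by (erule special_mono) (rule S_subset)+

lemma bp_union: "braid_pres U Q"
  using bp[of True] bp[of False] unfolding braid_pres_def by blast

lemma agree': "h \<in> words T \<Longrightarrow> h' \<in> words T \<Longrightarrow> E i h h' \<longleftrightarrow> E j h h'"
  using agree by (cases i; cases j) auto

abbreviation "cls i x \<equiv> coset (S i) (R i) T x"

definition "inH i x \<longleftrightarrow> (\<exists>h\<in>words T. E i x h)"

text \<open>The predicate under the choice operator mentions \<open>x\<close> only through its
  coset, so equal cosets receive literally the same word.\<close>

definition "rep i x = (SOME r. r \<in> words (S i) \<and> (\<forall>w\<in>cls i x. \<exists>h\<in>words T. special (S i) (R i) w (r @ h)))"

lemma rep_props:
  assumes "x \<in> words (S i)"
  shows rep_words: "rep i x \<in> words (S i)"
    and rep_special: "\<And>w. w \<in> cls i x \<Longrightarrow> \<exists>h\<in>words T. special (S i) (R i) w (rep i x @ h)"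
proof -
  have "\<exists>r. r \<in> words (S i) \<and> (\<forall>w\<in>cls i x. \<exists>h\<in>words T. special (S i) (R i) w (r @ h))"
    using cp[of i] assms T_subset unfolding coset_property_def by blast
  from someI_ex[OF this] have "rep i x \<in> words (S i) \<and> (\<forall>w\<in>cls i x. \<exists>h\<in>words T. special (S i) (R i) w (rep i x @ h))"
    unfolding rep_def .
  then show "rep i x \<in> words (S i)" "\<And>w. w \<in> cls i x \<Longrightarrow> \<exists>h\<in>words T. special (S i) (R i) w (rep i x @ h)"
    by blast+
qed

lemma rep_special_self:
  assumes "x \<in> words (S i)"
  obtains h where "h \<in> words T" "special (S i) (R i) x (rep i x @ h)" "E i x (rep i x @ h)"
  using rep_special[OF assms coset_refl[OF assms]] special_pres_eq[OF bp _ assms] by blast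

lemma rep_cong: "cls i x = cls i y \<Longrightarrow> rep i x = rep i y"
  by (simp add: rep_def)

lemma cls_eq: "w \<in> cls i x \<Longrightarrow> x \<in> words (S i) \<Longrightarrow> cls i w = cls i x"
  using coset_eq[OF T_subset] by blast

lemma cls_appendI: "h \<in> words T \<Longrightarrow> E i w (x @ h) \<Longrightarrow> w \<in> cls i x"
  unfolding coset_def by blast

lemma rep_in_cls:
  assumes "x \<in> words (S i)"
  shows "rep i x \<in> cls i x"
proof -
  obtain h where h: "h \<in> words T" "E i x (rep i x @ h)"
    using rep_special_self[OF assms] by blast
  have "E i (rep i x) (x @ inv_word h)"
    using pres_eq_move_right[OF T_words(1)[OF h(1)], of i "R i" "rep i x" x] h(2) pres_eq.sym by blast
  then show ?thesis
    using h(1) by (intro cls_appendI) simp_all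
qed

lemma rep_rep: "x \<in> words (S i) \<Longrightarrow> rep i (rep i x) = rep i x"
  by (rule rep_cong[OF cls_eq[OF rep_in_cls]])

lemma inH_cls: "inH i x \<longleftrightarrow> x \<in> cls i []"
  by (simp add: inH_def coset_def)

text \<open>The representative of the trivial coset is reached from the empty word, hence empty;
  this is where syllables in the common subgroup disappear.\<close>

lemma rep_inH:
  assumes "inH i x"
  shows "rep i x = []"
proof -
  have x: "cls i x = cls i []"
    using cls_eq[of x i "[]"] assms inH_cls by simp
  obtain h where "special (S i) (R i) [] (rep i [] @ h)"
    using rep_special_self[of "[]" i] by auto
  then have "rep i [] @ h = []"
    using special_Nil[OF bp] by blast
  then show ?thesis
    using rep_cong[OF x] by simp
qed

lemma inH_iff:
  assumes "x \<in> words (S i)"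
  shows "inH i x \<longleftrightarrow> rep i x = []"
proof
  assume r: "rep i x = []"
  obtain h where "h \<in> words T" "E i x (rep i x @ h)"
    using rep_special_self[OF assms] .
  then show "inH i x"
    unfolding inH_def r by auto
qed (rule rep_inH)

lemma inH_append_right:
  assumes "h \<in> words T" "x \<in> words (S i)"
  shows "inH i (x @ h) \<longleftrightarrow> inH i x"
proof -
  have "x @ h \<in> cls i x"
    using assms T_words(1)[OF assms(1)] by (intro cls_appendI[OF assms(1)] pres_eq.refl) simp
  then have "cls i (x @ h) = cls i x"
    using cls_eq assms by blast
  then show ?thesis
    using rep_cong[of i "x @ h" x] inH_iff[of "x @ h" i] inH_iff[OF assms(2)] assms(2) T_words(1)[OF assms(1), of i]
    by simp
qed

lemma inH_inv: "inH i (inv_word x) \<longleftrightarrow> inH i x"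
proof -
  have "inH i (inv_word x)" if "inH i x" for x
    using that unfolding inH_def by (auto intro!: bexI[of _ "inv_word _"] pres_eq_inv)
  from this[of x] this[of "inv_word x"] show ?thesis by auto
qed

lemma inH_append_left:
  assumes "h \<in> words T" "x \<in> words (S i)"
  shows "inH i (h @ x) \<longleftrightarrow> inH i x"
  using inH_append_right[of "inv_word h" "inv_word x" i] inH_inv[of i "h @ x"] inH_inv[of i x] assms by simp

lemma inH_cong: "E i x y \<Longrightarrow> inH i x \<longleftrightarrow> inH i y"
  unfolding inH_def using pres_eq.trans[of "S i" "R i" x y] pres_eq.trans[of "S i" "R i" y x] pres_eq.sym[of "S i" "R i" x y]
  by blast

text \<open>States are compared as pairs, so each element of the common subgroup gets one fixed
  word. By \<open>agree'\<close> the choice made in the factor \<open>True\<close> is valid in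
  both.\<close>

definition "canon h = (SOME h'. h' \<in> words T \<and> E True h h')"

lemma canon:
  assumes "h \<in> words T"
  shows canon_words: "canon h \<in> words T" and canon_E: "E i h (canon h)"
proof -
  have "\<exists>h'. h' \<in> words T \<and> E True h h'"
    using assms pres_eq.refl T_words by blast
  from someI_ex[OF this] have *: "canon h \<in> words T" "E True h (canon h)"
    unfolding canon_def by blast+
  then show "canon h \<in> words T" "E i h (canon h)"
    using agree' assms by blast+
qed

lemma canon_cong:
  assumes "h \<in> words T" "h' \<in> words T" "E i h h'"
  shows "canon h = canon h'"
proof -
  have *: "E True h h'"
    using agree'[OF assms(1,2)] assms(3) by blast
  have "(\<lambda>k. k \<in> words T \<and> E True h k) = (\<lambda>k. k \<in> words T \<and> E True h' k)"
    using pres_eq.trans[OF *] pres_eq.trans[OF pres_eq.sym[OF *]] by blast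
  then show ?thesis
    by (simp add: canon_def)
qed

lemma canon_canon: "h \<in> words T \<Longrightarrow> canon (canon h) = canon h"
  using canon_cong[OF canon_words _ pres_eq.sym[OF canon_E]] by blast

definition "tail i g = canon (SOME h. h \<in> words T \<and> E i g (rep i g @ h))"

lemma tail:
  assumes "g \<in> words (S i)"
  shows tail_words: "tail i g \<in> words T" and tail_E: "E i g (rep i g @ tail i g)"
    and tail_canon: "canon (tail i g) = tail i g"
    and tail_eq: "h \<in> words T \<Longrightarrow> E i g (rep i g @ h) \<Longrightarrow> tail i g = canon h"
proof -
  define k where "k = (SOME h. h \<in> words T \<and> E i g (rep i g @ h))"
  have "\<exists>h. h \<in> words T \<and> E i g (rep i g @ h)"
    using rep_special_self[OF assms] by blast
  from someI_ex[OF this] have k: "k \<in> words T" "E i g (rep i g @ k)"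
    unfolding k_def by blast+
  have t: "tail i g = canon k"
    by (simp add: tail_def k_def)
  show "tail i g \<in> words T" "canon (tail i g) = tail i g"
    using canon_words[OF k(1)] canon_canon[OF k(1)] t by simp_all
  show "E i g (rep i g @ tail i g)"
    unfolding t using pres_eq.trans[OF k(2) pres_eq_appendL[OF rep_words[OF assms] canon_E[OF k(1)]]] .
  show "tail i g = canon h" if h: "h \<in> words T" "E i g (rep i g @ h)"
  proof -
    have "E i (rep i g @ k) (rep i g @ h)"
      using pres_eq.trans[OF pres_eq.sym[OF k(2)] h(2)] .
    then have "E i k h"
      using pres_eq_cancelL[OF rep_words[OF assms]] by blast
    then show ?thesis
      unfolding t using canon_cong k(1) h(1) by blast
  qed
qed

lemma E_cls: "E i g g' \<Longrightarrow> cls i g = cls i g'"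
  using cls_eq[of g i g'] cls_appendI[of "[]" i g g'] pres_eq_words[of "S i" "R i" g g'] by simp

lemma rep_E: "E i g g' \<Longrightarrow> rep i g = rep i g'"
  using E_cls rep_cong by blast

lemma tail_E_cong:
  assumes "E i g g'"
  shows "tail i g = tail i g'"
proof -
  have g: "g \<in> words (S i)" "g' \<in> words (S i)"
    using pres_eq_words[OF assms] by blast+
  have "E i g (rep i g @ tail i g')"
    using pres_eq.trans[OF assms tail_E[OF g(2)]] rep_E[OF assms] by simp
  then show ?thesis
    using tail_eq[OF g(1) tail_words[OF g(2)]] tail_canon[OF g(2)] by simp
qed

subsection \<open>The action on normal forms\<close>

text \<open>A state \<open>(l, h)\<close> stands for the normal form in which the syllables of \<open>l\<close>, the last one first,
  are followed by \<open>h\<close>.\<close>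



definition red_seq :: "'a syllables \<Rightarrow> bool" where
  "red_seq l \<longleftrightarrow> (\<forall>p\<in>set l. snd p \<in> words (S (fst p)) \<and> \<not> inH (fst p) (snd p)) \<and> successively (\<noteq>) (map fst l)"

text \<open>Kept apart from \<open>red_seq\<close>: the types of syllables are determined for every
  reduced sequence, the syllables themselves only where they are representatives, and later proofs
  need sequences with some syllables of each sort.\<close>

definition rep_seq :: "'a syllables \<Rightarrow> bool" where
  "rep_seq l \<longleftrightarrow> (\<forall>p\<in>set l. rep (fst p) (snd p) = snd p)"

definition val :: "'a syllables \<Rightarrow> 'a letter list" where
  "val l = concat (map snd l)"

definition states :: "('a syllables \<times> 'a letter list) set" where
  "states = {(l, h). red_seq l \<and> rep_seq l \<and> h \<in> words T \<and> canon h = h}"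

definition other_head :: "bool \<Rightarrow> 'a syllables \<Rightarrow> bool" where
  "other_head i l \<longleftrightarrow> l = [] \<or> fst (hd l) \<noteq> i"

definition pop :: "bool \<Rightarrow> 'a syllables \<times> 'a letter list \<Rightarrow>
    'a syllables \<times> 'a letter list" where
  "pop i st = (if other_head i (fst st) then st else (tl (fst st), snd (hd (fst st)) @ snd st))"

definition push :: "bool \<Rightarrow> 'a syllables \<Rightarrow> 'a letter list \<Rightarrow>
    'a syllables \<times> 'a letter list" where
  "push i l g = (if inH i g then (l, tail i g) else ((i, rep i g) # l, tail i g))"

text \<open>Right multiplication as in van der Waerden's argument: a last syllable of factor
  \<open>i\<close> is reopened, multiplied inside the factor, and split again into representative
  and common part.\<close>

definition act :: "bool \<Rightarrow> 'a letter list \<Rightarrow> 'a syllables \<times> 'a letter list \<Rightarrow>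
    'a syllables \<times> 'a letter list" where
  "act i x st = (case pop i st of (l, g) \<Rightarrow> push i l (g @ x))"

lemma red_seq_simps [simp]:
  "red_seq []"
  "red_seq (p # l) \<longleftrightarrow> snd p \<in> words (S (fst p)) \<and> \<not> inH (fst p) (snd p) \<and> other_head (fst p) l \<and> red_seq l"
  by (cases l; auto simp: red_seq_def other_head_def successively_Cons)+

lemma rep_seq_simps [simp]:
  "rep_seq []" "rep_seq (p # l) \<longleftrightarrow> rep (fst p) (snd p) = snd p \<and> rep_seq l"
  "rep_seq (l @ l') \<longleftrightarrow> rep_seq l \<and> rep_seq l'"
  by (auto simp: rep_seq_def)

lemma val_simps [simp]: "val [] = []" "val (p # l) = snd p @ val l" "val (l @ l') = val l @ val l'"
  by (simp_all add: val_def)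

lemma val_words: "val l \<in> words X \<longleftrightarrow> (\<forall>p\<in>set l. snd p \<in> words X)"
  by (induction l) auto

lemma red_seq_val: "red_seq l \<Longrightarrow> val l \<in> words U"
  using val_words S_words unfolding red_seq_def by blast

lemma pop_state:
  assumes "(l, h) \<in> states" "pop i (l, h) = (l', g)"
  shows "red_seq l'" "rep_seq l'" "other_head i l'" "g \<in> words (S i)"
proof -
  have "red_seq l' \<and> rep_seq l' \<and> other_head i l' \<and> g \<in> words (S i)"
  proof (cases "other_head i l")
    case True
    then have "l' = l" "g = h"
      using assms(2) by (simp_all add: pop_def)
    then show ?thesis
      using True assms(1) T_words(1)[of h i] by (simp add: states_def)
  next
    case False
    then obtain y l1 where l: "l = (i, y) # l1"
      by (cases l) (auto simp: other_head_def)
    then have "l' = l1" "g = y @ h"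
      using assms(2) False by (auto simp: pop_def)
    then show ?thesis
      using assms(1) l T_words(1)[of h i] by (simp add: states_def)
  qed
  then show "red_seq l'" "rep_seq l'" "other_head i l'" "g \<in> words (S i)" by simp_all
qed

lemma push_state:
  assumes "red_seq l" "rep_seq l" "other_head i l" "g \<in> words (S i)"
  shows "push i l g \<in> states"
proof -
  have "\<not> inH i (rep i g)" if "\<not> inH i g"
    using that inH_iff[OF assms(4)] rep_inH[of i "rep i g"] rep_rep[OF assms(4)] by auto
  then show ?thesis
    using assms tail_words[OF assms(4)] tail_canon[OF assms(4)] rep_words[OF assms(4)] rep_rep[OF assms(4)]
    by (simp add: push_def states_def)
qed

lemma act_state: "st \<in> states \<Longrightarrow> x \<in> words (S i) \<Longrightarrow> act i x st \<in> states"
proof -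
  assume st: "st \<in> states" and x: "x \<in> words (S i)"
  obtain l h l' g where *: "st = (l, h)" "pop i st = (l', g)"
    by (meson surj_pair)
  show "act i x st \<in> states"
    using pop_state[of l h i l' g] push_state[of l' i "g @ x"] st x * by (simp add: act_def)
qed

lemma push_cong: "E i g g' \<Longrightarrow> push i l g = push i l g'"
  using inH_cong rep_E tail_E_cong by (simp add: push_def)

lemma pop_push:
  assumes "other_head i l" "g \<in> words (S i)"
  obtains g' where "pop i (push i l g) = (l, g')" "E i g' g"
proof (cases "inH i g")
  case True
  then have "E i (tail i g) g"
    using tail_E[OF assms(2)] rep_inH pres_eq.sym by fastforce
  then show ?thesis
    using that True assms(1) by (simp add: push_def pop_def)
next
  case False
  have "E i (rep i g @ tail i g) g"
    using pres_eq.sym[OF tail_E[OF assms(2)]] .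
  then show ?thesis
    using that False by (simp add: push_def pop_def other_head_def)
qed

lemma push_pop:
  assumes "(l, h) \<in> states" "pop i (l, h) = (l', g)"
  shows "push i l' g = (l, h)"
proof (cases "other_head i l")
  case True
  then have *: "l' = l" "g = h"
    using assms(2) by (simp_all add: pop_def)
  have h: "h \<in> words T" "canon h = h"
    using assms(1) by (simp_all add: states_def)
  have "E i h h"
    using h T_words pres_eq.refl by blast
  then have H: "inH i h"
    using h unfolding inH_def by blast
  then have "tail i h = h"
    using tail_eq[OF T_words(1)[OF h(1)] h(1)] rep_inH[OF H] h(2) \<open>E i h h\<close> by simp
  then show ?thesis
    using * H by (simp add: push_def)
next
  case False
  then obtain y where l: "l = (i, y) # l'" and g: "g = y @ h"
    using assms(2) unfolding other_head_def pop_def by (cases l) auto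
  have h: "h \<in> words T" "canon h = h" and y: "y \<in> words (S i)" "\<not> inH i y" "rep i y = y"
    using assms(1) l by (auto simp: states_def)
  have "g \<in> cls i y"
    using g h y T_words(1)[OF h(1)] by (intro cls_appendI[OF h(1)]) (simp add: pres_eq.refl)
  then have r: "rep i g = y"
    using rep_cong[OF cls_eq[OF _ y(1)]] y(3) by simp
  have gw: "g \<in> words (S i)"
    using g y(1) T_words(1)[OF h(1)] by simp
  have "tail i g = canon h"
    using g r gw pres_eq.refl[OF gw] by (intro tail_eq[OF gw h(1)]) simp
  then show ?thesis
    using r l h(2) inH_append_right[OF h(1) y(1)] y(2) g by (simp add: push_def)
qed

lemma act_Nil: "st \<in> states \<Longrightarrow> act i [] st = st"
proof -
  assume st: "st \<in> states"
  obtain l h l' g where *: "st = (l, h)" "pop i st = (l', g)"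
    by (meson surj_pair)
  then show ?thesis
    using push_pop[of l h i l' g] st by (simp add: act_def)
qed

lemma act_append:
  assumes "st \<in> states" "x \<in> words (S i)" "y \<in> words (S i)"
  shows "act i y (act i x st) = act i (x @ y) st"
proof -
  obtain l h l' g where *: "st = (l, h)" "pop i st = (l', g)"
    by (meson surj_pair)
  have g: "other_head i l'" "g \<in> words (S i)"
    using pop_state[of l h i l' g] assms(1) * by simp_all
  then obtain g' where g': "pop i (push i l' (g @ x)) = (l', g')" "E i g' (g @ x)"
    using pop_push[of i l' "g @ x"] assms(2) by auto
  have "E i (g' @ y) (g @ (x @ y))"
    using pres_eq_appendR[OF assms(3) g'(2)] by simp
  then show ?thesis
    using g'(1) *(2) push_cong by (simp add: act_def)
qed

lemma act_cong:
  assumes "st \<in> states" "E i x y"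
  shows "act i x st = act i y st"
proof -
  obtain l h l' g where *: "st = (l, h)" "pop i st = (l', g)"
    by (meson surj_pair)
  have "g \<in> words (S i)"
    using pop_state[of l h i l' g] assms(1) * by simp
  then have "E i (g @ x) (g @ y)"
    using assms(2) pres_eq_appendL by blast
  then show ?thesis
    using * push_cong by (simp add: act_def)
qed

text \<open>The result does not depend on \<open>i\<close>, so the actions of the two factors agree
  on the common subgroup and glue to an action of the amalgam.\<close>

lemma act_T:
  assumes "(l, h) \<in> states" "x \<in> words T"
  shows "act i x (l, h) = (l, canon (h @ x))"
proof (cases "other_head i l")
  case True
  have h: "h \<in> words T"
    using assms(1) by (simp add: states_def)
  have hx: "h @ x \<in> words T" "h @ x \<in> words (S i)"
    using h assms(2) T_words(1)[OF h] T_words(1)[OF assms(2)] by simp_all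
  have "E i (h @ x) (h @ x)"
    using hx pres_eq.refl by blast
  then have H: "inH i (h @ x)"
    using hx unfolding inH_def by blast
  then have "tail i (h @ x) = canon (h @ x)"
    using tail_eq[OF hx(2,1)] rep_inH[OF H] pres_eq.refl[OF hx(2)] by simp
  then show ?thesis
    using True H by (simp add: act_def pop_def push_def)
next
  case False
  then obtain y l' where l: "l = (i, y) # l'"
    unfolding other_head_def by (cases l) auto
  have h: "h \<in> words T" and y: "y \<in> words (S i)" "\<not> inH i y" "rep i y = y"
    using assms(1) l by (auto simp: states_def)
  have hx: "h @ x \<in> words T"
    using h assms(2) by simp
  define g where "g = y @ (h @ x)"
  have gw: "g \<in> words (S i)"
    using y(1) T_words(1)[OF hx] by (simp add: g_def)
  have "g \<in> cls i y"
    using pres_eq.refl[OF gw] by (intro cls_appendI[OF hx]) (simp add: g_def)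
  then have r: "rep i g = y"
    using rep_cong[OF cls_eq[OF _ y(1)]] y(3) by simp
  have "tail i g = canon (h @ x)"
    using pres_eq.refl[OF gw] r by (intro tail_eq[OF gw hx]) (simp add: g_def)
  moreover have "\<not> inH i g"
    using inH_append_right[OF hx y(1)] y(2) by (simp add: g_def)
  ultimately show ?thesis
    using False l r by (simp add: act_def pop_def push_def g_def)
qed

definition act_letter :: "'a letter \<Rightarrow> 'a syllables \<times> 'a letter list \<Rightarrow>
    'a syllables \<times> 'a letter list" where
  "act_letter c = act ([c] \<in> words (S True)) [c]"

lemma act_letter:
  assumes "st \<in> states" "[c] \<in> words (S i)"
  shows "act_letter c st = act i [c] st"
proof (cases "i \<or> [c] \<notin> words (S True)")
  case True
  then show ?thesis
    using assms by (cases i) (auto simp: act_letter_def)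
next
  case False
  then have "[c] \<in> words T"
    using assms words_Int_iff by (cases i) auto
  moreover obtain l h where "st = (l, h)"
    by (meson surj_pair)
  ultimately show ?thesis
    using act_T[of l h "[c]"] assms(1) by (simp add: act_letter_def)
qed

lemma fold_act:
  assumes "st \<in> states" "x \<in> words (S i)"
  shows "fold act_letter x st = act i x st"
  using assms
proof (induction x arbitrary: st)
  case Nil
  then show ?case by (simp add: act_Nil)
next
  case (Cons c x)
  have cx: "[c] \<in> words (S i)" "x \<in> words (S i)"
    using Cons.prems(2) words_Cons_letter by blast+
  have "fold act_letter (c # x) st = fold act_letter x (act i [c] st)"
    using act_letter[OF Cons.prems(1) cx(1)] by simp
  also have "\<dots> = act i x (act i [c] st)"
    using Cons.IH[OF act_state[OF Cons.prems(1) cx(1)] cx(2)] .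
  also have "\<dots> = act i (c # x) st"
    using act_append[OF Cons.prems(1) cx] by simp
  finally show ?case .
qed

lemma fold_act_cong:
  assumes "st \<in> states" "E i x y"
  shows "fold act_letter x st = fold act_letter y st"
  using fold_act[OF assms(1)] act_cong[OF assms] pres_eq_words[OF assms(2)] by metis

lemma fold_act_EE:
  assumes "EE w w'" "st \<in> states"
  shows "fold act_letter w st = fold act_letter w' st"
proof (rule pres_eq_fold[OF assms])
  fix c st assume *: "[c] \<in> words U" "st \<in> states"
  then obtain i where "[c] \<in> words (S i)"
    by (cases c) auto
  then show "act_letter c st \<in> states"
    using act_letter[OF *(2)] act_state[OF *(2)] by metis
next
  fix s st assume *: "s \<in> U" "st \<in> states"
  then obtain i where i: "s \<in> S i" by blast
  have "E i [Pos s, Neg s] []" "E i [Neg s, Pos s] []"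
    using i by (auto intro: pres_eq.intros)
  from this[THEN fold_act_cong[OF *(2)]]
  show "act_letter (Neg s) (act_letter (Pos s) st) = st" "act_letter (Pos s) (act_letter (Neg s) st) = st"
    by simp_all
next
  fix v v' st assume *: "Upair v v' \<in> Q" "st \<in> states"
  then obtain i where i: "Upair v v' \<in> R i" by blast
  have "E i (pos v) (pos v')"
    using pres_eq.relation[OF i braid_pres_lists[OF bp i]] .
  then show "fold act_letter (pos v) st = fold act_letter (pos v') st"
    using fold_act_cong[OF *(2)] by blast
qed

text \<open>Each syllable differs in type from the last one and stays outside the common subgroup
  after multiplication by the current common part, so it is pushed and never absorbed.\<close>

lemma fold_act_types:
  assumes "red_seq l" "h \<in> words T" "canon h = h"
  shows "\<exists>l' h'. fold act_letter (val l) ([], h) = (l', h') \<and> (l', h') \<in> states \<and> map fst l' = rev (map fst l)"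
  using assms(1)
proof (induction l rule: rev_induct)
  case Nil
  then show ?case
    using assms by (simp add: states_def)
next
  case (snoc p l)
  obtain i x where p: "p = (i, x)"
    by (meson surj_pair)
  have l: "red_seq l" "x \<in> words (S i)" "\<not> inH i x" "l = [] \<or> fst (last l) \<noteq> i"
    using snoc.prems unfolding red_seq_def p by (auto simp: successively_append_iff last_map)
  obtain l' h' where st: "fold act_letter (val l) ([], h) = (l', h')" "(l', h') \<in> states"
      "map fst l' = rev (map fst l)"
    using snoc.IH[OF l(1)] by blast
  have "other_head i l'"
  proof (cases "l = []")
    case True
    then show ?thesis
      using st(3) by (simp add: other_head_def)
  next
    case False
    then have "l' \<noteq> []"
      using st(3) by auto
    then have "fst (hd l') = hd (map fst l')"
      by (simp add: hd_map)
    also have "\<dots> = fst (last l)"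
      using False by (simp add: st(3) hd_rev last_map)
    finally have "fst (hd l') = fst (last l)" .
    then have "fst (hd l') \<noteq> i"
      using l(4) False by simp
    then show ?thesis
      by (simp add: other_head_def)
  qed
  then have pop: "pop i (l', h') = (l', h')"
    by (simp add: pop_def)
  have h': "h' \<in> words T"
    using st(2) by (simp add: states_def)
  have "\<not> inH i (h' @ x)"
    using inH_append_left[OF h' l(2)] l(3) by blast
  then have act: "act i x (l', h') = ((i, rep i (h' @ x)) # l', tail i (h' @ x))"
    by (simp add: act_def pop push_def)
  have "fold act_letter (val (l @ [p])) ([], h) = fold act_letter x (l', h')"
    by (simp add: st(1) p)
  also have "\<dots> = ((i, rep i (h' @ x)) # l', tail i (h' @ x))"
    unfolding fold_act[OF st(2) l(2)] by (rule act)
  finally show ?case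
    using st(3) p act_state[OF st(2) l(2)] unfolding act by simp
qed

subsection \<open>Uniqueness of normal forms\<close>

lemma fold_act_T:
  assumes "(l, h) \<in> states" "t \<in> words T"
  shows "fold act_letter t (l, h) = (l, canon (h @ t))" "(l, canon (h @ t)) \<in> states"
proof -
  have t: "t \<in> words (S True)"
    using T_words(1)[OF assms(2)] .
  show "fold act_letter t (l, h) = (l, canon (h @ t))"
    using fold_act[OF assms(1) t] act_T[OF assms] by metis
  then show "(l, canon (h @ t)) \<in> states"
    using fold_act[OF assms(1) t] act_state[OF assms(1) t] by metis
qed

text \<open>\<open>t\<close> and \<open>h\<close> alter only the common part of the state, before
  and after the syllables are read; the types are therefore read off from the final state.\<close>

lemma types_eq:
  assumes "red_seq l" "red_seq l'" "t \<in> words T" "t' \<in> words T" "h \<in> words T" "h' \<in> words T"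
    and "EE (t @ val l @ h) (t' @ val l' @ h')"
  shows "map fst l = map fst l'"
proof -
  let ?e = "([], canon []) :: 'a syllables \<times> 'a letter list"
  have e: "?e \<in> states"
    using canon_words[of "[]"] canon_canon[of "[]"] by (simp add: states_def)
  have types: "map fst (fst (fold act_letter (t @ val l @ h) ?e)) = rev (map fst l)"
    if rl: "red_seq l" "t \<in> words T" "h \<in> words T" for l t h
  proof -
    note t = fold_act_T[OF e rl(2)]
    obtain l' h' where l': "fold act_letter (val l) ([], canon (canon [] @ t)) = (l', h')" "(l', h') \<in> states"
        "map fst l' = rev (map fst l)"
      using fold_act_types[OF rl(1), of "canon (canon [] @ t)"] t(2) by (auto simp: states_def)
    have "fold act_letter (t @ val l @ h) ?e = fold act_letter h (l', h')"
      using t(1) l'(1) by simp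
    then show ?thesis
      using fold_act_T(1)[OF l'(2) rl(3)] l'(3) by simp
  qed
  have "rev (map fst l) = rev (map fst l')"
    using types[OF assms(1,3,5)] types[OF assms(2,4,6)] fold_act_EE[OF assms(7) e] by simp
  then show ?thesis by simp
qed

text \<open>The factors embed: acting on a state without syllables records representative and tail,
  which determine an element of the factor.\<close>

lemma EE_imp_E:
  assumes "EE x y" "x \<in> words (S i)" "y \<in> words (S i)"
  shows "E i x y"
proof -
  \<comment> \<open>\<open>canon []\<close> represents 1 but may be a nonempty word; it is cancelled
    at the end.\<close>
  define e where "e = canon []"
  have e: "([], e) \<in> states" "e \<in> words T"
    using canon_words[of "[]"] canon_canon[of "[]"] by (simp_all add: states_def e_def)
  have ew: "e @ x \<in> words (S i)" "e @ y \<in> words (S i)"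
    using T_words(1)[OF e(2)] assms by simp_all
  have act: "act i z ([], e) = push i [] (e @ z)" for z
    by (simp add: act_def pop_def other_head_def)
  have "act i x ([], e) = act i y ([], e)"
    using fold_act_EE[OF assms(1) e(1)] fold_act[OF e(1) assms(2)] fold_act[OF e(1) assms(3)] by simp
  then have eq: "push i [] (e @ x) = push i [] (e @ y)"
    by (simp add: act)
  have "rep i (e @ x) = rep i (e @ y) \<and> tail i (e @ x) = tail i (e @ y)"
    using eq rep_inH[of i "e @ x"] rep_inH[of i "e @ y"]
    by (cases "inH i (e @ x)"; cases "inH i (e @ y)") (simp_all add: push_def)
  then have "E i (e @ x) (e @ y)"
    using pres_eq.trans[OF tail_E[OF ew(1)], of "e @ y"] pres_eq.sym[OF tail_E[OF ew(2)]] by simp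
  then show ?thesis
    using pres_eq_cancelL[OF T_words(1)[OF e(2)]] by blast
qed

text \<open>If y^-1 x were outside the common subgroup, putting it in place of \<open>x\<close>
  would give a reduced sequence one syllable longer than \<open>l'\<close> for the same element,
  against \<open>types_eq\<close>.\<close>

lemma first_syllable:
  assumes "red_seq ((i, x) # l)" "red_seq ((j, y) # l')" "t \<in> words T" "t' \<in> words T"
    and "EE (x @ val l @ t) (y @ val l' @ t')"
  shows "i = j \<and> x \<in> cls i y"
proof -
  have types: "map fst ((i, x) # l) = map fst ((j, y) # l')"
    using types_eq[OF assms(1,2) _ _ assms(3,4), of "[]" "[]"] assms(5) by simp
  then have ij: "i = j" by simp
  have xy: "x \<in> words (S i)" "y \<in> words (S i)"
    using assms(1,2) ij by simp_all
  have "EE ((inv_word y @ x) @ val l @ t) (val l' @ t')"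
    using pres_eq_move_left[OF S_words[OF xy(2)], of Q "val l' @ t'" "x @ val l @ t"] assms(5) pres_eq.sym
    by fastforce
  then have *: "EE ([] @ val ((i, inv_word y @ x) # l) @ t) ([] @ val l' @ t')"
    by simp
  have "inH i (inv_word y @ x)"
  proof (rule ccontr)
    assume "\<not> ?thesis"
    then have "red_seq ((i, inv_word y @ x) # l)"
      using assms(1) xy by simp
    then have "map fst ((i, inv_word y @ x) # l) = map fst l'"
      using types_eq[OF _ _ _ _ assms(3,4) *] assms(2) by simp
    from arg_cong[OF this, of length] arg_cong[OF types, of length] show False
      by simp
  qed
  then obtain h where h: "h \<in> words T" "E i (inv_word y @ x) h"
    unfolding inH_def by blast
  then have "E i x (y @ h)"
    using pres_eq_move_left[of "inv_word y" "S i" "R i" x h] xy(2) by simp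
  then show ?thesis
    using ij h(1) cls_appendI by blast
qed

text \<open>Only the first \<open>length m\<close> syllables are required to be representatives;
  \<open>l\<close> and \<open>l'\<close> may be arbitrary. The common prefix is then literally
  equal, not just equal in the group.\<close>

lemma prefix_eq:
  assumes "red_seq (m @ l)" "red_seq (m' @ l')" "length m = length m'" "rep_seq m" "rep_seq m'"
    and "t \<in> words T" "t' \<in> words T" "EE (val (m @ l) @ t) (val (m' @ l') @ t')"
  shows "m = m' \<and> EE (val l @ t) (val l' @ t')"
  using assms(3,1,2,4,5,8)
proof (induction m m' rule: list_induct2)
  case Nil
  then show ?case by simp
next
  case (Cons p m p' m')
  obtain i x j y where p: "p = (i, x)" "p' = (j, y)"
    by (meson surj_pair)
  have *: "i = j \<and> x \<in> cls i y"
    by (rule first_syllable[OF _ _ assms(6,7)]) (use Cons.prems p in auto)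
  have xy: "x \<in> words (S i)" "y \<in> words (S i)" "rep i x = x" "rep i y = y"
    using Cons.prems p * by simp_all
  have "rep i x = rep i y"
    using * by (intro rep_cong cls_eq xy(2)) blast
  then have "x = y"
    using xy(3,4) by simp
  then have "EE (x @ (val (m @ l) @ t)) (x @ (val (m' @ l') @ t'))"
    using Cons.prems p by simp
  then have "EE (val (m @ l) @ t) (val (m' @ l') @ t')"
    using pres_eq_cancelL[OF S_words[OF xy(1)]] by blast
  then show ?case
    using Cons.IH Cons.prems p * \<open>x = y\<close> by simp
qed

definition inv_seq :: "'a syllables \<Rightarrow> 'a syllables" where
  "inv_seq l = rev (map (map_prod id inv_word) l)"

lemma inv_seq_simps [simp]:
  "inv_seq [] = []" "inv_seq (l @ l') = inv_seq l' @ inv_seq l" "inv_seq (inv_seq l) = l"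
  "length (inv_seq l) = length l" "map fst (inv_seq l) = rev (map fst l)"
  by (auto simp: inv_seq_def rev_map o_def prod.map_comp map_idI)

lemma val_inv_seq: "val (inv_seq l) = inv_word (val l)"
  by (induction l) (auto simp: inv_seq_def)

lemma red_seq_inv_seq: "red_seq (inv_seq l) \<longleftrightarrow> red_seq l"
proof -
  have "successively (\<lambda>x y. y \<noteq> x) (map fst l) \<longleftrightarrow> successively (\<noteq>) (map fst l)"
    by (rule successively_cong) auto
  then show ?thesis
    unfolding red_seq_def inv_seq_simps(5) successively_rev by (simp add: inv_seq_def inH_inv)
qed

lemma suffix_eq:
  assumes "red_seq (l @ m)" "red_seq (l' @ m')" "length m = length m'" "rep_seq (inv_seq m)" "rep_seq (inv_seq m')"
    and "t \<in> words T" "t' \<in> words T" "EE (t @ val (l @ m)) (t' @ val (l' @ m'))"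
  shows "m = m' \<and> EE (t @ val l) (t' @ val l')"
proof -
  have "EE (inv_word (t @ val (l @ m))) (inv_word (t' @ val (l' @ m')))"
    using assms(8) pres_eq_inv by blast
  then have "EE (val (inv_seq m @ inv_seq l) @ inv_word t) (val (inv_seq m' @ inv_seq l') @ inv_word t')"
    by (simp add: val_inv_seq)
  moreover have "red_seq (inv_seq m @ inv_seq l)" "red_seq (inv_seq m' @ inv_seq l')"
    using assms(1,2) red_seq_inv_seq[of "l @ m"] red_seq_inv_seq[of "l' @ m'"] by simp_all
  ultimately have *: "inv_seq m = inv_seq m' \<and> EE (val (inv_seq l) @ inv_word t) (val (inv_seq l') @ inv_word t')"
    using assms(3-7) by (intro prefix_eq) simp_all
  then have "inv_seq m = inv_seq m'"
    by blast
  from arg_cong[OF this, of inv_seq] have "m = m'"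
    by simp
  moreover have "EE (inv_word (t @ val l)) (inv_word (t' @ val l'))"
    using * by (simp add: val_inv_seq)
  ultimately show ?thesis
    using pres_eq_inv_iff by blast
qed

subsection \<open>Normalisation by special transformations\<close>

lemma red_seq_snoc:
  "red_seq (l @ [(i, x)]) \<longleftrightarrow> red_seq l \<and> x \<in> words (S i) \<and> \<not> inH i x \<and> (l = [] \<or> fst (last l) \<noteq> i)"
  by (auto simp: red_seq_def successively_append_iff last_map)

lemma red_seq_appendD: "red_seq (l @ l') \<Longrightarrow> red_seq l \<and> red_seq l'"
  by (auto simp: red_seq_def successively_append_iff)

text \<open>Each new letter is multiplied, together with the common part, into the last syllable if
  that has the right type; \<open>rep_special_self\<close> then splits the result by special
  transformations.\<close>

lemma left_normalise:
  assumes "w \<in> words U"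
  obtains l h where "special U Q w (val l @ h)" "red_seq l" "rep_seq l" "h \<in> words T"
proof -
  have "\<exists>l h. special U Q w (val l @ h) \<and> red_seq l \<and> rep_seq l \<and> h \<in> words T"
    using assms
  proof (induction w rule: rev_induct)
    case Nil
    show ?case by (intro exI[of _ "[]"]) simp
  next
    case (snoc c w)
    then obtain l h where l: "special U Q w (val l @ h)" "red_seq l" "rep_seq l" "h \<in> words T"
      by auto
    have c: "[c] \<in> words U" using snoc.prems by simp
    have w: "special U Q (w @ [c]) (val l @ h @ [c])"
      using special_appendR[OF l(1) c] by simp
    obtain i where i: "[c] \<in> words (S i)"
      using c by (cases c) auto
    obtain l0 g where g: "red_seq l0" "rep_seq l0" "g \<in> words (S i)" "val l @ h @ [c] = val l0 @ g"
      "l0 = [] \<or> fst (last l0) \<noteq> i"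
    proof (cases "l = [] \<or> fst (last l) \<noteq> i")
      case True
      then show ?thesis
        using that[of l "h @ [c]"] l i T_words(1) by simp
    next
      case False
      then obtain l0 y where l0: "l = l0 @ [(i, y)]"
        by (cases l rule: rev_cases) auto
      have "red_seq l0" "y \<in> words (S i)" "l0 = [] \<or> fst (last l0) \<noteq> i"
        using l(2) red_seq_snoc unfolding l0 by blast+
      then show ?thesis
        using that[of l0 "y @ h @ [c]"] l(3) i T_words(1)[OF l(4)] l0 by simp
    qed
    obtain k where k: "k \<in> words T" "special (S i) (R i) g (rep i g @ k)" "E i g (rep i g @ k)"
      using rep_special_self[OF g(3)] .
    have "special U Q (val l0 @ g) (val l0 @ (rep i g @ k))"
      using special_appendL[OF special_factor[OF k(2)] red_seq_val[OF g(1)]] .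
    then have sp: "special U Q (w @ [c]) (val l0 @ rep i g @ k)"
      using rtranclp_trans[OF w] g(4) by simp
    show ?case
    proof (cases "inH i g")
      case True
      then show ?thesis
        using sp rep_inH[OF True] g k(1) by (intro exI[of _ l0] exI[of _ k]) simp
    next
      case False
      then have "\<not> inH i (rep i g)"
        using inH_iff[OF g(3)] rep_inH[of i "rep i g"] rep_rep[OF g(3)] by auto
      then have "red_seq (l0 @ [(i, rep i g)])"
        using g rep_words[OF g(3)] red_seq_snoc by blast
      then show ?thesis
        using sp g k(1) rep_rep[OF g(3)] by (intro exI[of _ "l0 @ [(i, rep i g)]"] exI[of _ k]) simp
    qed
  qed
  then show ?thesis using that by blast
qed

lemma right_normalise:
  assumes "w \<in> words U"
  obtains t l where "special U Q w (t @ val l)" "red_seq l" "rep_seq (inv_seq l)" "t \<in> words T"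
proof -
  obtain l h where l: "special U Q (inv_word w) (val l @ h)" "red_seq l" "rep_seq l" "h \<in> words T"
    using left_normalise[of "inv_word w"] assms by auto
  have "special U Q w (inv_word h @ val (inv_seq l))"
    using special_inv[OF l(1)] by (simp add: val_inv_seq)
  then show ?thesis
    using that[of "inv_word h" "inv_seq l"] l red_seq_inv_seq by simp
qed

end

context amalgam
begin

lemma red_seq_append:
  assumes "red_seq l" "red_seq l'" "other_head (fst (last l)) l'"
  shows "red_seq (l @ l')"
  using assms unfolding red_seq_def other_head_def
  by (cases "l = []"; cases "l' = []") (auto simp: successively_append_iff hd_map last_map)

lemma special_EE: "special U Q x y \<Longrightarrow> x \<in> words U \<Longrightarrow> EE x y"
  by (rule special_pres_eq[OF bp_union])

text \<open>The coset property of one factor for the parabolic subset \<open>X \<inter> S i\<close>;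
  here the induction needs it beyond the common subgroup.\<close>

lemma parabolic_representative:
  assumes "X \<subseteq> U" "x \<in> words (S i)"
  obtains \<rho> where "\<rho> \<in> words (S i)"
    "\<And>w y. y \<in> words X \<Longrightarrow> y \<in> words (S i) \<Longrightarrow> E i w (x @ y) \<Longrightarrow> \<exists>a\<in>words X. special U Q w (\<rho> @ a)"
proof -
  have "X \<inter> S i \<subseteq> S i" by blast
  then obtain \<rho> where \<rho>: "\<rho> \<in> words (S i)"
      "\<forall>w\<in>coset (S i) (R i) (X \<inter> S i) x. \<exists>a\<in>words (X \<inter> S i). special (S i) (R i) w (\<rho> @ a)"
    using cp[of i] assms(2) unfolding coset_property_def by blast
  have "\<exists>a\<in>words X. special U Q w (\<rho> @ a)"
    if y: "y \<in> words X" "y \<in> words (S i)" "E i w (x @ y)" for w y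
  proof -
    have "y \<in> words (X \<inter> S i)"
      using y(1,2) words_Int_iff by blast
    then have "w \<in> coset (S i) (R i) (X \<inter> S i) x"
      using y(3) unfolding coset_def by blast
    then obtain a where a: "a \<in> words (X \<inter> S i)" "special (S i) (R i) w (\<rho> @ a)"
      using \<rho>(2) by blast
    then show ?thesis
      using special_factor[OF a(2)] words_Int_iff by blast
  qed
  then show ?thesis
    using that \<rho>(1) by blast
qed

text \<open>A right normal form of a word over \<open>X\<close> stays over \<open>X\<close>, as
  special transformations create no letters; so all its syllables can be left in the
  remainder.\<close>

lemma parabolic_right_normalise:
  assumes "X \<subseteq> U" "y \<in> words X"
  obtains t l where "EE y (t @ val l)" "red_seq l" "rep_seq (inv_seq l)" "t \<in> words T" "t \<in> words X"
    "\<And>p. p \<in> set l \<Longrightarrow> snd p \<in> words X"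
proof -
  have y: "y \<in> words U"
    using words_mono[OF assms(2,1)] .
  obtain t l where tl: "special U Q y (t @ val l)" "red_seq l" "rep_seq (inv_seq l)" "t \<in> words T"
    using right_normalise[OF y] .
  have "t @ val l \<in> words X"
    using special_letters[OF tl(1) bp_union assms(2)] .
  then show ?thesis
    using that[OF special_EE[OF tl(1) y] tl(2-4)] val_words by auto
qed

text \<open>The coset \<open>C\<close> consists of the elements \<open>p x y\<close> with \<open>y\<close> in the parabolic subgroup, where \<open>p x\<close>
  has as few syllables as possible, so that nothing but the last syllable \<open>x\<close> interacts with \<open>y\<close>.\<close>

lemma coset_representative_minimal:
  assumes X: "X \<subseteq> U" and l0: "red_seq (l0 @ [(i, x0)])" "rep_seq (l0 @ [(i, x0)])"
    and h0: "h0 \<in> words T" "val (l0 @ [(i, x0)]) @ h0 \<in> coset U Q X g"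
    and minimal: "\<And>l h. red_seq l \<Longrightarrow> rep_seq l \<Longrightarrow> h \<in> words T \<Longrightarrow> val l @ h \<in> coset U Q X g \<Longrightarrow>
      length l0 < length l"
  shows "\<exists>r\<in>words U. \<forall>w\<in>coset U Q X g. \<exists>a\<in>words X. special U Q w (r @ a)"
proof -
  define C where "C = coset U Q X g"
  define x where "x = x0 @ h0"
  have red0: "red_seq l0" "x0 \<in> words (S i)" "\<not> inH i x0" "l0 = [] \<or> fst (last l0) \<noteq> i"
    using l0(1) red_seq_snoc by blast+
  have rep0: "rep_seq l0"
    using l0(2) by simp
  have xS: "x \<in> words (S i)"
    using red0(2) T_words(1)[OF h0(1)] by (simp add: x_def)
  have pU: "val l0 \<in> words U"
    using red_seq_val[OF red0(1)] .
  have pxC: "val l0 @ x \<in> C"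
    using h0(2) by (simp add: C_def x_def)
  obtain \<rho> where \<rho>: "\<rho> \<in> words (S i)"
      "\<And>w y. y \<in> words X \<Longrightarrow> y \<in> words (S i) \<Longrightarrow> E i w (x @ y) \<Longrightarrow> \<exists>a\<in>words X. special U Q w (\<rho> @ a)"
    using parabolic_representative[OF X xS] by blast
  \<comment> \<open>Otherwise the coset would contain an element with only the syllables of
    \<open>l0\<close>, against minimality.\<close>
  have notH: "\<not> inH i (x @ y)" if y: "y \<in> words X" "y \<in> words (S i)" for y
  proof
    assume "inH i (x @ y)"
    then obtain h where h: "h \<in> words T" "E i (x @ y) h"
      unfolding inH_def by blast
    have "EE (val l0 @ h) ((val l0 @ x) @ y)"
      using pres_eq_appendL[OF pU E_imp_EE[OF pres_eq.sym[OF h(2)]]] by simp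
    then have "val l0 @ h \<in> C"
      using coset_append[OF X _ y(1)] pxC C_def by blast
    then show False
      using minimal[OF red0(1) rep0 h(1)] C_def by simp
  qed
  have "\<exists>a\<in>words X. special U Q w ((val l0 @ \<rho>) @ a)" if w: "w \<in> C" for w
  proof -
    have wU: "w \<in> words U"
      using w coset_words C_def by metis
    obtain y where y: "y \<in> words X" "EE w ((val l0 @ x) @ y)"
      using coset_diff[OF X, of "val l0 @ x" Q g w] pxC w C_def by blast
    obtain t' l' where l': "EE y (t' @ val l')" "red_seq l'" "rep_seq (inv_seq l')" "t' \<in> words T" "t' \<in> words X"
        "\<And>p. p \<in> set l' \<Longrightarrow> snd p \<in> words X"
      using parabolic_right_normalise[OF X y(1)] by blast
    \<comment> \<open>The part of y that can merge with \<open>x\<close>: the common part together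
      with a first syllable of factor \<open>i\<close>, if there is one. What follows begins in the
      other factor.\<close>
    obtain y' l2 where l2: "t' @ val l' = y' @ val l2" "y' \<in> words X" "y' \<in> words (S i)" "red_seq l2"
        "rep_seq (inv_seq l2)" "val l2 \<in> words X" "other_head i l2"
    proof (cases "other_head i l'")
      case True
      then show ?thesis
        using that[of t' l'] l' T_words(1)[OF l'(4)] val_words by blast
    next
      case False
      then obtain y1 l1 where l1: "l' = (i, y1) # l1"
        by (cases l') (auto simp: other_head_def)
      have "val l1 \<in> words X" "y1 \<in> words X"
        using l'(6)[of "(i, y1)"] l'(6) by (simp_all add: val_words l1)
      moreover have "rep_seq (inv_seq l1)"
        using l'(3) l1 by (simp add: inv_seq_def)
      ultimately show ?thesis
        using that[of "t' @ y1" l1] l' T_words(1)[OF l'(4)] l1 by simp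
    qed
    have xy: "x @ y' \<in> words (S i)" "\<not> inH i (x @ y')"
      using xS l2(3) notH[OF l2(2,3)] by simp_all
    have red1: "red_seq (l0 @ [(i, x @ y')])"
      using red0 xy red_seq_snoc by blast
    have red2: "red_seq ((l0 @ [(i, x @ y')]) @ l2)"
      by (rule red_seq_append[OF red1 l2(4)]) (use l2(7) in simp)
    have "EE ((val l0 @ x) @ y) ((val l0 @ x) @ (t' @ val l'))"
      using pU S_words[OF xS] by (intro pres_eq_appendL[OF _ l'(1)]) simp
    then have EEw: "EE w (val ((l0 @ [(i, x @ y')]) @ l2))"
      using pres_eq.trans[OF y(2)] l2(1) by simp
    obtain t L where L: "special U Q w (t @ val L)" "red_seq L" "rep_seq (inv_seq L)" "t \<in> words T"
      using right_normalise[OF wU] .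
    have EEL: "EE (t @ val L) (val ((l0 @ [(i, x @ y')]) @ l2))"
      using pres_eq.trans[OF pres_eq.sym[OF special_EE[OF L(1) wU]] EEw] .
    have typesL: "map fst L = map fst ((l0 @ [(i, x @ y')]) @ l2)"
      by (rule types_eq[OF L(2) red2 L(4), of "[]" "[]" "[]"]) (use EEL in simp_all)
    have lenL: "length L = Suc (length l0) + length l2"
      using arg_cong[OF typesL, of length] by simp
    define n where "n = Suc (length l0)"
    have valL: "val L = val (take n L) @ val (drop n L)"
      using val_simps(3)[of "take n L" "drop n L"] by (simp only: append_take_drop_id)
    \<comment> \<open>Right normal forms are literally unique from the right, so behind the
      syllables of \<open>l0\<close> and the merged one, \<open>w\<close> ends in exactly the word
      of \<open>l2\<close>, which already lies over \<open>X\<close>.\<close>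
    have "drop n L = l2 \<and> EE (t @ val (take n L)) ([] @ val (l0 @ [(i, x @ y')]))"
    proof (rule suffix_eq)
      show "red_seq (take n L @ drop n L)" "red_seq ((l0 @ [(i, x @ y')]) @ l2)"
        using L(2) red2 by simp_all
      show "length (drop n L) = length l2"
        using lenL by (simp add: n_def)
      have "rep_seq (inv_seq (take n L @ drop n L))"
        using L(3) by simp
      then show "rep_seq (inv_seq (drop n L))"
        unfolding inv_seq_simps rep_seq_simps by blast
      show "EE (t @ val (take n L @ drop n L)) ([] @ val ((l0 @ [(i, x @ y')]) @ l2))"
        using EEL by simp
    qed (use L l2 in simp_all)
    then have dropL: "drop n L = l2" and EEt: "EE (t @ val (take n L)) (val (l0 @ [(i, x @ y')]))"
      by simp_all
    have redt: "red_seq (take n L)"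
      using L(2) red_seq_appendD[of "take n L" "drop n L"] by simp
    have types: "map fst (take n L) = map fst l0 @ [i]"
      using types_eq[OF redt red1 L(4), of "[]" "[]" "[]"] EEt by simp
    then obtain l1 p where "take n L = l1 @ [p]"
      by (cases "take n L" rule: rev_cases) auto
    then obtain j z where l1: "take n L = l1 @ [(j, z)]"
      by (cases p) auto
    have jt: "j = i" "map fst l1 = map fst l0"
      using types l1 by simp_all
    have red3: "red_seq l1" "z \<in> words (S i)" "\<not> inH i z"
      using redt red_seq_snoc unfolding l1 jt by blast+
    \<comment> \<open>The syllable \<open>z\<close> is held back: a left normal form makes
      everything before it literally \<open>l0\<close>, while \<open>z\<close> has to be brought to
      \<rho> times a word over \<open>X\<close> instead of a representative modulo
      \<open>T\<close>.\<close>
    have tl1: "t @ val l1 \<in> words U"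
      using T_words(2)[OF L(4)] red_seq_val[OF red3(1)] by simp
    obtain l3 h where l3: "special U Q (t @ val l1) (val l3 @ h)" "red_seq l3" "rep_seq l3" "h \<in> words T"
      using left_normalise[OF tl1] .
    have EE3: "EE (t @ val l1) (val l3 @ h)"
      using special_EE[OF l3(1) tl1] .
    have types3: "map fst l3 = map fst l0"
      using types_eq[OF red3(1) l3(2) L(4), of "[]" "[]" h] EE3 l3(4) jt(2) by simp
    have "l3 = [] \<or> fst (last l3) \<noteq> i"
    proof (cases "l3 = []")
      case False
      moreover have "l0 \<noteq> []"
        using types3 False by auto
      ultimately have "fst (last l3) = fst (last l0)"
        using arg_cong[OF types3, of last] by (simp add: last_map)
      then show ?thesis
        using red0(4) \<open>l0 \<noteq> []\<close> by simp
    qed simp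
    moreover have hz: "h @ z \<in> words (S i)" "\<not> inH i (h @ z)"
      using T_words(1)[OF l3(4)] red3 inH_append_left[OF l3(4) red3(2)] by simp_all
    ultimately have red4: "red_seq (l3 @ [(i, h @ z)])"
      using l3(2) red_seq_snoc by blast
    have "EE ((val l3 @ h) @ z) ((t @ val l1) @ z)"
      using pres_eq_appendR[OF S_words[OF red3(2)] pres_eq.sym[OF EE3]] .
    moreover have "EE ((t @ val l1) @ z) (val (l0 @ [(i, x @ y')]))"
      using EEt by (simp add: l1)
    ultimately have "EE ((val l3 @ h) @ z) (val (l0 @ [(i, x @ y')]))"
      by (rule pres_eq.trans)
    then have EE4: "EE (val (l3 @ [(i, h @ z)]) @ []) (val (l0 @ [(i, x @ y')]) @ [])"
      by simp
    have "length l3 = length l0"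
      using types3 by (rule map_eq_imp_length_eq)
    then have "l3 = l0 \<and> EE (val [(i, h @ z)] @ []) (val [(i, x @ y')] @ [])"
      by (rule prefix_eq[OF red4 red1 _ l3(3) rep0 _ _ EE4]) simp_all
    then have l30: "l3 = l0" and "EE (h @ z) (x @ y')"
      by simp_all
    \<comment> \<open>The remaining equality descends to one factor, where its coset property
      finishes.\<close>
    then have "E i (h @ z) (x @ y')"
      using EE_imp_E hz(1) xy(1) by blast
    then obtain a where a: "a \<in> words X" "special U Q (h @ z) (\<rho> @ a)"
      using \<rho>(2)[OF l2(2,3)] by blast
    have "special U Q w ((t @ val l1) @ (z @ val l2))"
      using L(1) by (simp add: valL l1 dropL)
    also have "special U Q \<dots> ((val l3 @ h) @ (z @ val l2))"
      using S_words[OF red3(2)] red_seq_val[OF l2(4)] by (intro special_appendR[OF l3(1)]) simp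
    also have "(val l3 @ h) @ (z @ val l2) = val l0 @ (h @ z) @ val l2"
      using l30 by simp
    also have "special U Q \<dots> (val l0 @ (\<rho> @ a) @ val l2)"
      using special_context[OF a(2) pU red_seq_val[OF l2(4)]] .
    finally have "special U Q w ((val l0 @ \<rho>) @ (a @ val l2))"
      by simp
    moreover have "a @ val l2 \<in> words X"
      using a(1) l2(6) by simp
    ultimately show ?thesis by blast
  qed
  moreover have "val l0 @ \<rho> \<in> words U"
    using pU S_words[OF \<rho>(1)] by simp
  ultimately show ?thesis
    unfolding C_def by blast
qed

text \<open>When the coset meets the common subgroup, right normal forms of its elements have all
  syllables over \<open>X\<close>; only the common part remains, and it is treated in the factor
  \<open>True\<close>, which contains \<open>T\<close>.\<close>

lemma coset_representative_base:
  assumes X: "X \<subseteq> U" and h0: "h0 \<in> words T" "h0 \<in> coset U Q X g"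
  shows "\<exists>r\<in>words U. \<forall>w\<in>coset U Q X g. \<exists>a\<in>words X. special U Q w (r @ a)"
proof -
  define C where "C = coset U Q X g"
  obtain \<rho> where \<rho>: "\<rho> \<in> words (S True)"
      "\<And>w y. y \<in> words X \<Longrightarrow> y \<in> words (S True) \<Longrightarrow> E True w (h0 @ y) \<Longrightarrow> \<exists>a\<in>words X. special U Q w (\<rho> @ a)"
    using parabolic_representative[OF X T_words(1)[OF h0(1)]] by blast
  have "\<exists>a\<in>words X. special U Q w (\<rho> @ a)" if w: "w \<in> C" for w
  proof -
    have wU: "w \<in> words U"
      using w coset_words C_def by metis
    obtain y where y: "y \<in> words X" "EE w (h0 @ y)"
      using coset_diff[OF X, of h0 Q g w] h0(2) w C_def by blast
    obtain t' l' where l': "EE y (t' @ val l')" "red_seq l'" "rep_seq (inv_seq l')" "t' \<in> words T" "t' \<in> words X"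
        "\<And>p. p \<in> set l' \<Longrightarrow> snd p \<in> words X"
      using parabolic_right_normalise[OF X y(1)] by blast
    obtain t L where L: "special U Q w (t @ val L)" "red_seq L" "rep_seq (inv_seq L)" "t \<in> words T"
      using right_normalise[OF wU] .
    have "EE (h0 @ y) (h0 @ (t' @ val l'))"
      using pres_eq_appendL[OF T_words(2)[OF h0(1)] l'(1)] .
    then have EEL: "EE (t @ val ([] @ L)) ((h0 @ t') @ val ([] @ l'))"
      using pres_eq.trans[OF pres_eq.sym[OF special_EE[OF L(1) wU]] pres_eq.trans[OF y(2)]] by simp
    have ht: "h0 @ t' \<in> words T"
      using h0(1) l'(4) by simp
    have "map fst L = map fst l'"
      using types_eq[OF L(2) l'(2) L(4) ht, of "[]" "[]"] EEL by simp
    then have "length L = length l'"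
      by (rule map_eq_imp_length_eq)
    then have "L = l' \<and> EE (t @ val []) ((h0 @ t') @ val [])"
      using L l' ht EEL by (intro suffix_eq) simp_all
    then have Ll: "L = l'" and "EE t (h0 @ t')"
      by simp_all
    then have "E True t (h0 @ t')"
      using EE_imp_E T_words(1)[OF L(4)] T_words(1)[OF ht] by blast
    then obtain a where a: "a \<in> words X" "special U Q t (\<rho> @ a)"
      using \<rho>(2)[OF l'(5) T_words(1)[OF l'(4)]] by blast
    have "special U Q w ((\<rho> @ a) @ val L)"
      using rtranclp_trans[OF L(1) special_appendR[OF a(2) red_seq_val[OF L(2)]]] .
    moreover have "val L \<in> words X"
      using l'(6) val_words Ll by blast
    ultimately show ?thesis
      using a(1) by (intro bexI[of _ "a @ val L"]) simp_all
  qed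
  moreover have "\<rho> \<in> words U"
    using S_words[OF \<rho>(1)] .
  ultimately show ?thesis
    unfolding C_def by blast
qed

lemma coset_property_amalgam: "coset_property U Q"
  unfolding coset_property_def
proof (intro allI impI ballI)
  fix X g assume X: "X \<subseteq> U" and g: "g \<in> words U"
  define P where "P l \<longleftrightarrow> red_seq l \<and> rep_seq l \<and> (\<exists>h\<in>words T. val l @ h \<in> coset U Q X g)" for l
  obtain l h where l: "special U Q g (val l @ h)" "red_seq l" "rep_seq l" "h \<in> words T"
    using left_normalise[OF g] .
  have "EE (val l @ h) (g @ [])"
    using pres_eq.sym[OF special_EE[OF l(1) g]] by simp
  then have "P l"
    unfolding P_def coset_def using l words_simps(1) by blast
  \<comment> \<open>The fewest syllables occurring in the coset: zero leads to the base case,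
    otherwise the last syllable is split off and the rest serves as the fixed prefix.\<close>
  then obtain l0 where l0: "P l0" "\<And>l. P l \<Longrightarrow> length l0 \<le> length l"
    using ex_has_least_nat[of P l length] by blast
  obtain h0 where h0: "h0 \<in> words T" "val l0 @ h0 \<in> coset U Q X g" and red: "red_seq l0" "rep_seq l0"
    using l0(1) unfolding P_def by blast
  show "\<exists>r\<in>words U. \<forall>w\<in>coset U Q X g. \<exists>a\<in>words X. special U Q w (r @ a)"
  proof (cases l0 rule: rev_cases)
    case Nil
    then show ?thesis
      using coset_representative_base[OF X h0(1)] h0(2) by simp
  next
    case (snoc l1 p)
    obtain i x where p: "p = (i, x)"
      by (meson surj_pair)
    show ?thesis
    proof (rule coset_representative_minimal[OF X _ _ h0(1)])
      show "red_seq (l1 @ [(i, x)])" "rep_seq (l1 @ [(i, x)])" "val (l1 @ [(i, x)]) @ h0 \<in> coset U Q X g"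
        using red h0(2) unfolding snoc p by simp_all
      fix l h assume "red_seq l" "rep_seq l" "h \<in> words T" "val l @ h \<in> coset U Q X g"
      then have "P l"
        unfolding P_def by blast
      then show "length l1 < length l"
        using l0(2)[of l] snoc by simp
    qed
  qed
qed

end

section \<open>Type FC and Property H\<close>

lemma type_FC_coset_property:
  assumes "type_FC S R"
  shows "braid_pres S R \<and> coset_property S R"
  using assms
proof induction
  case (spherical S R)
  then show ?case
    using spherical_coset_property artin_tits_braid_pres unfolding spherical_def by blast
next
  case (amalgam S1 R1 S2 R2)
  interpret amalgam "\<lambda>i. if i then S1 else S2" "\<lambda>i. if i then R1 else R2"
  proof
    fix i :: bool
    show "braid_pres (if i then S1 else S2) (if i then R1 else R2)"
      "coset_property (if i then S1 else S2) (if i then R1 else R2)"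
      using amalgam.IH by simp_all
  next
    fix h h' :: "'a letter list"
    assume "h \<in> words ((if True then S1 else S2) \<inter> (if False then S1 else S2))"
      "h' \<in> words ((if True then S1 else S2) \<inter> (if False then S1 else S2))"
    then show "pres_eq (if True then S1 else S2) (if True then R1 else R2) h h' \<longleftrightarrow>
        pres_eq (if False then S1 else S2) (if False then R1 else R2) h h'"
      using amalgam_position_pres_eq[OF amalgam.hyps(3)] by simp
  qed
  show ?case
    using bp_union coset_property_amalgam by simp
qed

theorem proposition2p1:
  fixes S :: "'a set" and R :: "'a list uprod set"
  assumes "type_FC S R"
  shows "property_H S R"
  unfolding property_H_def
proof (intro ballI impI)
  fix w assume w: "w \<in> words S" "word_class S R w = \<one>\<^bsub>pres_group S R\<^esub>"
  have bp: "braid_pres S R" and cp: "coset_property S R"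
    using type_FC_coset_property[OF assms] by blast+
  obtain r where r: "\<forall>w\<in>coset S R {} []. \<exists>h\<in>words {}. special S R w (r @ h)"
    using cp unfolding coset_property_def by (meson empty_subsetI words_simps(1))
  have "[] \<in> coset S R {} []"
    by (rule coset_refl) simp
  \<comment> \<open>The empty word lies in its own trivial coset and words over the empty alphabet
    are empty, so it is transformed into \<open>r\<close> itself.\<close>
  then have "special S R [] r"
    using r by force
  then have "r = []"
    using special_Nil[OF bp] by blast
  have "pres_eq S R w []"
    using w by (simp add: pres_group_simps word_class_eq_iff)
  then have "w \<in> coset S R {} []"
    unfolding coset_def by simp
  then show "special S R w []"
    using r \<open>r = []\<close> by force
qed

end
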